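(* Let $G$ be a second-countable locally compact non-compact group with left Haar measure $\mu$, $S\subset G$, $1\le p<+\infty$, and let $\omega$ be a locally $p$-integrable $S$-admissible weight on $G$. If the subgroup of $G$ generated by $S$ is abelian, then: (1) There is an $S$-dense vector in $L^p(G,\omega)$ if and only if for any compact subset $F\subset G$ and $\varepsilon>0$, there are $s\in S$ and a compact subset $E\subset F$ such that $\mu(F\setminus E)<\varepsilon$ and $$\operatorname*{ess\,sup}_{t\in E}\omega(st)<\varepsilon,\qquad\operatorname*{ess\,sup}_{t\in E}\omega(s^{-1}t)<\varepsilon.$$ (2) There is a $([0,1],S)$-dense vector in $L^p(G,\omega)$ if and only if for any compact subset $F\subset G$ and $\varepsilon>0$, there are $s\in S$ and a compact subset $E\subset F$ such that $\mu(F\setminus E)<\varepsilon$ and $$\operatorname*{ess\,sup}_{t\in E}\omega(s^{-1}t)<\varepsilon,\qquad\operatorname*{ess\,sup}_{t\in E}\omega(st)\;\operatorname*{ess\,sup}_{t\in E}\omega(s^{-1}t)<\varepsilon.$$ (3) There is a $([1,+\infty),S)$-dense vector in $L^p(G,\omega)$ if and only if for any compact subset $F\subset G$ and $\varepsilon>0$, there are $s\in S$ and a compact subset $E\subset F$ such that $\mu(F\setminus E)<\varepsilon$ and $$\operatorname*{ess\,sup}_{t\in E}\omega(st)<\varepsilon,\qquad\operatorname*{ess\,sup}_{t\in E}\omega(st)\;\operatorname*{ess\,sup}_{t\in E}\omega(s^{-1}t)<\varepsilon.$$ (4) There is a $(\mathbb{C},S)$-dense vector in $L^p(G,\omega)$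 if and only if for any compact subset $F\subset G$ and $\varepsilon>0$, there are $s\in S$ and a compact subset $E\subset F$ such that $\mu(F\setminus E)<\varepsilon$ and $$\operatorname*{ess\,sup}_{t\in E}\omega(st)\;\operatorname*{ess\,sup}_{t\in E}\omega(s^{-1}t)<\varepsilon.$$
   Context: A weight on $G$ is a positive measurable function $\omega:G\to(0,+\infty)$; it is locally $p$-integrable if $\int_K\omega^p\,d\mu<+\infty$ for every compact $K\subset G$. $L^p(G,\omega)$ is the space of measurable $f:G\to\mathbb{C}$ (modulo a.e. equality) with $\|f\|_{p,\omega}:=\left(\int_G|f(t)|^p\omega(t)^p\,d\mu(t)\right)^{1/p}<\infty$, with this norm. For $s\in G$, the left translation is $(T_sf)(t)=f(s^{-1}t)$. The weight $\omega$ is $S$-admissible if $\operatorname{ess\,sup}_{t\in G}\omega(st)/\omega(t)<+\infty$ for all $s\in S$ (equivalently, $T_s$ is a bounded operator of $L^p(G,\omega)$ into itself for every $s\in S$). A vector $f\in L^p(G,\omega)$ is $S$-dense if $\{T_sf:\ s\in S\}$ is dense in $L^p(G,\omega)$; for $\Lambda\subset\mathbb{C}$ it is $(\Lambda,S)$-dense if $\{\lambda T_sf:\ \lambda\in\Lambda,\ s\in S\}$ is dense in $L^p(G,\omega)$. Essential suprema of $\omega$ over empty or null sets are taken to be $0$. *)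

theory Defs
  imports "HOL-Analysis.Analysis" "HOL-Probability.Essential_Supremum"
begin

text \<open>
  Groups are written additively, following \<^class>\<open>topological_group_add\<close>, but are \<^emph>\<open>not\<close>
  assumed commutative: \<open>s + t\<close>, \<open>- s + t\<close> and \<open>0\<close> stand for \<open>s t\<close>, \<open>s\<inverse> t\<close> and the
  neutral element.
\<close>

definition add_subgroup :: "'g::group_add set \<Rightarrow> bool" where
  "add_subgroup H \<longleftrightarrow> 0 \<in> H \<and> (\<forall>x\<in>H. \<forall>y\<in>H. x + y \<in> H) \<and> (\<forall>x\<in>H. - x \<in> H)"

definition generated_subgroup :: "'g::group_add set \<Rightarrow> 'g set" where
  "generated_subgroup S = add_subgroup hull S"

definition abelian_set :: "'g::group_add set \<Rightarrow> bool" where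
  "abelian_set H \<longleftrightarrow> (\<forall>x\<in>H. \<forall>y\<in>H. x + y = y + x)"

text \<open>A left Haar measure is a nonzero left-invariant Radon measure on the Borel sets.\<close>

definition left_haar_measure :: "'g::topological_group_add measure \<Rightarrow> bool" where
  "left_haar_measure \<mu> \<longleftrightarrow>
     sets \<mu> = sets borel \<and>
     emeasure \<mu> UNIV \<noteq> 0 \<and>
     (\<forall>K. compact K \<longrightarrow> emeasure \<mu> K < \<infinity>) \<and>
     (\<forall>A\<in>sets borel. emeasure \<mu> A = (INF U\<in>{U. open U \<and> A \<subseteq> U}. emeasure \<mu> U)) \<and>
     (\<forall>U. open U \<longrightarrow> emeasure \<mu> U = (SUP K\<in>{K. compact K \<and> K \<subseteq> U}. emeasure \<mu> K)) \<and>
     (\<forall>s. \<forall>A\<in>sets borel. emeasure \<mu> ((+) s ` A) = emeasure \<mu> A)"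

definition weight :: "'g measure \<Rightarrow> ('g \<Rightarrow> real) \<Rightarrow> bool" where
  "weight \<mu> \<omega> \<longleftrightarrow> \<omega> \<in> borel_measurable \<mu> \<and> (\<forall>t. 0 < \<omega> t)"

definition locally_p_integrable ::
    "'g::topological_space measure \<Rightarrow> real \<Rightarrow> ('g \<Rightarrow> real) \<Rightarrow> bool" where
  "locally_p_integrable \<mu> p \<omega> \<longleftrightarrow>
     (\<forall>K. compact K \<longrightarrow> (\<integral>\<^sup>+ t\<in>K. ennreal (\<omega> t powr p) \<partial>\<mu>) < \<infinity>)"

definition admissible :: "'g::group_add measure \<Rightarrow> 'g set \<Rightarrow> ('g \<Rightarrow> real) \<Rightarrow> bool" where
  "admissible \<mu> S \<omega> \<longleftrightarrow> (\<forall>s\<in>S. esssup \<mu> (\<lambda>t. ennreal (\<omega> (s + t) / \<omega> t)) < \<infinity>)"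

text \<open>
  The essential supremum over a set, for nonnegative functions. Since the values lie in
  \<^typ>\<open>ennreal\<close>, whose least element is 0, it is 0 over an empty or null set.
\<close>

definition esssup_on :: "'g measure \<Rightarrow> 'g set \<Rightarrow> ('g \<Rightarrow> real) \<Rightarrow> ennreal" where
  "esssup_on \<mu> E f = esssup (restrict_space \<mu> E) (\<lambda>t. ennreal (f t))"

text \<open>
  The weighted space is represented by functions rather than by classes modulo a.e. equality;
  \<open>wLp_norm\<close> is then a seminorm vanishing exactly on the functions that are a.e. 0, so that
  density in the seminormed space of functions is density in its quotient.
\<close>

definition wLp :: "'g measure \<Rightarrow> real \<Rightarrow> ('g \<Rightarrow> real) \<Rightarrow> ('g \<Rightarrow> complex) set" where
  "wLp \<mu> p \<omega> =
     {f. f \<in> borel_measurable \<mu> \<and> integrable \<mu> (\<lambda>t. norm (f t) powr p * \<omega> t powr p)}"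

definition wLp_norm :: "'g measure \<Rightarrow> real \<Rightarrow> ('g \<Rightarrow> real) \<Rightarrow> ('g \<Rightarrow> complex) \<Rightarrow> real" where
  "wLp_norm \<mu> p \<omega> f = (\<integral>t. norm (f t) powr p * \<omega> t powr p \<partial>\<mu>) powr (1 / p)"

definition dense_in_wLp ::
    "'g measure \<Rightarrow> real \<Rightarrow> ('g \<Rightarrow> real) \<Rightarrow> ('g \<Rightarrow> complex) set \<Rightarrow> bool" where
  "dense_in_wLp \<mu> p \<omega> D \<longleftrightarrow>
     D \<subseteq> wLp \<mu> p \<omega> \<and>
     (\<forall>g\<in>wLp \<mu> p \<omega>. \<forall>e>0. \<exists>d\<in>D. wLp_norm \<mu> p \<omega> (\<lambda>t. g t - d t) < e)"

definition translate :: "'g::group_add \<Rightarrow> ('g \<Rightarrow> complex) \<Rightarrow> 'g \<Rightarrow> complex" where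
  "translate s f = (\<lambda>t. f (- s + t))"

definition S_dense_vector ::
    "'g::group_add measure \<Rightarrow> real \<Rightarrow> ('g \<Rightarrow> real) \<Rightarrow> 'g set \<Rightarrow> ('g \<Rightarrow> complex) \<Rightarrow> bool" where
  "S_dense_vector \<mu> p \<omega> S f \<longleftrightarrow>
     f \<in> wLp \<mu> p \<omega> \<and> dense_in_wLp \<mu> p \<omega> {translate s f |s. s \<in> S}"

definition LS_dense_vector ::
    "'g::group_add measure \<Rightarrow> real \<Rightarrow> ('g \<Rightarrow> real) \<Rightarrow> complex set \<Rightarrow> 'g set \<Rightarrow>
     ('g \<Rightarrow> complex) \<Rightarrow> bool" where
  "LS_dense_vector \<mu> p \<omega> \<Lambda> S f \<longleftrightarrow>
     f \<in> wLp \<mu> p \<omega> \<and>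
     dense_in_wLp \<mu> p \<omega> {(\<lambda>t. c * translate s f t) |c s. c \<in> \<Lambda> \<and> s \<in> S}"

end

(*
  For every set L of scalars, an (L,S)-dense vector exists if and only if for all compact F and
  e > 0 there are s in S, a nonzero c in L and a compact E in F, with F - E of measure below e,
  such that |c| w(s t) <= e and w(s^-1 t) <= e |c| for almost all t in E. For the four sets L of
  the theorem, choosing c turns this into the stated conditions on essential suprema.

  Sufficiency: given bounded compactly supported u, v, the function u 1_E + c^-1 T_s^-1 (v 1_E) is
  close to u and is mapped by c T_s close to v. Iterating this along a countable dense sequence of
  targets v, with corrections that decrease fast enough to survive the bounded operators already
  used, gives a dense vector as a limit.

  Necessity: as the operators commute and have dense range, every nonzero multiple of a translate
  of a dense vector is dense again. So there are a dense vector h close to the indicator of F and,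
  for any target v, a pair c, s with c T_s h close to v. Where v stays away from c 1_F, the values
  of c T_s h contradict h being close to the indicator unless w is small there. A target separated
  from every multiple c 1_F is a step function with values 4^i if points are null sets; otherwise
  G is discrete, and a counting argument provides s with F and s F disjoint.
*)

theory Submission
  imports Defs
begin

section \<open>The modular of the weighted space\<close>

text \<open>The scalar \<open>c\<close> comes with the \<open>s\<close> that density supplies, so
  the target must be fixed before \<open>c\<close> is known. The ratio 4 between successive values
  leaves room for errors below 1/4 and makes the sets of z with |z - 4^i| < |z|/2 disjoint. Relative
  closeness is needed because |c| may be arbitrarily large or small. The free \<open>c\<close> also
  explains the product conditions. If a and b are the suprema of w(s t) and w(s^-1 t), a scalar with
  |c| a and b / |c| both at most e exists as soon as a b <= e^2, and restricting |c| to [0,1] or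
  [1,infinity) adds a bound on one factor. The loss of a square is harmless since e is
  arbitrary.\<close>

locale weighted_Lp =
  fixes \<mu> :: "'g::{topological_group_add, t2_space, second_countable_topology} measure"
    and p :: real and \<omega> :: "'g \<Rightarrow> real"
  assumes loc_compact: "locally_compact_space (euclidean :: 'g topology)"
    and haar: "left_haar_measure \<mu>"
    and p_ge_1: "1 \<le> p"
    and weight: "weight \<mu> \<omega>"
    and loc_integrable: "locally_p_integrable \<mu> p \<omega>"
begin

section \<open>The Haar measure and the modular under translations\<close>

lemma sets_eq [measurable_cong]: "sets \<mu> = sets borel"
  using haar by (simp add: left_haar_measure_def)

lemma space_eq [simp]: "space \<mu> = UNIV"
  using sets_eq_imp_space_eq[OF sets_eq] by simp

lemma compact_sets: "compact K \<Longrightarrow> K \<in> sets \<mu>"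
  by (simp add: sets_eq borel_compact)

lemma compact_finite: "compact K \<Longrightarrow> emeasure \<mu> K < \<infinity>"
  using haar by (simp add: left_haar_measure_def)

lemma weight_pos: "0 < \<omega> t"
  using weight by (simp add: weight_def)

lemma weight_measurable [measurable]: "\<omega> \<in> borel_measurable borel"
  using weight by (simp add: weight_def measurable_cong_sets[OF sets_eq refl])

lemma measurable_translation [measurable]: "(\<lambda>t. s + t) \<in> borel \<rightarrow>\<^sub>M (borel :: 'g measure)"
  by (intro borel_measurable_continuous_onI continuous_intros)

lemma distr_translation: "distr \<mu> \<mu> (\<lambda>t. s + t) = \<mu>"
proof (rule measure_eqI)
  fix A assume "A \<in> sets (distr \<mu> \<mu> (\<lambda>t. s + t))"
  then have A[measurable]: "A \<in> sets borel" by (simp add: sets_eq)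
  have "emeasure (distr \<mu> \<mu> (\<lambda>t. s + t)) A = emeasure \<mu> ((\<lambda>t. s + t) -` A)"
    by (subst emeasure_distr) (auto simp: sets_eq)
  also have "(\<lambda>t. s + t) -` A = (+) (- s) ` A"
    by (force simp: image_iff add.assoc[symmetric])
  also have "emeasure \<mu> \<dots> = emeasure \<mu> A"
    using haar A by (simp add: left_haar_measure_def)
  finally show "emeasure (distr \<mu> \<mu> (\<lambda>t. s + t)) A = emeasure \<mu> A" .
qed simp

lemma nn_integral_translation:
  assumes [measurable]: "f \<in> borel_measurable borel"
  shows "(\<integral>\<^sup>+ t. f (s + t) \<partial>\<mu>) = (\<integral>\<^sup>+ t. f t \<partial>\<mu>)"
proof -
  have "(\<integral>\<^sup>+ t. f t \<partial>\<mu>) = (\<integral>\<^sup>+ t. f t \<partial>distr \<mu> \<mu> (\<lambda>t. s + t))"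
    by (simp add: distr_translation)
  also have "\<dots> = (\<integral>\<^sup>+ t. f (s + t) \<partial>\<mu>)"
    by (rule nn_integral_distr) auto
  finally show ?thesis ..
qed

lemma emeasure_translation:
  assumes [measurable]: "A \<in> sets borel"
  shows "emeasure \<mu> {t. s + t \<in> A} = emeasure \<mu> A"
proof -
  have m: "{t. s + t \<in> A} \<in> sets \<mu>"
    by measurable
  have "emeasure \<mu> {t. s + t \<in> A} = (\<integral>\<^sup>+ t. indicator A (s + t) \<partial>\<mu>)"
    unfolding nn_integral_indicator[OF m, symmetric]
    by (rule nn_integral_cong) (simp add: indicator_def)
  also have "\<dots> = (\<integral>\<^sup>+ t. indicator A t \<partial>\<mu>)"
    by (rule nn_integral_translation) measurable
  finally show ?thesis by (simp add: sets_eq)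
qed

text \<open>
  The modular is the \<open>p\<close>-th power of the norm. It satisfies only the quasi-triangle inequality
  \<open>modular_add_le\<close>, which is enough below and avoids Minkowski's inequality.
\<close>

definition modular :: "('g \<Rightarrow> complex) \<Rightarrow> ennreal" where
  "modular f = (\<integral>\<^sup>+ t. ennreal (norm (f t) powr p * \<omega> t powr p) \<partial>\<mu>)"

lemma p_pos: "0 < p" using p_ge_1 by simp

lemma wLp_iff: "f \<in> wLp \<mu> p \<omega> \<longleftrightarrow> f \<in> borel_measurable borel \<and> modular f < \<infinity>"
proof -
  have "f \<in> borel_measurable \<mu> \<longleftrightarrow> f \<in> borel_measurable borel"
    by (simp add: measurable_cong_sets[OF sets_eq refl])
  moreover have "integrable \<mu> (\<lambda>t. norm (f t) powr p * \<omega> t powr p) \<longleftrightarrow> modular f < \<infinity>"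
    if [measurable]: "f \<in> borel_measurable borel"
    unfolding integrable_iff_bounded modular_def
    by (simp add: measurable_cong_sets[OF sets_eq refl] abs_mult)
  ultimately show ?thesis
    by (auto simp: wLp_def)
qed

lemma wLp_norm_less_iff:
  assumes "f \<in> wLp \<mu> p \<omega>" "0 < e"
  shows "wLp_norm \<mu> p \<omega> f < e \<longleftrightarrow> modular f < ennreal (e powr p)"
proof -
  let ?I = "\<integral>t. norm (f t) powr p * \<omega> t powr p \<partial>\<mu>"
  have int: "integrable \<mu> (\<lambda>t. norm (f t) powr p * \<omega> t powr p)"
    using assms by (simp add: wLp_def)
  have I: "0 \<le> ?I" by simp
  have "modular f = ennreal ?I"
    unfolding modular_def by (rule nn_integral_eq_integral[OF int]) simp
  then have "modular f < ennreal (e powr p) \<longleftrightarrow> ?I < e powr p"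
    by (simp add: ennreal_less_iff)
  also have "\<dots> \<longleftrightarrow> ?I powr (1 / p) < e"
  proof -
    have "?I < e powr p \<longleftrightarrow> ?I powr (1 / p) < (e powr p) powr (1 / p)"
      using p_pos I by (meson not_less powr_less_mono2 powr_mono2 powr_ge_zero
          divide_pos_pos zero_less_one less_imp_le)
    then show ?thesis using p_pos assms(2) by (simp add: powr_powr)
  qed
  finally show ?thesis by (simp add: wLp_norm_def)
qed

lemma modular_add_le:
  assumes [measurable]: "f \<in> borel_measurable borel" "g \<in> borel_measurable borel"
    and le: "\<And>t. norm (h t) \<le> norm (f t) + norm (g t)"
  shows "modular h \<le> ennreal (2 powr p) * (modular f + modular g)"
proof -
  have *: "norm (h t) powr p * \<omega> t powr p \<le>
      2 powr p * (norm (f t) powr p * \<omega> t powr p) + 2 powr p * (norm (g t) powr p * \<omega> t powr p)" for t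
  proof -
    have "norm (h t) powr p \<le> (2 * max (norm (f t)) (norm (g t))) powr p"
      using le[of t] p_pos by (intro powr_mono2) auto
    also have "\<dots> = 2 powr p * max (norm (f t)) (norm (g t)) powr p"
      by (simp add: powr_mult)
    also have "\<dots> \<le> 2 powr p * (norm (f t) powr p + norm (g t) powr p)"
      by (intro mult_left_mono) (auto simp: max_def)
    finally have "norm (h t) powr p * \<omega> t powr p
        \<le> 2 powr p * (norm (f t) powr p + norm (g t) powr p) * \<omega> t powr p"
      by (rule mult_right_mono) simp
    then show ?thesis by (simp add: algebra_simps)
  qed
  have "modular h \<le> (\<integral>\<^sup>+ t. ennreal (2 powr p) * ennreal (norm (f t) powr p * \<omega> t powr p)
      + ennreal (2 powr p) * ennreal (norm (g t) powr p * \<omega> t powr p) \<partial>\<mu>)"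
    unfolding modular_def
    by (intro nn_integral_mono) (simp add: * ennreal_plus[symmetric] ennreal_mult'[symmetric]
        del: ennreal_plus)
  also have "\<dots> = ennreal (2 powr p) * (modular f + modular g)"
    unfolding modular_def
    by (simp add: nn_integral_add nn_integral_cmult distrib_left measurable_cong_sets[OF sets_eq refl])
  finally show ?thesis .
qed

lemma modular_cmult:
  assumes [measurable]: "f \<in> borel_measurable borel"
  shows "modular (\<lambda>t. c * f t) = ennreal (norm c powr p) * modular f"
  unfolding modular_def
  by (subst nn_integral_cmult[symmetric])
    (simp_all add: norm_mult powr_mult ennreal_mult'[symmetric] mult.assoc
      measurable_cong_sets[OF sets_eq refl])

lemma modular_uminus_commute: "modular (\<lambda>t. f t - g t) = modular (\<lambda>t. g t - f t)"
  by (simp add: modular_def norm_minus_commute)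

lemma translate_measurable [measurable]:
  "f \<in> borel_measurable borel \<Longrightarrow> translate s f \<in> borel_measurable (borel :: 'g measure)"
  unfolding translate_def by (rule measurable_compose[OF measurable_translation])

lemma modular_translate:
  assumes [measurable]: "f \<in> borel_measurable borel"
  shows "modular (translate s f) = (\<integral>\<^sup>+ t. ennreal (norm (f t) powr p * \<omega> (s + t) powr p) \<partial>\<mu>)"
proof -
  have "modular (translate s f)
      = (\<integral>\<^sup>+ t. ennreal (norm (translate s f (s + t)) powr p * \<omega> (s + t) powr p) \<partial>\<mu>)"
    unfolding modular_def by (rule nn_integral_translation[symmetric]) simp
  then show ?thesis by (simp add: translate_def add.assoc[symmetric])
qed

lemma modular_translate_bounded:
  assumes "admissible \<mu> S \<omega>" "s \<in> S"
  obtains C where "0 < C"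
    "\<And>f. f \<in> borel_measurable borel \<Longrightarrow> modular (translate s f) \<le> ennreal C * modular f"
proof -
  let ?m = "esssup \<mu> (\<lambda>t. ennreal (\<omega> (s + t) / \<omega> t))"
  have "?m < \<infinity>" using assms by (simp add: admissible_def)
  then obtain b where b: "0 \<le> b" "?m = ennreal b"
    by (cases ?m) auto
  have "AE t in \<mu>. ennreal (\<omega> (s + t) / \<omega> t) \<le> ennreal b"
    using esssup_AE[of "\<lambda>t. ennreal (\<omega> (s + t) / \<omega> t)" \<mu>] b by simp
  \<comment> \<open>\<open>b\<close> is only known to be nonnegative; \<open>b + 1\<close> gives a
    strictly positive constant, by which later steps divide.\<close>
  then have ae: "AE t in \<mu>. \<omega> (s + t) \<le> (b + 1) * \<omega> t"
  proof eventually_elim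
    case (elim t)
    have "\<omega> (s + t) / \<omega> t \<le> b + 1" using elim b weight_pos[of t] by simp
    then show ?case using weight_pos[of t] by (simp add: pos_divide_le_eq)
  qed
  show ?thesis
  proof
    show "0 < (b + 1) powr p" using b by simp
    fix f :: "'g \<Rightarrow> complex" assume [measurable]: "f \<in> borel_measurable borel"
    have "modular (translate s f)
        \<le> (\<integral>\<^sup>+ t. ennreal ((b + 1) powr p) * ennreal (norm (f t) powr p * \<omega> t powr p) \<partial>\<mu>)"
      unfolding modular_translate[OF \<open>f \<in> borel_measurable borel\<close>]
    proof (rule nn_integral_mono_AE, use ae in eventually_elim)
      case (elim t)
      have "\<omega> (s + t) powr p \<le> (b + 1) powr p * \<omega> t powr p"
        using elim b p_pos weight_pos[of t] weight_pos[of "s + t"]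
        by (simp flip: powr_mult add: powr_mono2 less_imp_le)
      then have "norm (f t) powr p * \<omega> (s + t) powr p
          \<le> (b + 1) powr p * (norm (f t) powr p * \<omega> t powr p)"
        by (metis mult.left_commute mult_left_mono powr_ge_zero)
      then show ?case by (simp add: ennreal_mult'[symmetric])
    qed
    also have "\<dots> = ennreal ((b + 1) powr p) * modular f"
      unfolding modular_def
      by (rule nn_integral_cmult) (simp add: measurable_cong_sets[OF sets_eq refl])
    finally show "modular (translate s f) \<le> ennreal ((b + 1) powr p) * modular f" .
  qed
qed

section \<open>Density expressed by the modular\<close>

lemma wLp_diff:
  assumes "f \<in> wLp \<mu> p \<omega>" "g \<in> wLp \<mu> p \<omega>"
  shows "(\<lambda>t. f t - g t) \<in> wLp \<mu> p \<omega>"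
proof -
  have "modular (\<lambda>t. f t - g t) \<le> ennreal (2 powr p) * (modular f + modular g)"
    using assms by (intro modular_add_le) (auto simp: wLp_iff norm_triangle_ineq4)
  also have "\<dots> < \<infinity>"
    using assms by (auto simp: wLp_iff ennreal_mult_less_top)
  finally show ?thesis using assms by (auto simp: wLp_iff)
qed

lemma dense_in_wLp_iff:
  assumes "D \<subseteq> wLp \<mu> p \<omega>"
  shows "dense_in_wLp \<mu> p \<omega> D \<longleftrightarrow>
    (\<forall>g\<in>wLp \<mu> p \<omega>. \<forall>e>0. \<exists>d\<in>D. modular (\<lambda>t. g t - d t) < ennreal e)"
proof -
  have iff: "wLp_norm \<mu> p \<omega> (\<lambda>t. g t - d t) < e
      \<longleftrightarrow> modular (\<lambda>t. g t - d t) < ennreal (e powr p)"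
    if "g \<in> wLp \<mu> p \<omega>" "d \<in> D" "0 < e" for g d e
    using that assms by (intro wLp_norm_less_iff wLp_diff) auto
  show ?thesis
  proof (intro iffI ballI allI impI)
    fix g and e :: real
    assume "dense_in_wLp \<mu> p \<omega> D" "g \<in> wLp \<mu> p \<omega>" "0 < e"
    then obtain d where "d \<in> D" "wLp_norm \<mu> p \<omega> (\<lambda>t. g t - d t) < e powr (1 / p)"
      unfolding dense_in_wLp_def by (metis powr_gt_zero less_numeral_extra(3))
    then have "modular (\<lambda>t. g t - d t) < ennreal ((e powr (1 / p)) powr p)"
      using iff[OF \<open>g \<in> wLp \<mu> p \<omega>\<close>, of d "e powr (1 / p)"] \<open>0 < e\<close> by simp
    then show "\<exists>d\<in>D. modular (\<lambda>t. g t - d t) < ennreal e"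
      using \<open>d \<in> D\<close> \<open>0 < e\<close> p_pos by (auto simp: powr_powr)
  next
    assume *: "\<forall>g\<in>wLp \<mu> p \<omega>. \<forall>e>0. \<exists>d\<in>D. modular (\<lambda>t. g t - d t) < ennreal e"
    show "dense_in_wLp \<mu> p \<omega> D"
      unfolding dense_in_wLp_def
    proof (intro conjI ballI allI impI assms)
      fix g and e :: real
      assume g: "g \<in> wLp \<mu> p \<omega>" and e: "0 < e"
      then obtain d where "d \<in> D" "modular (\<lambda>t. g t - d t) < ennreal (e powr p)"
        using * by (metis powr_gt_zero less_numeral_extra(3))
      then show "\<exists>d\<in>D. wLp_norm \<mu> p \<omega> (\<lambda>t. g t - d t) < e"
        using iff[OF g _ e] by blast
    qed
  qed
qed

text \<open>\<open>bcs\<close>: bounded Borel functions with compact support.\<close>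

definition bcs :: "('g \<Rightarrow> complex) set" where
  "bcs = {f \<in> borel_measurable borel.
     \<exists>K M. compact K \<and> 0 < M \<and> (\<forall>t. norm (f t) \<le> M) \<and> (\<forall>t. t \<notin> K \<longrightarrow> f t = 0)}"

lemma bcs_measurable: "f \<in> bcs \<Longrightarrow> f \<in> borel_measurable borel"
  by (simp add: bcs_def)

text \<open>The measure with density \<open>\<omega> powr p\<close> with respect to
  \<open>\<mu>\<close>; the modular is the integral of \<open>norm f powr p\<close> against
  it.\<close>

definition wmeas :: "'g set \<Rightarrow> ennreal" where
  "wmeas A = (\<integral>\<^sup>+ t. ennreal (\<omega> t powr p) * indicator A t \<partial>\<mu>)"

lemma wmeas_compact: "compact K \<Longrightarrow> wmeas K < \<infinity>"
  using loc_integrable by (simp add: wmeas_def locally_p_integrable_def)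

lemma modular_le_wmeas:
  assumes "\<And>t. norm (f t) \<le> M" "\<And>t. t \<notin> A \<Longrightarrow> f t = 0" "0 \<le> M" "A \<in> sets borel"
  shows "modular f \<le> ennreal (M powr p) * wmeas A"
proof -
  have "modular f \<le> (\<integral>\<^sup>+ t. ennreal (M powr p) * (ennreal (\<omega> t powr p) * indicator A t) \<partial>\<mu>)"
    unfolding modular_def
  proof (rule nn_integral_mono)
    fix t
    show "ennreal (norm (f t) powr p * \<omega> t powr p)
        \<le> ennreal (M powr p) * (ennreal (\<omega> t powr p) * indicator A t)"
    proof (cases "t \<in> A")
      case True
      have "norm (f t) powr p * \<omega> t powr p \<le> M powr p * \<omega> t powr p"
        using assms p_pos by (intro mult_right_mono powr_mono2) auto
      with True show ?thesis by (simp add: ennreal_mult'[symmetric])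
    next
      case False
      with assms(2) p_pos show ?thesis by simp
    qed
  qed
  also have "\<dots> = ennreal (M powr p) * wmeas A"
    unfolding wmeas_def using assms(4)
    by (intro nn_integral_cmult) (simp add: measurable_cong_sets[OF sets_eq refl])
  finally show ?thesis .
qed

lemma bcs_wLp: "f \<in> bcs \<Longrightarrow> f \<in> wLp \<mu> p \<omega>"
proof -
  assume f: "f \<in> bcs"
  then obtain K M where K: "compact K" "0 < M" "\<And>t. norm (f t) \<le> M" "\<And>t. t \<notin> K \<Longrightarrow> f t = 0"
    by (auto simp: bcs_def)
  have "modular f \<le> ennreal (M powr p) * wmeas K"
    using K by (intro modular_le_wmeas) (auto simp: borel_compact)
  also have "\<dots> < \<infinity>" using wmeas_compact[OF K(1)] by (simp add: ennreal_mult_less_top)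
  finally show ?thesis using f by (simp add: wLp_iff bcs_def)
qed

lemma bcs_cmult: assumes "f \<in> bcs" shows "(\<lambda>t. c * f t) \<in> bcs"
proof -
  from assms obtain K M where K: "compact K" "0 < M" "\<And>t. norm (f t) \<le> M" "\<And>t. t \<notin> K \<Longrightarrow> f t = 0"
    by (auto simp: bcs_def)
  have "0 < (norm c + 1) * M" using K by (auto simp: intro!: mult_pos_pos add_nonneg_pos)
  moreover have "norm (c * f t) \<le> (norm c + 1) * M" for t
    using K by (auto simp: norm_mult intro!: mult_mono)
  ultimately show ?thesis using assms K unfolding bcs_def
    by (auto intro!: exI[of _ K] exI[of _ "(norm c + 1) * M"])
qed

lemma bcs_add: assumes "f \<in> bcs" "g \<in> bcs" shows "(\<lambda>t. f t + g t) \<in> bcs"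
proof -
  from assms obtain K M where K: "compact K" "0 < M" "\<And>t. norm (f t) \<le> M" "\<And>t. t \<notin> K \<Longrightarrow> f t = 0"
    by (auto simp: bcs_def)
  from assms obtain K' M' where K': "compact K'" "0 < M'" "\<And>t. norm (g t) \<le> M'" "\<And>t. t \<notin> K' \<Longrightarrow> g t = 0"
    by (auto simp: bcs_def)
  have "norm (f t + g t) \<le> M + M'" for t
    using K K' by (meson add_mono norm_triangle_le)
  with K K' assms show ?thesis unfolding bcs_def
    by (auto intro!: exI[of _ "K \<union> K'"] exI[of _ "M + M'"])
qed

lemma bcs_translate: assumes "f \<in> bcs" shows "translate s f \<in> bcs"
proof -
  from assms obtain K M where K: "compact K" "0 < M" "\<And>t. norm (f t) \<le> M" "\<And>t. t \<notin> K \<Longrightarrow> f t = 0"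
    by (auto simp: bcs_def)
  have "compact ((+) s ` K)"
    by (intro compact_continuous_image K(1) continuous_intros)
  moreover have "f (- s + t) = 0" if "t \<notin> (+) s ` K" for t
  proof (rule K(4))
    show "- s + t \<notin> K"
      using that by (metis add_minus_cancel imageI)
  qed
  moreover have "translate s f \<in> borel_measurable borel"
    using assms by (intro translate_measurable) (simp add: bcs_def)
  ultimately show ?thesis using K unfolding bcs_def
    by (auto simp: translate_def intro!: exI[of _ "(+) s ` K"] exI[of _ M])
qed

lemma bcs_restrict: assumes "f \<in> bcs" "A \<in> sets borel" shows "(\<lambda>t. f t * indicator A t) \<in> bcs"
proof -
  from assms obtain K M where K: "compact K" "0 < M" "\<And>t. norm (f t) \<le> M" "\<And>t. t \<notin> K \<Longrightarrow> f t = 0"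
    by (auto simp: bcs_def)
  moreover have "norm (f t * indicator A t) \<le> M" for t
    using K by (cases "t \<in> A") auto
  ultimately show ?thesis using assms unfolding bcs_def
    by (auto intro!: exI[of _ K] exI[of _ M])
qed


section \<open>Small sets\<close>

text \<open>Markov's inequality. Keeping the weight inside the exceptional set is deliberate: off
  that set, a lower bound on \<open>norm (f t)\<close> becomes an upper bound on
  \<open>\<omega> t\<close>.\<close>

lemma chebyshev:
  assumes [measurable]: "f \<in> borel_measurable borel" and "0 < \<eta>" "0 < \<delta>"
    and le: "modular f \<le> ennreal (\<eta> powr p * \<delta>)"
  shows "emeasure \<mu> {t. \<eta> \<le> norm (f t) * \<omega> t} \<le> ennreal \<delta>"
proof -
  have m: "{t. \<eta> \<le> norm (f t) * \<omega> t} \<in> sets \<mu>"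
    by measurable
  have "ennreal (\<eta> powr p) * emeasure \<mu> {t. \<eta> \<le> norm (f t) * \<omega> t}
      = (\<integral>\<^sup>+ t. ennreal (\<eta> powr p) * indicator {t. \<eta> \<le> norm (f t) * \<omega> t} t \<partial>\<mu>)"
    using m by (simp add: nn_integral_cmult_indicator)
  also have "\<dots> \<le> modular f"
    unfolding modular_def
  proof (rule nn_integral_mono)
    fix t
    have "\<eta> powr p \<le> norm (f t) powr p * \<omega> t powr p" if "\<eta> \<le> norm (f t) * \<omega> t"
      using that p_pos \<open>0 < \<eta>\<close> powr_mono2[of p \<eta> "norm (f t) * \<omega> t"] by (simp add: powr_mult)
    then show "ennreal (\<eta> powr p) * indicator {t. \<eta> \<le> norm (f t) * \<omega> t} t
        \<le> ennreal (norm (f t) powr p * \<omega> t powr p)"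
      by (simp add: indicator_def)
  qed
  also note le
  finally have "ennreal (\<eta> powr p) * emeasure \<mu> {t. \<eta> \<le> norm (f t) * \<omega> t}
      \<le> ennreal (\<eta> powr p) * ennreal \<delta>"
    using assms by (simp add: ennreal_mult')
  then show ?thesis
    using assms by (subst (asm) ennreal_mult_le_mult_iff) auto
qed

text \<open>By left invariance the exceptional set seen from the shifted point has the same measure,
  so the bound is uniform in \<open>s\<close>.\<close>

lemma chebyshev_translation:
  assumes [measurable]: "f \<in> borel_measurable borel" and "0 < \<eta>" "0 < \<delta>"
    and le: "modular f \<le> ennreal (\<eta> powr p * \<delta>)"
  shows "emeasure \<mu> {t. \<eta> \<le> norm (f (s + t)) * \<omega> (s + t)} \<le> ennreal \<delta>"
proof -
  have "{t. \<eta> \<le> norm (f t) * \<omega> t} \<in> sets borel" by measurable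
  from emeasure_translation[OF this, of s] chebyshev[OF assms] show ?thesis by simp
qed

text \<open>The modular controls \<open>norm f * \<omega>\<close>, so a positive lower bound for
  \<open>\<omega>\<close> is required. The subsets \<open>B n\<close> of \<open>F\<close> where
  \<open>\<omega>\<close> is at most 1/(n+1) decrease to the empty set, because
  \<open>\<omega>\<close> is positive everywhere, and \<open>F\<close> has finite measure; one of
  them has measure below \<open>\<delta> / 2\<close> and is discarded.\<close>

lemma small_in_measure:
  assumes F: "compact F" and "0 < \<kappa>" "0 < \<delta>"
  obtains e where "0 < e"
    "\<And>f. f \<in> borel_measurable borel \<Longrightarrow> modular f \<le> ennreal e \<Longrightarrow>
        emeasure \<mu> {t\<in>F. \<kappa> \<le> norm (f t)} \<le> ennreal \<delta>"
proof -
  have Fm[measurable]: "F \<in> sets borel" using F by (rule borel_compact)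
  define B where "B n = {t\<in>F. \<omega> t \<le> 1 / real (Suc n)}" for n
  have B_m: "B n \<in> sets \<mu>" for n unfolding B_def by measurable
  have "(\<lambda>n. emeasure \<mu> (B n)) \<longlonglongrightarrow> emeasure \<mu> (\<Inter>n. B n)"
  proof (rule Lim_emeasure_decseq)
    show "decseq B"
      by (intro decseq_SucI) (auto simp: B_def intro: order_trans[OF _ frac_le])
    show "emeasure \<mu> (B n) \<noteq> \<infinity>" for n
      using emeasure_mono[of "B n" F \<mu>] compact_finite[OF F] compact_sets[OF F]
      by (auto simp: B_def top_unique)
  qed (use B_m in auto)
  moreover have "(\<Inter>n. B n) = {}"
  proof -
    have "t \<notin> (\<Inter>n. B n)" for t
    proof -
      obtain n where "1 / real (Suc n) < \<omega> t"
        using weight_pos[of t] nat_approx_posE by blast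
      then show ?thesis by (auto simp: B_def intro!: exI[of _ n])
    qed
    then show ?thesis by auto
  qed
  ultimately have "(\<lambda>n. emeasure \<mu> (B n)) \<longlonglongrightarrow> 0" by simp
  then have "eventually (\<lambda>n. emeasure \<mu> (B n) < ennreal (\<delta> / 2)) sequentially"
    using \<open>0 < \<delta>\<close> by (intro order_tendstoD) auto
  then obtain n where n: "emeasure \<mu> (B n) < ennreal (\<delta> / 2)"
    by (auto simp: eventually_sequentially)
  define c where "c = 1 / real (Suc n)"
  have c: "0 < c" by (simp add: c_def)
  show ?thesis
  proof
    show "0 < (\<kappa> * c) powr p * (\<delta> / 2)" using assms c by simp
    fix f :: "'g \<Rightarrow> complex"
    assume f[measurable]: "f \<in> borel_measurable borel"
      and le: "modular f \<le> ennreal ((\<kappa> * c) powr p * (\<delta> / 2))"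
    let ?A = "{t. \<kappa> * c \<le> norm (f t) * \<omega> t}"
    have A: "?A \<in> sets \<mu>" by measurable
    have "{t\<in>F. \<kappa> \<le> norm (f t)} \<subseteq> B n \<union> ?A"
    proof
      fix t assume t: "t \<in> {t\<in>F. \<kappa> \<le> norm (f t)}"
      show "t \<in> B n \<union> ?A"
      proof (cases "\<omega> t \<le> c")
        case True
        then show ?thesis using t by (simp add: B_def c_def)
      next
        case False
        then have "\<kappa> * c \<le> norm (f t) * \<omega> t"
          using t c assms by (intro mult_mono) auto
        then show ?thesis by simp
      qed
    qed
    then have "emeasure \<mu> {t\<in>F. \<kappa> \<le> norm (f t)} \<le> emeasure \<mu> (B n \<union> ?A)"
      using A B_m by (intro emeasure_mono) auto
    also have "\<dots> \<le> emeasure \<mu> (B n) + emeasure \<mu> ?A"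
      using A B_m by (intro emeasure_subadditive) auto
    also have "\<dots> \<le> ennreal (\<delta> / 2) + ennreal (\<delta> / 2)"
      using n le assms c by (intro add_mono chebyshev) auto
    also have "\<dots> = ennreal \<delta>" using assms by (simp flip: ennreal_plus)
    finally show "emeasure \<mu> {t\<in>F. \<kappa> \<le> norm (f t)} \<le> ennreal \<delta>" .
  qed
qed

text \<open>Absolute continuity of \<open>wmeas\<close> with respect to \<open>\<mu>\<close> on a
  compact set: the part where \<open>\<omega> powr p\<close> exceeds \<open>n\<close> has small
  \<open>wmeas\<close> by dominated convergence, and elsewhere the density is at most
  \<open>n\<close>.\<close>

lemma wmeas_small:
  assumes F: "compact F" and "0 < e"
  obtains \<delta> where "0 < \<delta>"
    "\<And>B. B \<in> sets borel \<Longrightarrow> B \<subseteq> F \<Longrightarrow> emeasure \<mu> B < ennreal \<delta> \<Longrightarrow> wmeas B \<le> ennreal e"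
proof -
  have Fm[measurable]: "F \<in> sets borel" using F by (rule borel_compact)
  let ?g = "\<lambda>n t. ennreal (\<omega> t powr p) * indicator {t\<in>F. real n < \<omega> t powr p} t"
  have "(\<lambda>n. \<integral>\<^sup>+ t. ?g n t \<partial>\<mu>) \<longlonglongrightarrow> (\<integral>\<^sup>+ t. 0 \<partial>\<mu>)"
  proof (rule nn_integral_dominated_convergence[where w="\<lambda>t. ennreal (\<omega> t powr p) * indicator F t"])
    show "(\<integral>\<^sup>+ t. ennreal (\<omega> t powr p) * indicator F t \<partial>\<mu>) < \<infinity>"
      using wmeas_compact[OF F] by (simp add: wmeas_def)
    show "AE t in \<mu>. (\<lambda>n. ?g n t) \<longlonglongrightarrow> 0"
    proof (rule AE_I2)
      fix t
      obtain k :: nat where "\<omega> t powr p < k" using reals_Archimedean2 by blast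
      then have "eventually (\<lambda>n. ?g n t = 0) sequentially"
        unfolding eventually_sequentially by (intro exI[of _ k]) (auto simp: indicator_def)
      then show "(\<lambda>n. ?g n t) \<longlonglongrightarrow> 0" by (rule tendsto_eventually)
    qed
  qed (auto simp: indicator_def measurable_cong_sets[OF sets_eq refl])
  then have "eventually (\<lambda>n. (\<integral>\<^sup>+ t. ?g n t \<partial>\<mu>) < ennreal (e / 2)) sequentially"
    using \<open>0 < e\<close> by (intro order_tendstoD) auto
  then obtain n where n: "(\<integral>\<^sup>+ t. ?g n t \<partial>\<mu>) < ennreal (e / 2)"
    by (auto simp: eventually_sequentially)
  define m where "m = real n + 1"
  have m: "0 < m" "real n \<le> m" by (simp_all add: m_def)
  show ?thesis
  proof
    show "0 < e / (2 * m)" using assms m by simp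
    fix B :: "'g set"
    assume B[measurable]: "B \<in> sets borel" and "B \<subseteq> F"
      and small: "emeasure \<mu> B < ennreal (e / (2 * m))"
    have "wmeas B \<le> (\<integral>\<^sup>+ t. ?g n t + ennreal m * indicator B t \<partial>\<mu>)"
      unfolding wmeas_def
      using \<open>B \<subseteq> F\<close> m by (intro nn_integral_mono) (auto simp: indicator_def intro!: ennreal_leI)
    also have "\<dots> = (\<integral>\<^sup>+ t. ?g n t \<partial>\<mu>) + ennreal m * emeasure \<mu> B"
      by (simp add: nn_integral_add nn_integral_cmult_indicator sets_eq
          measurable_cong_sets[OF sets_eq refl])
    also have "\<dots> \<le> ennreal (e / 2) + ennreal m * ennreal (e / (2 * m))"
      using n small by (intro add_mono mult_left_mono) auto
    also have "\<dots> = ennreal e"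
      using assms m by (simp flip: ennreal_plus ennreal_mult' add: field_simps)
    finally show "wmeas B \<le> ennreal e" .
  qed
qed

section \<open>Regularity and compact exhaustion\<close>

lemma outer_open:
  assumes "A \<in> sets borel" "emeasure \<mu> A < ennreal e"
  obtains U where "open U" "A \<subseteq> U" "emeasure \<mu> U < ennreal e"
proof -
  have "emeasure \<mu> A = (INF U\<in>{U. open U \<and> A \<subseteq> U}. emeasure \<mu> U)"
    using haar assms by (simp add: left_haar_measure_def)
  with assms(2) have "(INF U\<in>{U. open U \<and> A \<subseteq> U}. emeasure \<mu> U) < ennreal e" by simp
  then show ?thesis using that by (auto simp: INF_less_iff)
qed

text \<open>Inner regularity inside a compact set follows from outer regularity: removing from
  \<open>F\<close> an open set that covers \<open>F - E\<close> leaves a compact subset of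
  \<open>E\<close>.\<close>

lemma inner_compact:
  assumes "compact F" "E \<in> sets borel" "E \<subseteq> F" "emeasure \<mu> (F - E) < ennreal e"
  obtains K where "compact K" "K \<subseteq> E" "emeasure \<mu> (F - K) < ennreal e"
proof -
  have "F - E \<in> sets borel" using assms by (auto simp: borel_compact)
  then obtain U where U: "open U" "F - E \<subseteq> U" "emeasure \<mu> U < ennreal e"
    using outer_open assms by blast
  have "compact (F - U)" using assms(1) U(1) by (rule compact_diff)
  moreover have "F - U \<subseteq> E" using U assms by auto
  moreover have "emeasure \<mu> (F - (F - U)) \<le> emeasure \<mu> U"
    using U by (intro emeasure_mono) (auto simp: sets_eq)
  ultimately show ?thesis using U(3) that by (meson order_le_less_trans)
qed

text \<open>Second countability enters through the Lindelof property: countably many of the open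
  sets contained in compact ones already cover the group.\<close>

lemma compact_exhaustion:
  obtains C :: "nat \<Rightarrow> 'g set" where "\<And>n. compact (C n)" "incseq C" "(\<Union>n. C n) = UNIV"
proof -
  have "\<exists>U K. open U \<and> compact K \<and> x \<in> U \<and> U \<subseteq> K" for x :: 'g
    using loc_compact by (auto simp: locally_compact_space_def)
  then obtain U K where UK: "\<And>x :: 'g. open (U x)" "\<And>x. compact (K x)" "\<And>x. x \<in> U x" "\<And>x. U x \<subseteq> K x"
    by metis
  obtain F' where F': "F' \<subseteq> range U" "countable F'" "\<Union>F' = \<Union>(range U)"
    using Lindelof[of "range U"] UK(1) by blast
  then obtain I where I: "countable I" "F' = U ` I"
    by (metis countable_subset_image)
  have cover: "(\<Union>x\<in>I. K x) = UNIV"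
    using F'(3) I(2) UK(3,4) by blast
  then have "I \<noteq> {}" by auto
  define C where "C n = (\<Union>i\<le>n. K (from_nat_into I i))" for n
  show ?thesis
  proof
    show "compact (C n)" for n unfolding C_def using UK(2) by (intro compact_UN) auto
    show "incseq C" unfolding C_def by (intro incseq_SucI UN_mono) auto
    show "(\<Union>n. C n) = UNIV"
    proof -
      have "x \<in> (\<Union>n. C n)" for x
      proof -
        obtain i where "i \<in> I" "x \<in> K i" using cover by blast
        moreover then obtain n where "from_nat_into I n = i"
          using from_nat_into_surj[OF I(1)] by blast
        ultimately show ?thesis by (auto simp: C_def)
      qed
      then show ?thesis by auto
    qed
  qed
qed


section \<open>Separability\<close>

text \<open>An open set \<open>U\<close> slightly larger than \<open>A\<close> is a countable union
  of basic sets. Continuity from above, available since \<open>U\<close> has finite measure, reduces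
  it to a finite subunion up to \<open>\<delta> / 2\<close>.\<close>

lemma symmetric_difference_basis:
  fixes B :: "'g set set"
  assumes B: "topological_basis B" "countable B"
    and A[measurable]: "A \<in> sets borel" and fin: "emeasure \<mu> A < \<infinity>" and "0 < \<delta>"
  obtains W where "finite W" "W \<subseteq> B" "emeasure \<mu> ((A - \<Union>W) \<union> (\<Union>W - A)) < ennreal \<delta>"
proof -
  obtain a where a: "0 \<le> a" "emeasure \<mu> A = ennreal a"
    using fin by (cases "emeasure \<mu> A") auto
  have "emeasure \<mu> A < ennreal (a + \<delta> / 2)"
    using a \<open>0 < \<delta>\<close> by (simp add: ennreal_less_iff)
  then obtain U where U: "open U" "A \<subseteq> U" "emeasure \<mu> U < ennreal (a + \<delta> / 2)"
    using outer_open[OF A] by blast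
  have Um[measurable]: "U \<in> sets borel" using U by auto
  have "emeasure \<mu> (U - A) = emeasure \<mu> U - emeasure \<mu> A"
    using U fin by (intro emeasure_Diff) (auto simp: sets_eq)
  also have "\<dots> < ennreal (\<delta> / 2)"
  proof -
    obtain u where "0 \<le> u" "emeasure \<mu> U = ennreal u"
      using U(3) by (cases "emeasure \<mu> U") auto
    then show ?thesis using U(3) a \<open>0 < \<delta>\<close>
      by (simp add: ennreal_minus ennreal_less_iff ennreal_lessI del: ennreal_plus)
  qed
  finally have UA: "emeasure \<mu> (U - A) < ennreal (\<delta> / 2)" .
  obtain W' where W': "W' \<subseteq> B" "\<Union>W' = U"
    using B(1) U(1) by (auto simp: topological_basis_def)
  have "\<exists>W. finite W \<and> W \<subseteq> W' \<and> emeasure \<mu> (U - \<Union>W) < ennreal (\<delta> / 2)"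
  proof (cases "W' = {}")
    case True
    then show ?thesis using W'(2) \<open>0 < \<delta>\<close> by auto
  next
    case False
    have cW: "countable W'" using W' B countable_subset by blast
    define D where "D n = U - \<Union>(from_nat_into W' ` {..n})" for n
    have op: "open V" if "V \<in> W'" for V
      using topological_basis_open[OF B(1)] W'(1) that by blast
    have Dm: "D n \<in> sets \<mu>" for n
      unfolding D_def sets_eq using from_nat_into[OF False] op by auto
    have "(\<lambda>n. emeasure \<mu> (D n)) \<longlonglongrightarrow> emeasure \<mu> (\<Inter>n. D n)"
    proof (rule Lim_emeasure_decseq)
      show "decseq D"
        unfolding D_def by (intro decseq_SucI) auto
      show "emeasure \<mu> (D n) \<noteq> \<infinity>" for n
        using emeasure_mono[of "D n" U \<mu>] U(3) by (auto simp: D_def sets_eq top_unique)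
    qed (use Dm in auto)
    moreover have "(\<Inter>n. D n) = {}"
    proof -
      have "x \<notin> (\<Inter>n. D n)" for x
      proof
        assume x: "x \<in> (\<Inter>n. D n)"
        then have "x \<in> U" by (auto simp: D_def)
        then obtain V where "V \<in> W'" "x \<in> V" using W' by auto
        then obtain n where "from_nat_into W' n = V"
          using from_nat_into_surj[OF cW] by blast
        then have "x \<notin> D n" using \<open>x \<in> V\<close> by (auto simp: D_def)
        then show False using x by auto
      qed
      then show ?thesis by auto
    qed
    ultimately have "(\<lambda>n. emeasure \<mu> (D n)) \<longlonglongrightarrow> 0" by simp
    then have "eventually (\<lambda>n. emeasure \<mu> (D n) < ennreal (\<delta> / 2)) sequentially"
      using \<open>0 < \<delta>\<close> by (intro order_tendstoD) auto
    then obtain n where "emeasure \<mu> (D n) < ennreal (\<delta> / 2)"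
      by (auto simp: eventually_sequentially)
    then show ?thesis
      using from_nat_into[OF False] by (intro exI[of _ "from_nat_into W' ` {..n}"]) (auto simp: D_def)
  qed
  then obtain W where W: "finite W" "W \<subseteq> W'" "emeasure \<mu> (U - \<Union>W) < ennreal (\<delta> / 2)"
    by blast
  have Wm: "\<Union>W \<in> sets borel"
    using W(2) W'(1) topological_basis_open[OF B(1)] by (intro borel_open open_Union) blast
  have "emeasure \<mu> ((A - \<Union>W) \<union> (\<Union>W - A)) \<le> emeasure \<mu> ((U - \<Union>W) \<union> (U - A))"
    using U W W' Wm by (intro emeasure_mono) (auto simp: sets_eq)
  also have "\<dots> \<le> emeasure \<mu> (U - \<Union>W) + emeasure \<mu> (U - A)"
    using Wm by (intro emeasure_subadditive) (auto simp: sets_eq)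
  also have "\<dots> < ennreal (\<delta> / 2) + ennreal (\<delta> / 2)"
    using W(3) UA by (intro add_strict_mono)
  also have "\<dots> = ennreal \<delta>" using \<open>0 < \<delta>\<close> by (simp flip: ennreal_plus)
  finally show ?thesis using that W W' by blast
qed

text \<open>The approximants are finite sums of \<open>z * indicator (U \<inter> X n)\<close> with
  \<open>z\<close> from a countable dense set of scalars and \<open>U\<close> a finite union of
  basic open sets. Membership in \<open>bcs\<close> is part of the result because these functions
  serve as targets, to which translations by arbitrary group elements are applied.\<close>

lemma countable_dense_bcs:
  obtains Q where "countable Q" "Q \<noteq> {}" "Q \<subseteq> bcs"
    "\<And>f e. f \<in> wLp \<mu> p \<omega> \<Longrightarrow> 0 < e \<Longrightarrow> \<exists>q\<in>Q. modular (\<lambda>t. f t - q t) < ennreal e"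
proof -
  obtain C :: "nat \<Rightarrow> 'g set" where C: "\<And>n. compact (C n)" "incseq C" "(\<Union>n. C n) = UNIV"
    using compact_exhaustion by blast
  obtain B :: "'g set set" where B: "countable B" "topological_basis B"
    using ex_countable_basis by blast
  obtain Z :: "complex set" where Z: "countable Z" "\<And>X. open X \<Longrightarrow> X \<noteq> {} \<Longrightarrow> \<exists>z\<in>Z. z \<in> X"
    by (erule countable_dense_setE)
  \<comment> \<open>On \<open>X n\<close> the weight is at most \<open>n\<close>, so the modular of
    a bounded function living there is controlled by \<open>\<mu>\<close>, which is what
    approximation by basic open sets provides.\<close>
  define X where "X n = {t\<in>C n. \<omega> t \<le> real n}" for n
  define \<U> where "\<U> = Union ` {W. finite W \<and> W \<subseteq> B}"
  define ev :: "(complex \<times> 'g set \<times> nat) list \<Rightarrow> 'g \<Rightarrow> complex" where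
    "ev L = (\<lambda>t. \<Sum>(z, U, n)\<leftarrow>L. z * indicator (U \<inter> X n) t)" for L
  define Q where "Q = ev ` lists (Z \<times> \<U> \<times> UNIV)"
  \<comment> \<open>The functions approximated by \<open>Q\<close>. Closure properties of
    \<open>Cl\<close> lead from single blocks over simple functions to the whole space.\<close>
  define Cl where "Cl = {f \<in> borel_measurable borel.
    \<forall>e>0. \<exists>q\<in>Q. modular (\<lambda>t. f t - q t) < ennreal e}"
  have "countable \<U>" unfolding \<U>_def
    by (intro countable_image countable_Collect_finite_subset B)
  then have "countable Q" unfolding Q_def using Z by auto
  have Cm[measurable]: "C n \<in> sets borel" for n using C(1) by (rule borel_compact)
  have Xm[measurable]: "X n \<in> sets borel" for n unfolding X_def by measurable
  have \<U>m: "U \<in> sets borel" if "U \<in> \<U>" for U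
    using that topological_basis_open[OF B(2)] unfolding \<U>_def
    by (auto intro!: borel_open open_Union)
  have block: "(\<lambda>t. z * indicator (A \<inter> X n) t) \<in> bcs" if "A \<in> sets borel" for z A n
    unfolding bcs_def
  proof (intro CollectI conjI exI[of _ "C n"] exI[of _ "norm z + 1"] allI impI)
    show "(\<lambda>t. z * indicator (A \<inter> X n) t) \<in> borel_measurable borel"
      using that by measurable
    show "0 < norm z + 1" by (simp add: add_nonneg_pos)
  qed (auto simp: C X_def indicator_def)
  have "ev L \<in> bcs" if "L \<in> lists (Z \<times> \<U> \<times> UNIV)" for L
    using that
  proof (induction L)
    case Nil
    show ?case using block[of "{}" 0 0] by (simp add: ev_def)
  next
    case (Cons x L)
    obtain z U n where x: "x = (z, U, n)" by (cases x) auto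
    have "ev (x # L) = (\<lambda>t. z * indicator (U \<inter> X n) t + ev L t)"
      by (simp add: ev_def x)
    moreover have "(\<lambda>t. z * indicator (U \<inter> X n) t) \<in> bcs"
      using Cons x \<U>m by (intro block) auto
    ultimately show ?case using Cons by (simp add: bcs_add)
  qed
  then have Q_bcs: "Q \<subseteq> bcs" by (auto simp: Q_def)
  have Q_add: "(\<lambda>t. q t + r t) \<in> Q" if qr: "q \<in> Q" "r \<in> Q" for q r
  proof -
    obtain L where L: "q = ev L" "L \<in> lists (Z \<times> \<U> \<times> UNIV)"
      using qr unfolding Q_def by blast
    obtain M where M: "r = ev M" "M \<in> lists (Z \<times> \<U> \<times> UNIV)"
      using qr unfolding Q_def by blast
    have "(\<lambda>t. q t + r t) = ev (L @ M)" by (simp add: ev_def L M)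
    moreover have "L @ M \<in> lists (Z \<times> \<U> \<times> UNIV)" using L M by simp
    ultimately show ?thesis unfolding Q_def by (rule image_eqI)
  qed
  have Q_meas: "q \<in> borel_measurable borel" if "q \<in> Q" for q
    using that Q_bcs bcs_measurable by blast
  have pp: "0 < (2::real) powr p" by simp
  \<comment> \<open>\<open>Cl\<close> is closed under approximation; the choice of \<open>d\<close>
    absorbs the factor of the quasi-triangle inequality.\<close>
  have Cl_trans: "f \<in> Cl"
    if f[measurable]: "f \<in> borel_measurable borel"
      and g: "\<And>e. 0 < e \<Longrightarrow> \<exists>g\<in>Cl. modular (\<lambda>t. f t - g t) < ennreal e" for f
    unfolding Cl_def
  proof (intro CollectI conjI allI impI f)
    fix e :: real assume "0 < e"
    define d where "d = e / (2 * 2 powr p)"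
    have d: "0 < d" "2 powr p * (d + d) = e" using \<open>0 < e\<close> by (auto simp: d_def field_simps)
    from g[OF d(1)] obtain g where g: "g \<in> Cl" "modular (\<lambda>t. f t - g t) < ennreal d" by blast
    then obtain q where q: "q \<in> Q" "modular (\<lambda>t. g t - q t) < ennreal d"
      using d by (auto simp: Cl_def)
    have [measurable]: "g \<in> borel_measurable borel" "q \<in> borel_measurable borel"
      using g q Q_meas by (auto simp: Cl_def)
    have "modular (\<lambda>t. f t - q t)
        \<le> ennreal (2 powr p) * (modular (\<lambda>t. f t - g t) + modular (\<lambda>t. g t - q t))"
    proof (rule modular_add_le)
      show "norm (f t - q t) \<le> norm (f t - g t) + norm (g t - q t)" for t
        using norm_triangle_ineq[of "f t - g t" "g t - q t"] by simp
    qed measurable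
    also have "\<dots> < ennreal (2 powr p) * (ennreal d + ennreal d)"
      using g q pp by (intro ennreal_mult_strict_left_mono add_strict_mono) auto
    also have "\<dots> = ennreal e" using d by (simp flip: ennreal_plus ennreal_mult')
    finally show "\<exists>q\<in>Q. modular (\<lambda>t. f t - q t) < ennreal e" using q by blast
  qed
  have Cl_add: "(\<lambda>t. f t + g t) \<in> Cl" if fg: "f \<in> Cl" "g \<in> Cl" for f g
    unfolding Cl_def
  proof (intro CollectI conjI allI impI)
    show "(\<lambda>t. f t + g t) \<in> borel_measurable borel" using that by (auto simp: Cl_def)
    fix e :: real assume "0 < e"
    define d where "d = e / (2 * 2 powr p)"
    have d: "0 < d" "2 powr p * (d + d) = e" using \<open>0 < e\<close> by (auto simp: d_def field_simps)
    obtain q r where q: "q \<in> Q" "modular (\<lambda>t. f t - q t) < ennreal d"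
      and r: "r \<in> Q" "modular (\<lambda>t. g t - r t) < ennreal d"
      using d(1) fg unfolding Cl_def by blast
    have [measurable]: "g \<in> borel_measurable borel" "f \<in> borel_measurable borel"
       "q \<in> borel_measurable borel" "r \<in> borel_measurable borel"
      using that q r Q_meas by (auto simp: Cl_def)
    have "modular (\<lambda>t. (f t + g t) - (q t + r t))
        \<le> ennreal (2 powr p) * (modular (\<lambda>t. f t - q t) + modular (\<lambda>t. g t - r t))"
    proof (rule modular_add_le)
      show "norm ((f t + g t) - (q t + r t)) \<le> norm (f t - q t) + norm (g t - r t)" for t
        by (rule norm_diff_triangle_ineq)
    qed measurable
    also have "\<dots> < ennreal (2 powr p) * (ennreal d + ennreal d)"
      using q r pp by (intro ennreal_mult_strict_left_mono add_strict_mono) auto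
    also have "\<dots> = ennreal e" using d by (simp flip: ennreal_plus ennreal_mult')
    finally show "\<exists>q\<in>Q. modular (\<lambda>t. (f t + g t) - q t) < ennreal e"
      using Q_add[OF q(1) r(1)] by (intro bexI[of _ "\<lambda>t. q t + r t"])
  qed
  have "[] \<in> lists (Z \<times> \<U> \<times> UNIV)" by simp
  then have zero: "(\<lambda>t. 0) \<in> Q"
    unfolding Q_def by (rule rev_image_eqI) (simp add: ev_def)
  have Cl_zero: "(\<lambda>t. 0) \<in> Cl"
    using zero p_pos by (auto simp: Cl_def modular_def intro!: bexI[of _ "\<lambda>t. 0"])
  have wX: "wmeas (A \<inter> X n) \<le> ennreal (real n powr p) * emeasure \<mu> A"
    if [measurable]: "A \<in> sets borel" for A n
  proof -
    have "wmeas (A \<inter> X n) \<le> (\<integral>\<^sup>+ t. ennreal (real n powr p) * indicator A t \<partial>\<mu>)"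
      unfolding wmeas_def using p_pos weight_pos
      by (intro nn_integral_mono)
        (auto simp: indicator_def X_def intro!: ennreal_leI powr_mono2 intro: less_imp_le)
    also have "\<dots> = ennreal (real n powr p) * emeasure \<mu> A"
      by (simp add: nn_integral_cmult_indicator sets_eq)
    finally show ?thesis .
  qed
  have Cl_ind: "(\<lambda>t. z * indicator (A \<inter> X n) t) \<in> Cl"
    if A[measurable]: "A \<in> sets borel" for z A n
    unfolding Cl_def
  proof (intro CollectI conjI allI impI)
    show "(\<lambda>t. z * indicator (A \<inter> X n) t) \<in> borel_measurable borel" by measurable
    fix e :: real assume "0 < e"
    define m where "m = (real n + 1) powr p"
    have m: "0 < m" "real n powr p \<le> m" using p_pos by (auto simp: m_def intro!: powr_mono2)
    have wXm: "wmeas (B \<inter> X n) \<le> ennreal m * emeasure \<mu> B" if "B \<in> sets borel" for B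
      by (rule order_trans[OF wX[OF that] mult_right_mono]) (use m in \<open>auto intro: ennreal_leI\<close>)
    obtain a where a: "0 \<le> a" "emeasure \<mu> (C n) = ennreal a"
      using compact_finite[OF C(1), of n] by (cases "emeasure \<mu> (C n)") auto
    define d where "d = e / (2 * 2 powr p * m)"
    have d: "0 < d" "2 powr p * (m * d + m * d) = e" using \<open>0 < e\<close> m by (auto simp: d_def field_simps)
    \<comment> \<open>A scalar \<open>q\<close> within \<open>r\<close> of \<open>z\<close> is close
      enough: \<open>r powr p\<close> times the measure of \<open>C n\<close> is at most
      \<open>d\<close>. The summand 1 avoids a division by 0.\<close>
    define r where "r = (d / (a + 1)) powr (1 / p)"
    have r: "0 < r" "r powr p * a \<le> d"
    proof -
      show "0 < r" using a d by (simp add: r_def)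
      have "r powr p = d / (a + 1)" using a d p_pos by (simp add: r_def powr_powr)
      moreover have "d / (a + 1) * a \<le> d" using a d by (simp add: pos_divide_le_eq mult_left_mono)
      ultimately show "r powr p * a \<le> d" by simp
    qed
    obtain q where q: "q \<in> Z" "q \<in> ball z r" using Z(2)[of "ball z r"] r by auto
    then have zq: "norm (z - q) \<le> r" by (simp add: dist_norm)
    define k where "k = norm q powr p + 1"
    have k: "0 < k" "norm q powr p \<le> k" by (auto simp: k_def add_nonneg_pos)
    \<comment> \<open>Two errors are separated: replacing \<open>z\<close> by \<open>q\<close>,
      supported in \<open>C n\<close>, and replacing \<open>A \<inter> C n\<close> by
      \<open>V\<close>, supported in their symmetric difference.\<close>
    have tri: "norm (z * indicator (A \<inter> X n) t - q * indicator (V \<inter> X n) t)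
        \<le> norm ((z - q) * indicator (C n \<inter> X n) t)
          + norm (q * indicator (((A \<inter> C n - V) \<union> (V - A \<inter> C n)) \<inter> X n) t)" for t V
    proof -
      have "t \<in> X n \<Longrightarrow> t \<in> C n" by (simp add: X_def)
      then show ?thesis using norm_triangle_ineq[of "z - q" q]
        by (cases "t \<in> X n"; cases "t \<in> A"; cases "t \<in> V") simp_all
    qed
    have AC: "A \<inter> C n \<in> sets borel" by measurable
    have "emeasure \<mu> (A \<inter> C n) < \<infinity>"
      using emeasure_mono[of "A \<inter> C n" "C n" \<mu>] a by (auto simp: sets_eq intro: order_le_less_trans)
    then obtain W where W: "finite W" "W \<subseteq> B"
      "emeasure \<mu> ((A \<inter> C n - \<Union>W) \<union> (\<Union>W - A \<inter> C n)) < ennreal (d / k)"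
      using symmetric_difference_basis[OF B(2,1) AC, of "d / k"] d k by auto
    let ?D = "(A \<inter> C n - \<Union>W) \<union> (\<Union>W - A \<inter> C n)"
    have WU: "\<Union>W \<in> \<U>" using W by (auto simp: \<U>_def)
    have Wm[measurable]: "\<Union>W \<in> sets borel" using \<U>m[OF WU] .
    have Dm: "?D \<in> sets borel" by measurable
    let ?q = "\<lambda>t. q * indicator (\<Union>W \<inter> X n) t"
    have "?q = ev [(q, \<Union>W, n)]" by (simp add: ev_def)
    then have qQ: "?q \<in> Q" using q(1) WU unfolding Q_def by (intro image_eqI) auto
    have "modular (\<lambda>t. z * indicator (A \<inter> X n) t - ?q t)
        \<le> ennreal (2 powr p) * (modular (\<lambda>t. (z - q) * indicator (C n \<inter> X n) t)
            + modular (\<lambda>t. q * indicator (?D \<inter> X n) t))"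
    proof (rule modular_add_le)
      show "norm (z * indicator (A \<inter> X n) t - ?q t)
        \<le> norm ((z - q) * indicator (C n \<inter> X n) t) + norm (q * indicator (?D \<inter> X n) t)" for t
        by (rule tri)
    qed (use Dm in measurable)
    also have "\<dots> \<le> ennreal (2 powr p) * (ennreal (r powr p) * wmeas (C n \<inter> X n)
        + ennreal (norm q powr p) * wmeas (?D \<inter> X n))"
      using Dm zq r by (intro mult_left_mono add_mono modular_le_wmeas) (auto simp: indicator_def)
    also have "\<dots> \<le> ennreal (2 powr p) * (ennreal (r powr p) * (ennreal m * ennreal a)
        + ennreal k * (ennreal m * emeasure \<mu> ?D))"
      using wXm[OF Cm, of n] wXm[OF Dm] a k
      by (intro mult_left_mono add_mono mult_mono ennreal_leI) auto
    also have "\<dots> < ennreal (2 powr p) * (ennreal (m * d) + ennreal (m * d))"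
    proof (intro ennreal_mult_strict_left_mono)
      have "ennreal (r powr p) * (ennreal m * ennreal a) = ennreal (m * (r powr p * a))"
        using m a by (simp flip: ennreal_mult' add: mult_ac)
      also have "\<dots> \<le> ennreal (m * d)" using m r by (intro ennreal_leI mult_left_mono) auto
      finally have 1: "ennreal (r powr p) * (ennreal m * ennreal a) \<le> ennreal (m * d)" .
      have "ennreal k * (ennreal m * emeasure \<mu> ?D) < ennreal k * (ennreal m * ennreal (d / k))"
        using W(3) k m by (intro ennreal_mult_strict_left_mono) auto
      also have "\<dots> = ennreal (m * d)"
        using m k d by (simp flip: ennreal_mult' add: mult_ac)
      finally have 2: "ennreal k * (ennreal m * emeasure \<mu> ?D) < ennreal (m * d)" .
      show "ennreal (r powr p) * (ennreal m * ennreal a) + ennreal k * (ennreal m * emeasure \<mu> ?D)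
        < ennreal (m * d) + ennreal (m * d)"
        using add_right_mono[OF 1] by (rule order_le_less_trans)
          (simp add: ennreal_add_left_cancel_less 2)
    qed auto
    also have "\<dots> = ennreal e" using d m by (simp flip: ennreal_plus ennreal_mult')
    finally show "\<exists>q\<in>Q. modular (\<lambda>t. z * indicator (A \<inter> X n) t - q t) < ennreal e"
      by (rule bexI[where x="?q", OF _ qQ])
  qed
  have Cl_sum: "(\<lambda>t. \<Sum>y\<in>Y. y * indicator (A y \<inter> X n) t) \<in> Cl"
    if "finite Y" "\<And>y. A y \<in> sets borel" for Y and A :: "complex \<Rightarrow> 'g set" and n
    using that(1)
  proof (induction Y)
    case empty
    show ?case using Cl_zero by simp
  next
    case (insert y Y)
    then show ?case
      using Cl_add[OF Cl_ind[OF that(2)], of "\<lambda>t. \<Sum>y\<in>Y. y * indicator (A y \<inter> X n) t" y y n]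
      by (simp only: sum.insert simp_thms)
  qed
  have Cl_simple: "(\<lambda>t. f t * indicator (X n) t) \<in> Cl" if "simple_function \<mu> f" for f n
  proof -
    have fin: "finite (range f)" using simple_functionD(1)[OF that] by simp
    have pre: "f -` {y} \<in> sets borel" for y
      using simple_functionD(2)[OF that, of "{y}"] by (simp add: sets_eq)
    have "f t * indicator (X n) t = (\<Sum>y\<in>range f. y * indicator (f -` {y} \<inter> X n) t)" for t
    proof -
      have "(\<Sum>y\<in>range f. y * indicator (f -` {y} \<inter> X n) t)
          = (\<Sum>y\<in>range f. if y = f t then y * indicator (X n) t else 0)"
        by (intro sum.cong) (auto simp: indicator_def)
      also have "\<dots> = f t * indicator (X n) t" using fin by simp
      finally show ?thesis ..
    qed
    then show ?thesis using Cl_sum[OF fin, of "\<lambda>y. f -` {y}" n] pre by simp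
  qed
  have "f \<in> Cl" if f: "f \<in> wLp \<mu> p \<omega>" for f
  proof (rule Cl_trans)
    show fm[measurable]: "f \<in> borel_measurable borel" using f by (simp add: wLp_iff)
    fix e :: real assume "0 < e"
    have "f \<in> borel_measurable \<mu>" by (simp add: measurable_cong_sets[OF sets_eq refl])
    from borel_measurable_implies_sequence_metric[OF this, of 0]
    obtain s where s: "\<And>i. simple_function \<mu> (s i)" "\<And>t. (\<lambda>i. s i t) \<longlonglongrightarrow> f t"
      "\<And>i t. norm (s i t) \<le> 2 * norm (f t)"
      unfolding dist_0_norm dist_commute[of _ 0] space_eq by blast
    have sm[measurable]: "s i \<in> borel_measurable borel" for i
      using borel_measurable_simple_function[OF s(1)[of i]]
      by (simp add: measurable_cong_sets[OF sets_eq refl])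
    \<comment> \<open>Using the same index for truncation and for the simple functions handles both
      limits at once: each \<open>t\<close> lies in \<open>X i\<close> for all large
      \<open>i\<close>. The dominating constant 3 below is 1 for \<open>f\<close> plus 2 for
      \<open>s i\<close>.\<close>
    let ?g = "\<lambda>i t. s i t * indicator (X i) t"
    let ?h = "\<lambda>i t. ennreal (norm (f t - ?g i t) powr p * \<omega> t powr p)"
    have "(\<lambda>i. \<integral>\<^sup>+ t. ?h i t \<partial>\<mu>) \<longlonglongrightarrow> (\<integral>\<^sup>+ t. 0 \<partial>\<mu>)"
    proof (rule nn_integral_dominated_convergence
        [where w="\<lambda>t. ennreal (3 powr p) * ennreal (norm (f t) powr p * \<omega> t powr p)"])
      show "(\<integral>\<^sup>+ t. ennreal (3 powr p) * ennreal (norm (f t) powr p * \<omega> t powr p) \<partial>\<mu>) < \<infinity>"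
        using f by (subst nn_integral_cmult)
          (auto simp: wLp_iff modular_def ennreal_mult_less_top measurable_cong_sets[OF sets_eq refl])
      show "AE t in \<mu>. ?h i t \<le> ennreal (3 powr p) * ennreal (norm (f t) powr p * \<omega> t powr p)" for i
      proof (rule AE_I2)
        fix t
        have "norm (f t - ?g i t) \<le> norm (f t) + norm (?g i t)" by (rule norm_triangle_ineq4)
        also have "\<dots> \<le> 3 * norm (f t)" using s(3)[of i t] by (auto simp: indicator_def)
        finally have "norm (f t - ?g i t) powr p \<le> 3 powr p * norm (f t) powr p"
          using p_pos by (simp flip: powr_mult add: powr_mono2)
        then have "norm (f t - ?g i t) powr p * \<omega> t powr p
            \<le> 3 powr p * norm (f t) powr p * \<omega> t powr p"
          by (rule mult_right_mono) simp
        then show "?h i t \<le> ennreal (3 powr p) * ennreal (norm (f t) powr p * \<omega> t powr p)"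
          by (simp flip: ennreal_mult' add: mult_ac)
      qed
      show "AE t in \<mu>. (\<lambda>i. ?h i t) \<longlonglongrightarrow> 0"
      proof (rule AE_I2)
        fix t
        obtain k :: nat where k: "\<omega> t \<le> real k" using real_arch_simple by blast
        obtain l where l: "t \<in> C l" using C(3) by blast
        have "t \<in> X i" if "max k l \<le> i" for i
          using that k l incseqD[OF C(2), of l i] by (auto simp: X_def)
        then have "eventually (\<lambda>i. s i t = ?g i t) sequentially"
          unfolding eventually_sequentially by (intro exI[of _ "max k l"]) (auto simp: indicator_def)
        with s(2)[of t] have "(\<lambda>i. ?g i t) \<longlonglongrightarrow> f t"
          by (rule Lim_transform_eventually)
        then have "(\<lambda>i. norm (f t - ?g i t) powr p * \<omega> t powr p)
            \<longlonglongrightarrow> norm (f t - f t) powr p * \<omega> t powr p"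
          using p_pos by (intro tendsto_intros) auto
        then show "(\<lambda>i. ?h i t) \<longlonglongrightarrow> 0"
          using tendsto_ennrealI by fastforce
      qed
    qed (auto simp: measurable_cong_sets[OF sets_eq refl])
    then have "eventually (\<lambda>i. (\<integral>\<^sup>+ t. ?h i t \<partial>\<mu>) < ennreal e) sequentially"
      using \<open>0 < e\<close> by (intro order_tendstoD) auto
    then obtain i where "modular (\<lambda>t. f t - ?g i t) < ennreal e"
      by (auto simp: eventually_sequentially modular_def)
    then show "\<exists>g\<in>Cl. modular (\<lambda>t. f t - g t) < ennreal e"
      by (rule bexI[where x="?g i", OF _ Cl_simple[OF s(1)]])
  qed
  then show ?thesis
    using that[of Q] \<open>countable Q\<close> zero Q_bcs by (auto simp: Cl_def)
qed

end

section \<open>Sufficiency\<close>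

text \<open>The factor \<open>(2 powr p) ^ Suc k\<close> forces geometric decay: every single term
  is at most the sum \<open>A\<close>, so the increments are at most
  \<open>A powr (1 / p) / 2 ^ Suc k\<close>, and these bounds add up to
  \<open>A powr (1 / p)\<close>. This takes the place of Minkowski's inequality in the completeness
  argument.\<close>

lemma convergent_of_powr_series:
  fixes h :: "nat \<Rightarrow> 'a::banach"
  assumes p: "1 \<le> (p::real)"
    and fin: "(\<Sum>k. ennreal ((2 powr p) ^ Suc k * norm (h (Suc k) - h k) powr p)) < \<infinity>"
  obtains L where "h \<longlonglongrightarrow> L"
    "ennreal (norm (L - h 0) powr p)
      \<le> (\<Sum>k. ennreal ((2 powr p) ^ Suc k * norm (h (Suc k) - h k) powr p))"
proof -
  let ?a = "\<lambda>k. norm (h (Suc k) - h k)"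
  define T where "T k = ennreal ((2 powr p) ^ Suc k * ?a k powr p)" for k
  have T: "(\<lambda>k. ennreal ((2 powr p) ^ Suc k * ?a k powr p)) = T"
    by (rule ext) (simp only: T_def)
  have "suminf T < \<infinity>" using fin unfolding T .
  then obtain A where A: "0 \<le> A" "suminf T = ennreal A"
    by (cases "suminf T") auto
  define r where "r = A powr (1 / p)"
  have le: "?a k \<le> r * (1 / 2) ^ Suc k" for k
  proof -
    have "T k \<le> ennreal A"
      using sum_le_suminf[of T "{k}"] A by (simp add: summableI)
    then have "(2 powr p) ^ Suc k * ?a k powr p \<le> A" using A(1) by (simp only: T_def ennreal_le_iff)
    also have "(2 powr p) ^ Suc k * ?a k powr p = (2 ^ Suc k * ?a k) powr p"
    proof -
      have "((2::real) powr p) ^ Suc k = (2 powr p) powr real (Suc k)"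
        by (rule powr_realpow[symmetric]) simp
      also have "\<dots> = (2 powr real (Suc k)) powr p" by (simp only: powr_powr mult.commute)
      also have "(2::real) powr real (Suc k) = 2 ^ Suc k" by (rule powr_realpow) simp
      finally have "((2::real) powr p) ^ Suc k = (2 ^ Suc k) powr p" .
      then show ?thesis by (simp only: powr_mult)
    qed
    finally have "((2 ^ Suc k * ?a k) powr p) powr (1 / p) \<le> r"
      unfolding r_def using p by (intro powr_mono2) auto
    then have "2 ^ Suc k * ?a k \<le> r" using p by (simp add: powr_powr)
    then have "?a k \<le> r / 2 ^ Suc k" by (subst pos_le_divide_eq) (simp_all add: mult.commute)
    then show ?thesis by (simp add: power_one_over)
  qed
  have geo: "(\<lambda>k. r * (1 / 2) ^ Suc k) sums r"
    using sums_mult[OF power_half_series, of r] by simp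
  have sa: "summable ?a"
    using le by (intro summable_comparison_test'[OF sums_summable[OF geo], of 0]) simp
  then have "summable (\<lambda>k. h (Suc k) - h k)" by (rule summable_norm_cancel)
  then have "(\<lambda>n. h n - h 0) \<longlonglongrightarrow> (\<Sum>k. h (Suc k) - h k)"
    by (simp only: summable_LIMSEQ flip: sum_lessThan_telescope[of h])
  then have lim: "h \<longlonglongrightarrow> h 0 + (\<Sum>k. h (Suc k) - h k)"
    using tendsto_add[OF tendsto_const[of "h 0"], of "\<lambda>n. h n - h 0"] by simp
  have "norm (\<Sum>k. h (Suc k) - h k) \<le> (\<Sum>k. ?a k)" using sa by (rule summable_norm)
  also have "\<dots> \<le> r" using suminf_le[OF le sa sums_summable[OF geo]] geo by (simp add: sums_iff)
  finally have "norm (\<Sum>k. h (Suc k) - h k) powr p \<le> r powr p"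
    using p by (intro powr_mono2) auto
  also have "r powr p = A" using p A by (simp add: r_def powr_powr)
  finally have "ennreal (norm (h 0 + (\<Sum>k. h (Suc k) - h k) - h 0) powr p) \<le> suminf T"
    unfolding A(2) by (intro ennreal_leI) (simp only: add_diff_cancel_left')
  then show ?thesis by (intro that[OF lim]) (simp only: T)
qed

section \<open>Functions near one target and mapped near another\<close>

context weighted_Lp
begin

text \<open>
  The common form of the four conditions: \<open>c\<close> is the multiplier for which \<open>c T\<^sub>s\<close> and its
  inverse are both small on functions living on \<open>E\<close>.
\<close>

definition mixing :: "complex set \<Rightarrow> 'g set \<Rightarrow> bool" where
  "mixing \<Lambda> S \<longleftrightarrow> (\<forall>F \<epsilon>. compact F \<and> 0 < \<epsilon> \<longrightarrow>
     (\<exists>s\<in>S. \<exists>c\<in>\<Lambda>. \<exists>E. c \<noteq> 0 \<and> compact E \<and> E \<subseteq> F \<and> emeasure \<mu> (F - E) < ennreal \<epsilon> \<and>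
       (AE t in \<mu>. t \<in> E \<longrightarrow> norm c * \<omega> (s + t) \<le> \<epsilon> \<and> \<omega> (- s + t) \<le> \<epsilon> * norm c)))"

lemma modular_translate_supported:
  assumes f: "f \<in> borel_measurable borel" and M: "\<And>t. norm (f t) \<le> M"
    and supp: "\<And>t. t \<notin> E \<Longrightarrow> f t = 0"
    and E: "E \<subseteq> F" and F[measurable]: "F \<in> sets borel"
    and ae: "AE t in \<mu>. t \<in> E \<longrightarrow> norm c * \<omega> (s + t) \<le> \<epsilon>"
  shows "modular (\<lambda>t. c * translate s f t) \<le> ennreal (M powr p * \<epsilon> powr p) * emeasure \<mu> F"
proof -
  have "modular (\<lambda>t. c * translate s f t) = modular (translate s (\<lambda>t. c * f t))"
    by (simp add: translate_def)
  also have "\<dots> = (\<integral>\<^sup>+ t. ennreal (norm (c * f t) powr p * \<omega> (s + t) powr p) \<partial>\<mu>)"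
    using f by (intro modular_translate) measurable
  also have "\<dots> \<le> (\<integral>\<^sup>+ t. ennreal (M powr p * \<epsilon> powr p) * indicator F t \<partial>\<mu>)"
  proof (rule nn_integral_mono_AE, use ae in eventually_elim)
    case (elim t)
    show ?case
    proof (cases "t \<in> E")
      case True
      then have "norm c * \<omega> (s + t) \<le> \<epsilon>" using elim by simp
      moreover have "norm (c * f t) powr p * \<omega> (s + t) powr p
          = norm (f t) powr p * (norm c * \<omega> (s + t)) powr p"
        using weight_pos[of "s + t"] by (simp add: norm_mult powr_mult)
      ultimately have "norm (c * f t) powr p * \<omega> (s + t) powr p \<le> M powr p * \<epsilon> powr p"
        using M[of t] p_pos weight_pos[of "s + t"]
        by (auto intro!: mult_mono powr_mono2 mult_nonneg_nonneg)
      then show ?thesis using True E by (auto intro: ennreal_leI)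
    next
      case False
      then show ?thesis using supp p_pos by simp
    qed
  qed
  also have "\<dots> = ennreal (M powr p * \<epsilon> powr p) * emeasure \<mu> F"
    by (simp add: nn_integral_cmult_indicator sets_eq)
  finally show ?thesis .
qed

lemma mixing_step:
  assumes mix: "mixing \<Lambda> S" and u: "u \<in> bcs" and v: "v \<in> bcs" and "0 < e"
  obtains s c h where "s \<in> S" "c \<in> \<Lambda>" "c \<noteq> 0" "h \<in> bcs" "modular (\<lambda>t. h t - u t) \<le> ennreal e"
    "modular (\<lambda>t. c * translate s h t - v t) \<le> ennreal e"
proof -
  obtain F\<^sub>1 M\<^sub>1 where 1: "compact F\<^sub>1" "0 < M\<^sub>1" "\<And>t. norm (u t) \<le> M\<^sub>1" "\<And>t. t \<notin> F\<^sub>1 \<Longrightarrow> u t = 0"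
    using u by (auto simp: bcs_def)
  obtain F\<^sub>2 M\<^sub>2 where 2: "compact F\<^sub>2" "0 < M\<^sub>2" "\<And>t. norm (v t) \<le> M\<^sub>2" "\<And>t. t \<notin> F\<^sub>2 \<Longrightarrow> v t = 0"
    using v by (auto simp: bcs_def)
  define F where "F = F\<^sub>1 \<union> F\<^sub>2"
  define M where "M = max M\<^sub>1 M\<^sub>2"
  have F: "compact F" using 1 2 by (auto simp: F_def)
  then have Fm[measurable]: "F \<in> sets borel" by (rule borel_compact)
  have M: "0 < M" "norm (u t) \<le> M" "norm (v t) \<le> M" for t
    using 1(2) 1(3)[of t] 2(3)[of t] by (auto simp: M_def)
  have supp: "u t = 0" "v t = 0" if "t \<notin> F" for t
    using that 1 2 by (auto simp: F_def)
  obtain m where m: "0 \<le> m" "emeasure \<mu> F = ennreal m"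
    using compact_finite[OF F] by (cases "emeasure \<mu> F") auto
  define d where "d = e / (2 * 2 powr p)"
  have d: "0 < d" "2 powr p * (d + d) = e" using \<open>0 < e\<close> by (auto simp: d_def field_simps)
  obtain \<delta> where \<delta>: "0 < \<delta>" "\<And>B. B \<in> sets borel \<Longrightarrow> B \<subseteq> F \<Longrightarrow> emeasure \<mu> B < ennreal \<delta> \<Longrightarrow>
      wmeas B \<le> ennreal (d / M powr p)"
    using wmeas_small[OF F, of "d / M powr p"] d M(1) by auto
  \<comment> \<open>Two uses of \<open>\<epsilon>\<close> are served: as a bound for the measure of
    \<open>F - E\<close> it makes the cut-off parts of \<open>u\<close> and \<open>v\<close> small,
    and as a bound for the weights on \<open>E\<close> it makes the translated parts small. The root
    turns the latter into a bound for the modular.\<close>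
  define \<epsilon> where "\<epsilon> = min \<delta> ((d / (M powr p * (m + 1))) powr (1 / p))"
  have \<epsilon>: "0 < \<epsilon>" "\<epsilon> \<le> \<delta>" using \<delta> d M(1) m by (auto simp: \<epsilon>_def)
  have \<epsilon>d: "M powr p * \<epsilon> powr p * m \<le> d"
  proof -
    have "\<epsilon> powr p \<le> ((d / (M powr p * (m + 1))) powr (1 / p)) powr p"
      using \<epsilon> p_pos by (intro powr_mono2) (auto simp: \<epsilon>_def)
    also have "\<dots> = d / (M powr p * (m + 1))" using p_pos d M(1) m by (simp add: powr_powr)
    finally have "\<epsilon> powr p * (M powr p * (m + 1)) \<le> d"
      using M(1) m by (simp add: pos_le_divide_eq)
    moreover have "\<epsilon> powr p * (M powr p * m) \<le> \<epsilon> powr p * (M powr p * (m + 1))"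
      by (intro mult_left_mono) auto
    ultimately show ?thesis by (simp add: mult_ac)
  qed
  obtain s c E where E: "s \<in> S" "c \<in> \<Lambda>" "c \<noteq> 0" "compact E" "E \<subseteq> F"
    "emeasure \<mu> (F - E) < ennreal \<epsilon>"
    and ae: "AE t in \<mu>. t \<in> E \<longrightarrow> norm c * \<omega> (s + t) \<le> \<epsilon> \<and> \<omega> (- s + t) \<le> \<epsilon> * norm c"
    using mix[unfolded mixing_def] F \<epsilon>(1) by blast
  have Em[measurable]: "E \<in> sets borel" using E(4) by (rule borel_compact)
  have um[measurable]: "u \<in> borel_measurable borel" and vm[measurable]: "v \<in> borel_measurable borel"
    using u v by (auto simp: bcs_def)
  let ?uE = "\<lambda>t. u t * indicator E t" and ?vE = "\<lambda>t. v t * indicator E t"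
  have small: "modular (\<lambda>t. w t * indicator (F - E) t) \<le> ennreal d"
    if "\<And>t. norm (w t) \<le> M" for w
  proof -
    have "emeasure \<mu> (F - E) < ennreal \<delta>"
      using E(6) \<epsilon> by (meson ennreal_leI less_le_trans)
    then have "wmeas (F - E) \<le> ennreal (d / M powr p)"
      by (intro \<delta>(2)) auto
    moreover have "modular (\<lambda>t. w t * indicator (F - E) t) \<le> ennreal (M powr p) * wmeas (F - E)"
      using that M(1) by (intro modular_le_wmeas) (auto simp: indicator_def)
    ultimately have "modular (\<lambda>t. w t * indicator (F - E) t) \<le> ennreal (M powr p) * ennreal (d / M powr p)"
      by (meson mult_left_mono order_trans zero_le)
    also have "\<dots> = ennreal d" using M(1) d by (simp flip: ennreal_mult')
    finally show ?thesis .
  qed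
  have transl: "modular (\<lambda>t. c' * translate s' (\<lambda>t. w t * indicator E t) t) \<le> ennreal d"
    if "\<And>t. norm (w t) \<le> M" and w[measurable]: "w \<in> borel_measurable borel"
      and ae: "AE t in \<mu>. t \<in> E \<longrightarrow> norm c' * \<omega> (s' + t) \<le> \<epsilon>" for w c' s'
  proof -
    have "modular (\<lambda>t. c' * translate s' (\<lambda>t. w t * indicator E t) t)
        \<le> ennreal (M powr p * \<epsilon> powr p) * emeasure \<mu> F"
      using that M(1) E(5) by (intro modular_translate_supported) (auto simp: indicator_def)
    also have "\<dots> = ennreal (M powr p * \<epsilon> powr p * m)" using m by (simp flip: ennreal_mult')
    also have "\<dots> \<le> ennreal d" using \<epsilon>d by (rule ennreal_leI)
    finally show ?thesis .
  qed
  define h where "h = (\<lambda>t. ?uE t + inverse c * translate (- s) ?vE t)"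
  show ?thesis
  proof
    show "s \<in> S" "c \<in> \<Lambda>" "c \<noteq> 0" by fact+
    show "h \<in> bcs" unfolding h_def
      using u v by (intro bcs_add bcs_restrict bcs_cmult bcs_translate) auto
    have "modular (\<lambda>t. h t - u t) \<le> ennreal (2 powr p)
        * (modular (\<lambda>t. u t * indicator (F - E) t) + modular (\<lambda>t. inverse c * translate (- s) ?vE t))"
    proof (rule modular_add_le)
      fix t
      have "h t - u t = - (u t * indicator (F - E) t) + inverse c * translate (- s) ?vE t"
        using supp[of t] E(5) by (auto simp: h_def indicator_def)
      then show "norm (h t - u t) \<le> norm (u t * indicator (F - E) t)
          + norm (inverse c * translate (- s) ?vE t)"
        using norm_triangle_ineq[of "- (u t * indicator (F - E) t)"] by (simp add: norm_minus_cancel)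
    qed measurable
    also have "\<dots> \<le> ennreal (2 powr p) * (ennreal d + ennreal d)"
    proof (intro mult_left_mono add_mono small transl vm M)
      show "AE t in \<mu>. t \<in> E \<longrightarrow> norm (inverse c) * \<omega> (- s + t) \<le> \<epsilon>"
        using ae by eventually_elim (use E(3) in \<open>auto simp: norm_divide inverse_eq_divide pos_divide_le_eq\<close>)
    qed auto
    also have "\<dots> = ennreal e" using d by (simp flip: ennreal_plus ennreal_mult')
    finally show "modular (\<lambda>t. h t - u t) \<le> ennreal e" .
    have "modular (\<lambda>t. c * translate s h t - v t) \<le> ennreal (2 powr p)
        * (modular (\<lambda>t. c * translate s ?uE t) + modular (\<lambda>t. v t * indicator (F - E) t))"
    proof (rule modular_add_le)
      fix t
      have "c * translate s h t = c * translate s ?uE t + ?vE t"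
        using E(3) by (simp add: h_def translate_def distrib_left add.assoc[symmetric])
      then have "c * translate s h t - v t = c * translate s ?uE t - v t * indicator (F - E) t"
        using supp[of t] E(5) by (auto simp: indicator_def)
      then show "norm (c * translate s h t - v t) \<le> norm (c * translate s ?uE t)
          + norm (v t * indicator (F - E) t)"
        by (simp only: norm_triangle_ineq4)
    qed measurable
    also have "\<dots> \<le> ennreal (2 powr p) * (ennreal d + ennreal d)"
    proof (intro mult_left_mono add_mono small transl um M)
      show "AE t in \<mu>. t \<in> E \<longrightarrow> norm c * \<omega> (s + t) \<le> \<epsilon>"
        using ae by eventually_elim auto
    qed auto
    also have "\<dots> = ennreal e" using d by (simp flip: ennreal_plus ennreal_mult')
    finally show "modular (\<lambda>t. c * translate s h t - v t) \<le> ennreal e" .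
  qed
qed


section \<open>Limits with controlled modular and the dense vector\<close>

lemma modular_diff_trans:
  assumes [measurable]: "f \<in> borel_measurable borel" "g \<in> borel_measurable borel"
    "h \<in> borel_measurable borel"
  shows "modular (\<lambda>t. f t - h t)
    \<le> ennreal (2 powr p) * (modular (\<lambda>t. f t - g t) + modular (\<lambda>t. g t - h t))"
proof (rule modular_add_le)
  show "norm (f t - h t) \<le> norm (f t - g t) + norm (g t - h t)" for t
    using norm_triangle_ineq[of "f t - g t" "g t - h t"] by simp
qed measurable

lemma LS_orbit_subset_wLp:
  assumes adm: "admissible \<mu> S \<omega>" and f: "f \<in> wLp \<mu> p \<omega>"
  shows "{(\<lambda>t. c * translate s f t) |c s. c \<in> \<Lambda> \<and> s \<in> S} \<subseteq> wLp \<mu> p \<omega>"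
proof clarify
  fix c s assume "s \<in> S"
  have fm[measurable]: "f \<in> borel_measurable borel" using f by (simp add: wLp_iff)
  obtain C where "modular (translate s f) \<le> ennreal C * modular f"
    using modular_translate_bounded[OF adm \<open>s \<in> S\<close>] fm by metis
  also have "\<dots> < \<infinity>" using f by (simp add: wLp_iff ennreal_mult_less_top)
  finally show "(\<lambda>t. c * translate s f t) \<in> wLp \<mu> p \<omega>"
    by (simp add: wLp_iff modular_cmult ennreal_mult_less_top)
qed

lemma LS_dense_vector_iff:
  assumes adm: "admissible \<mu> S \<omega>"
  shows "LS_dense_vector \<mu> p \<omega> \<Lambda> S f \<longleftrightarrow> f \<in> wLp \<mu> p \<omega> \<and>
    (\<forall>g\<in>wLp \<mu> p \<omega>. \<forall>e>0. \<exists>c\<in>\<Lambda>. \<exists>s\<in>S. modular (\<lambda>t. c * translate s f t - g t) < ennreal e)"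
proof (cases "f \<in> wLp \<mu> p \<omega>")
  case True
  show ?thesis
    unfolding LS_dense_vector_def dense_in_wLp_iff[OF LS_orbit_subset_wLp[OF adm True]]
      modular_uminus_commute[of "\<lambda>t. _ * translate _ f t"]
    using True by fast
qed (simp add: LS_dense_vector_def)

text \<open>Completeness in quantitative form. In the factor
  \<open>(1 / (2 powr p * 2)) ^ Suc n\<close>, the powers of \<open>2 powr p\<close> pay for the
  weights in \<open>convergent_of_powr_series\<close>, and the powers of 1/2 sum to 1. Monotonicity
  of \<open>\<beta>\<close> bounds the whole tail from \<open>n\<close> on by
  \<open>\<beta> n\<close>.\<close>

lemma modular_limit:
  assumes hm[measurable]: "\<And>n. h n \<in> borel_measurable borel"
    and step: "\<And>n. modular (\<lambda>t. h (Suc n) t - h n t) \<le> ennreal (\<beta> n * (1 / (2 powr p * 2)) ^ Suc n)"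
    and \<beta>: "decseq \<beta>" "\<And>n. 0 \<le> \<beta> n"
  obtains f where "f \<in> borel_measurable borel" "\<And>n. modular (\<lambda>t. f t - h n t) \<le> ennreal (\<beta> n)"
proof -
  define P where "P = (2::real) powr p"
  have P: "1 \<le> P" using p_pos by (simp add: P_def ge_one_powr_ge_zero)
  define G where "G n t = (\<Sum>k. ennreal (P ^ Suc k * norm (h (Suc (n + k)) t - h (n + k) t) powr p))" for n t
  have Gm[measurable]: "G n \<in> borel_measurable borel" for n unfolding G_def by measurable
  have int: "(\<integral>\<^sup>+ t. G n t * ennreal (\<omega> t powr p) \<partial>\<mu>) \<le> ennreal (\<beta> n)" for n
  proof -
    have "(\<integral>\<^sup>+ t. G n t * ennreal (\<omega> t powr p) \<partial>\<mu>)
        = (\<integral>\<^sup>+ t. (\<Sum>k. ennreal (P ^ Suc k) *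
            ennreal (norm (h (Suc (n + k)) t - h (n + k) t) powr p * \<omega> t powr p)) \<partial>\<mu>)"
    proof (rule nn_integral_cong)
      fix t
      have "G n t * ennreal (\<omega> t powr p) = (\<Sum>k. ennreal (P ^ Suc k * norm (h (Suc (n + k)) t - h (n + k) t) powr p)
          * ennreal (\<omega> t powr p))"
        unfolding G_def by (rule ennreal_suminf_multc[symmetric])
      also have "\<dots> = (\<Sum>k. ennreal (P ^ Suc k) *
            ennreal (norm (h (Suc (n + k)) t - h (n + k) t) powr p * \<omega> t powr p))"
        using P by (intro suminf_cong) (simp add: mult.assoc flip: ennreal_mult')
      finally show "G n t * ennreal (\<omega> t powr p) = \<dots>" .
    qed
    also have "\<dots> = (\<Sum>k. ennreal (P ^ Suc k) * modular (\<lambda>t. h (Suc (n + k)) t - h (n + k) t))"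
      unfolding modular_def
      by (subst nn_integral_suminf)
        (simp_all add: nn_integral_cmult measurable_cong_sets[OF sets_eq refl] del: power_Suc)
    also have "\<dots> \<le> (\<Sum>k. ennreal (\<beta> n * (1 / 2) ^ Suc k))"
    proof (rule suminf_le)
      fix k
      have "ennreal (P ^ Suc k) * modular (\<lambda>t. h (Suc (n + k)) t - h (n + k) t)
          \<le> ennreal (P ^ Suc k) * ennreal (\<beta> (n + k) * (1 / (P * 2)) ^ Suc (n + k))"
        using step[of "n + k"] by (intro mult_left_mono) (auto simp: P_def)
      also have "\<dots> = ennreal (P ^ Suc k * (\<beta> (n + k) * (1 / (P * 2)) ^ Suc (n + k)))"
        using P by (simp add: ennreal_mult' del: power_Suc)
      also have "\<dots> \<le> ennreal (\<beta> n * (1 / 2) ^ Suc k)"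
      proof (rule ennreal_leI)
        have "P ^ Suc k * (\<beta> (n + k) * (1 / (P * 2)) ^ Suc (n + k))
            \<le> P ^ Suc k * (\<beta> n * (1 / (P * 2)) ^ Suc k)"
          using P \<beta>(2)[of "n + k"] decseqD[OF \<beta>(1), of n "n + k"]
          by (intro mult_left_mono mult_mono power_decreasing) auto
        also have "\<dots> = \<beta> n * (1 / 2) ^ Suc k"
          using P by (simp add: power_divide power_mult_distrib del: power_Suc)
        finally show "P ^ Suc k * (\<beta> (n + k) * (1 / (P * 2)) ^ Suc (n + k)) \<le> \<beta> n * (1 / 2) ^ Suc k" .
      qed
      finally show "ennreal (P ^ Suc k) * modular (\<lambda>t. h (Suc (n + k)) t - h (n + k) t)
          \<le> ennreal (\<beta> n * (1 / 2) ^ Suc k)" .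
    qed auto
    also have "\<dots> = ennreal (\<beta> n)"
    proof (rule suminf_ennreal_eq)
      show "(\<lambda>k. \<beta> n * (1 / 2) ^ Suc k) sums \<beta> n"
        using sums_mult[OF power_half_series, of "\<beta> n"] by simp
    qed (use \<beta>(2) in auto)
    finally show ?thesis .
  qed
  \<comment> \<open>\<open>lim\<close> gives a measurable function on the whole group; its values
    where the sequence diverges do not matter, as finiteness of \<open>G n\<close> almost everywhere
    makes that set null.\<close>
  define f where "f t = lim (\<lambda>n. h n t)" for t
  show ?thesis
  proof
    show fm: "f \<in> borel_measurable borel" unfolding f_def by measurable
    fix n
    have "AE t in \<mu>. G n t * ennreal (\<omega> t powr p) \<noteq> \<infinity>"
    proof (rule nn_integral_PInf_AE)
      have "(\<integral>\<^sup>+ t. G n t * ennreal (\<omega> t powr p) \<partial>\<mu>) < \<infinity>"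
        using int[of n] by (rule order_le_less_trans) simp
      then show "(\<integral>\<^sup>+ t. G n t * ennreal (\<omega> t powr p) \<partial>\<mu>) \<noteq> \<infinity>" by simp
    qed (simp add: measurable_cong_sets[OF sets_eq refl])
    then have "AE t in \<mu>. ennreal (norm (f t - h n t) powr p * \<omega> t powr p)
        \<le> G n t * ennreal (\<omega> t powr p)"
    proof eventually_elim
      case (elim t)
      have w: "0 < \<omega> t powr p" using weight_pos[of t] by simp
      have "G n t < \<infinity>"
      proof (rule ccontr)
        assume "\<not> G n t < \<infinity>"
        then have "G n t = \<infinity>" by (simp add: not_less top_unique)
        then show False using elim w by (simp add: ennreal_top_mult)
      qed
      then have "(\<Sum>k. ennreal ((2 powr p) ^ Suc k * norm (h (n + Suc k) t - h (n + k) t) powr p)) < \<infinity>"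
        by (simp add: G_def P_def del: power_Suc)
      then obtain L where L: "(\<lambda>k. h (n + k) t) \<longlonglongrightarrow> L"
        "ennreal (norm (L - h (n + 0) t) powr p)
          \<le> (\<Sum>k. ennreal ((2 powr p) ^ Suc k * norm (h (n + Suc k) t - h (n + k) t) powr p))"
        by (rule convergent_of_powr_series[OF p_ge_1, of "\<lambda>k. h (n + k) t"])
      have "(\<lambda>k. h (k + n) t) \<longlonglongrightarrow> L" using L(1) by (simp add: add.commute)
      then have "(\<lambda>k. h k t) \<longlonglongrightarrow> L" by (rule LIMSEQ_offset)
      then have "f t = L" unfolding f_def by (rule limI)
      then have "ennreal (norm (f t - h n t) powr p) \<le> G n t"
        using L(2) by (simp add: G_def P_def del: power_Suc)
      then have "ennreal (norm (f t - h n t) powr p) * ennreal (\<omega> t powr p)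
          \<le> G n t * ennreal (\<omega> t powr p)"
        by (rule mult_right_mono) simp
      then show ?case by (simp flip: ennreal_mult')
    qed
    then have "modular (\<lambda>t. f t - h n t) \<le> (\<integral>\<^sup>+ t. G n t * ennreal (\<omega> t powr p) \<partial>\<mu>)"
      unfolding modular_def by (rule nn_integral_mono_AE)
    also note int
    finally show "modular (\<lambda>t. f t - h n t) \<le> ennreal (\<beta> n)" .
  qed
qed

theorem dense_vector_of_mixing:
  assumes adm: "admissible \<mu> S \<omega>" and mix: "mixing \<Lambda> S"
  shows "\<exists>f. LS_dense_vector \<mu> p \<omega> \<Lambda> S f"
proof -
  obtain Q where Q: "countable Q" "Q \<noteq> {}" "Q \<subseteq> bcs"
    "\<And>f e. f \<in> wLp \<mu> p \<omega> \<Longrightarrow> 0 < e \<Longrightarrow> \<exists>q\<in>Q. modular (\<lambda>t. f t - q t) < ennreal e"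
    using countable_dense_bcs by blast
  have "\<forall>s\<in>S. \<exists>C>0. \<forall>f\<in>borel_measurable borel. modular (translate s f) \<le> ennreal C * modular f"
    using modular_translate_bounded[OF adm] by metis
  then obtain C where C: "\<And>s. s \<in> S \<Longrightarrow> 0 < C s"
    "\<And>s f. s \<in> S \<Longrightarrow> f \<in> borel_measurable borel \<Longrightarrow> modular (translate s f) \<le> ennreal (C s) * modular f"
    by metis
  define B where "B c s = norm c powr p * C s" for c :: complex and s
  \<comment> \<open>Pairs a target with a tolerance, so that each element of \<open>Q\<close> occurs
    with each tolerance \<open>1 / Suc m\<close>.\<close>
  define \<tau> where "\<tau> = from_nat_into (Q \<times> (UNIV :: nat set))"
  define v where "v n = fst (\<tau> n)" for n
  define e where "e n = 1 / real (Suc (snd (\<tau> n)))" for n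
  have e: "0 < e n" for n by (simp add: e_def)
  have \<tau>: "\<tau> n \<in> Q \<times> UNIV" for n
    unfolding \<tau>_def using Q(2) by (intro from_nat_into) auto
  then have v: "v n \<in> Q" for n unfolding v_def by (metis mem_Times_iff)
  have \<tau>_surj: "\<exists>n. v n = q \<and> e n = 1 / real (Suc m)" if "q \<in> Q" for q m
  proof -
    have "countable (Q \<times> (UNIV :: nat set))" using Q(1) by auto
    from from_nat_into_surj[OF this, of "(q, m)"] that obtain n where "\<tau> n = (q, m)"
      by (auto simp: \<tau>_def)
    then show ?thesis by (intro exI[of _ n]) (simp add: v_def e_def)
  qed
  \<comment> \<open>A state holds the current function \<open>h\<close>, the multiplier and
    translation that send it near \<open>v n\<close>, and a budget \<open>\<beta>\<close>: a later
    change of \<open>h\<close> with modular at most \<open>\<beta>\<close> changes the image by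
    modular at most \<open>e n\<close>.\<close>
  define I where "I n x = (case x of (h, c, s, \<beta>) \<Rightarrow> h \<in> bcs \<and> c \<in> \<Lambda> \<and> s \<in> S \<and> (0::real) < \<beta> \<and>
    \<beta> * B c s \<le> e n \<and> modular (\<lambda>t. c * translate s h t - v n t) \<le> ennreal (e n))" for n x
  \<comment> \<open>Budgets never grow, and each correction uses a geometric fraction of the current
    one, so all changes after stage \<open>n\<close> together stay within the budget of stage
    \<open>n\<close>.\<close>
  define R where "R n x y = (case x of (h, c :: complex, s :: 'g, \<beta>) \<Rightarrow> case y of (h', c' :: complex, s' :: 'g, \<beta>') \<Rightarrow>
    \<beta>' \<le> \<beta> \<and> modular (\<lambda>t. h' t - h t) \<le> ennreal (\<beta> * (1 / (2 powr p * 2)) ^ Suc n))" for n x y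
  have next_step: "\<exists>h' c s \<beta>'. I n (h', c, s, \<beta>') \<and> \<beta>' \<le> \<beta> \<and> modular (\<lambda>t. h' t - h t) \<le> ennreal \<delta>"
    if h: "h \<in> bcs" and pos: "0 < \<beta>" "0 < \<delta>" for h n \<beta> \<delta>
  proof -
    have "0 < min \<delta> (e n)" using pos e by simp
    then obtain s c h' where 1: "s \<in> S" "c \<in> \<Lambda>" "c \<noteq> 0" "h' \<in> bcs"
      "modular (\<lambda>t. h' t - h t) \<le> ennreal (min \<delta> (e n))"
      "modular (\<lambda>t. c * translate s h' t - v n t) \<le> ennreal (min \<delta> (e n))"
      using mixing_step[OF mix h, of "v n"] v Q(3) by blast
    have B: "0 < B c s" unfolding B_def using 1 C(1) by simp
    have "min \<beta> (e n / B c s) * B c s \<le> e n / B c s * B c s"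
      using B by (intro mult_right_mono) auto
    then have "I n (h', c, s, min \<beta> (e n / B c s))"
      using 1 pos e[of n] B by (auto simp: I_def elim: order_trans intro: ennreal_leI)
    moreover have "modular (\<lambda>t. h' t - h t) \<le> ennreal \<delta>"
      using 1(5) by (rule order_trans) (simp add: ennreal_leI)
    ultimately show ?thesis by (meson min.cobounded1)
  qed
  have "\<exists>x. \<forall>n. I n (x n) \<and> R n (x n) (x (Suc n))"
  proof (rule dependent_nat_choice)
    have "v 0 \<in> bcs" using v Q(3) by blast
    from next_step[OF this, of 1 1 0] show "\<exists>x. I 0 x" by auto
  next
    fix x n assume "I n x"
    moreover obtain h c s \<beta> where x: "x = (h, c, s, \<beta>)" by (cases x) auto
    ultimately have "h \<in> bcs" "0 < \<beta>" by (auto simp: I_def)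
    then have "0 < \<beta> * (1 / (2 powr p * 2)) ^ Suc n" by simp
    from next_step[OF \<open>h \<in> bcs\<close> \<open>0 < \<beta>\<close> this, of "Suc n"]
    obtain h' c' s' \<beta>' where "I (Suc n) (h', c', s', \<beta>')" "R n x (h', c', s', \<beta>')"
      unfolding R_def x by auto
    then show "\<exists>y. I (Suc n) y \<and> R n x y" by blast
  qed
  then obtain x where x: "\<And>n. I n (x n)" "\<And>n. R n (x n) (x (Suc n))" by blast
  define h where "h n = fst (x n)" for n
  define c where "c n = fst (snd (x n))" for n
  define s where "s n = fst (snd (snd (x n)))" for n
  define \<beta> where "\<beta> n = snd (snd (snd (x n)))" for n
  have x_eq: "x n = (h n, c n, s n, \<beta> n)" for n by (simp add: h_def c_def s_def \<beta>_def)
  have I: "h n \<in> bcs" "c n \<in> \<Lambda>" "s n \<in> S" "0 < \<beta> n" "\<beta> n * B (c n) (s n) \<le> e n"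
    "modular (\<lambda>t. c n * translate (s n) (h n) t - v n t) \<le> ennreal (e n)" for n
    using x(1)[of n] unfolding x_eq I_def by auto
  have R: "\<beta> (Suc n) \<le> \<beta> n"
    "modular (\<lambda>t. h (Suc n) t - h n t) \<le> ennreal (\<beta> n * (1 / (2 powr p * 2)) ^ Suc n)" for n
    using x(2)[of n] unfolding x_eq R_def by auto
  have hm[measurable]: "h n \<in> borel_measurable borel" for n using I(1) by (rule bcs_measurable)
  have vm[measurable]: "v n \<in> borel_measurable borel" for n using v Q(3) bcs_measurable by blast
  obtain f where fm[measurable]: "f \<in> borel_measurable borel"
    and f: "\<And>n. modular (\<lambda>t. f t - h n t) \<le> ennreal (\<beta> n)"
    using modular_limit[of h \<beta>] hm R I(4) by (metis decseq_SucI less_imp_le)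
  define P where "P = (2::real) powr p"
  have P: "0 < P" by (simp add: P_def)
  have close: "modular (\<lambda>t. c n * translate (s n) f t - v n t) \<le> ennreal (P * (e n + e n))" for n
  proof -
    have "modular (\<lambda>t. c n * translate (s n) f t - c n * translate (s n) (h n) t)
        = ennreal (norm (c n) powr p) * modular (translate (s n) (\<lambda>t. f t - h n t))"
      by (subst modular_cmult[symmetric])
        (simp_all add: translate_measurable, simp add: translate_def right_diff_distrib)
    also have "\<dots> \<le> ennreal (norm (c n) powr p) * (ennreal (C (s n)) * ennreal (\<beta> n))"
      using order_trans[OF C(2)[OF I(3)] mult_left_mono[OF f]] by (intro mult_left_mono) auto
    also have "\<dots> = ennreal (\<beta> n * B (c n) (s n))"
      unfolding B_def using C(1)[OF I(3)[of n]] I(4)[of n] by (simp add: mult_ac flip: ennreal_mult')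
    also have "\<dots> \<le> ennreal (e n)" using I(5) by (rule ennreal_leI)
    finally have 1: "modular (\<lambda>t. c n * translate (s n) f t - c n * translate (s n) (h n) t)
        \<le> ennreal (e n)" .
    have "modular (\<lambda>t. c n * translate (s n) f t - v n t) \<le> ennreal P *
       (modular (\<lambda>t. c n * translate (s n) f t - c n * translate (s n) (h n) t)
        + modular (\<lambda>t. c n * translate (s n) (h n) t - v n t))"
      unfolding P_def by (rule modular_diff_trans) measurable
    also have "\<dots> \<le> ennreal P * (ennreal (e n) + ennreal (e n))"
      using 1 I(6) by (intro mult_left_mono add_mono) auto
    also have "\<dots> = ennreal (P * (e n + e n))"
      using e[of n] P by (simp flip: ennreal_plus ennreal_mult')
    finally show ?thesis .
  qed
  have "f \<in> wLp \<mu> p \<omega>"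
  proof -
    have "modular f \<le> ennreal (2 powr p) * (modular (\<lambda>t. f t - h 0 t) + modular (h 0))"
    proof (rule modular_add_le)
      show "norm (f t) \<le> norm (f t - h 0 t) + norm (h 0 t)" for t
        using norm_triangle_ineq[of "f t - h 0 t" "h 0 t"] by simp
    qed measurable
    also have "\<dots> < \<infinity>"
      using order_le_less_trans[OF f[of 0]] bcs_wLp[OF I(1)[of 0]]
      by (auto simp: wLp_iff ennreal_mult_less_top)
    finally show ?thesis using fm by (simp add: wLp_iff)
  qed
  moreover have "\<exists>c\<in>\<Lambda>. \<exists>s\<in>S. modular (\<lambda>t. c * translate s f t - g t) < ennreal \<epsilon>"
    if g: "g \<in> wLp \<mu> p \<omega>" and "0 < \<epsilon>" for g \<epsilon>
  proof -
    have gm[measurable]: "g \<in> borel_measurable borel" using g by (simp add: wLp_iff)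
    \<comment> \<open>Solves \<open>P * (P * (d + d) + d) = \<epsilon>\<close>: one factor
      \<open>P\<close> for each of two nested uses of the quasi-triangle inequality.\<close>
    define d where "d = \<epsilon> / (P * (P * 2 + 1))"
    have d: "0 < d" "P * (P * (d + d) + d) = \<epsilon>"
      using P \<open>0 < \<epsilon>\<close> by (auto simp: d_def divide_simps intro!: mult_pos_pos add_pos_pos)
        (auto simp: algebra_simps)
    obtain q where q: "q \<in> Q" "modular (\<lambda>t. g t - q t) < ennreal d" using Q(4)[OF g d(1)] by blast
    obtain m where m: "1 / real (Suc m) < d" using nat_approx_posE[OF d(1)] by blast
    obtain n where n: "v n = q" "e n = 1 / real (Suc m)" using \<tau>_surj[OF q(1)] by blast
    have "modular (\<lambda>t. c n * translate (s n) f t - g t) \<le> ennreal P *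
       (modular (\<lambda>t. c n * translate (s n) f t - v n t) + modular (\<lambda>t. v n t - g t))"
      unfolding P_def by (rule modular_diff_trans) measurable
    also have "\<dots> < ennreal P * (ennreal (P * (d + d)) + ennreal d)"
    proof (intro ennreal_mult_strict_left_mono add_strict_mono)
      have "P * (e n + e n) < P * (d + d)"
        using P m n by (intro mult_strict_left_mono add_strict_mono) auto
      then show "modular (\<lambda>t. c n * translate (s n) f t - v n t) < ennreal (P * (d + d))"
        using P d by (intro order_le_less_trans[OF close] ennreal_lessI) auto
      show "modular (\<lambda>t. v n t - g t) < ennreal d"
        using q(2) n(1) by (simp add: modular_uminus_commute[of q])
    qed (use P in auto)
    also have "\<dots> = ennreal \<epsilon>" using d P by (simp flip: ennreal_plus ennreal_mult')
    finally show ?thesis using I(2,3) by blast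
  qed
  ultimately show ?thesis unfolding LS_dense_vector_iff[OF adm] by blast
qed


section \<open>Necessity\<close>

text \<open>Keeps the zero function away from the indicator, so that a multiple of a translate close
  to the indicator has a nonzero multiplier.\<close>

lemma modular_indicator_pos:
  assumes [measurable]: "F \<in> sets borel" and pos: "0 < emeasure \<mu> F"
  shows "0 < modular (indicator F)"
proof (rule ccontr)
  assume "\<not> 0 < modular (indicator F)"
  then have "(\<integral>\<^sup>+ t. ennreal (norm (indicator F t :: complex) powr p * \<omega> t powr p) \<partial>\<mu>) = 0"
    by (simp add: modular_def)
  then have "AE t in \<mu>. ennreal (norm (indicator F t :: complex) powr p * \<omega> t powr p) = 0"
    by (subst (asm) nn_integral_0_iff_AE) (simp_all add: measurable_cong_sets[OF sets_eq refl])
  then have "AE t in \<mu>. t \<notin> F"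
  proof eventually_elim
    case (elim t)
    then show ?case using weight_pos[of t] by (auto simp: indicator_def ennreal_eq_0_iff not_le)
  qed
  then have "emeasure \<mu> F = 0"
    by (subst (asm) AE_iff_measurable[of F]) (auto simp: sets_eq)
  with pos show False by simp
qed

text \<open>\<open>- r\<close> may lie outside \<open>S\<close>, so translation by
  \<open>- r\<close> need not act on the weighted space. It does act on \<open>bcs\<close>, which is
  why the target is taken there: \<open>w\<close> is mapped to \<open>v\<close> by \<open>b\<close>
  times translation by \<open>r\<close>, and approximations of \<open>w\<close> along the orbit of
  \<open>f\<close> become approximations of \<open>v\<close> once the translations are
  interchanged.\<close>

lemma dense_vector_multiple:
  assumes adm: "admissible \<mu> S \<omega>" and comm: "\<And>r s. r \<in> S \<Longrightarrow> s \<in> S \<Longrightarrow> r + s = s + r"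
    and f: "LS_dense_vector \<mu> p \<omega> \<Lambda> S f"
    and r: "r \<in> S" and "b \<noteq> 0" and v: "v \<in> bcs" and "0 < e"
  obtains c s where "c \<in> \<Lambda>" "s \<in> S"
    "modular (\<lambda>t. c * translate s (\<lambda>t. b * translate r f t) t - v t) < ennreal e"
proof -
  obtain C where C: "0 < C"
    "\<And>f. f \<in> borel_measurable borel \<Longrightarrow> modular (translate r f) \<le> ennreal C * modular f"
    using modular_translate_bounded[OF adm r] by blast
  define w where "w = (\<lambda>t. inverse b * translate (- r) v t)"
  have w: "w \<in> bcs" unfolding w_def using v by (intro bcs_cmult bcs_translate)
  have fm: "f \<in> borel_measurable borel"
    using f unfolding LS_dense_vector_iff[OF adm] by (simp add: wLp_iff)
  have vm: "v \<in> borel_measurable borel" and wm: "w \<in> borel_measurable borel"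
    using v w bcs_measurable by auto
  define B where "B = norm b powr p * C"
  have B: "0 < B" using C \<open>b \<noteq> 0\<close> by (simp add: B_def)
  have "0 < e / B" using \<open>0 < e\<close> B by simp
  then obtain c s where cs: "c \<in> \<Lambda>" "s \<in> S" "modular (\<lambda>t. c * translate s f t - w t) < ennreal (e / B)"
    using f bcs_wLp[OF w] unfolding LS_dense_vector_iff[OF adm] by metis
  have "(\<lambda>t. c * translate s (\<lambda>t. b * translate r f t) t - v t)
      = (\<lambda>t. b * translate r (\<lambda>t. c * translate s f t - w t) t)"
  proof
    fix t
    have "- r + (- s + t) = - s + (- r + t)"
      using comm[OF r cs(2)] by (metis add.assoc minus_add)
    moreover have "- (- r) + (- r + t) = t" by (simp add: add.assoc[symmetric])
    ultimately show "c * translate s (\<lambda>t. b * translate r f t) t - v t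
        = b * translate r (\<lambda>t. c * translate s f t - w t) t"
      using \<open>b \<noteq> 0\<close> by (simp add: translate_def w_def right_diff_distrib)
  qed
  then have "modular (\<lambda>t. c * translate s (\<lambda>t. b * translate r f t) t - v t)
      = modular (\<lambda>t. b * translate r (\<lambda>t. c * translate s f t - w t) t)" by simp
  also have "\<dots> = ennreal (norm b powr p) * modular (translate r (\<lambda>t. c * translate s f t - w t))"
    using fm wm by (intro modular_cmult translate_measurable) measurable
  also have "\<dots> \<le> ennreal (norm b powr p) * (ennreal C * modular (\<lambda>t. c * translate s f t - w t))"
    using fm wm by (intro mult_left_mono C(2)) auto
  also have "\<dots> = ennreal B * modular (\<lambda>t. c * translate s f t - w t)"
    using C by (simp add: B_def ennreal_mult' mult.assoc)
  also have "\<dots> < ennreal B * ennreal (e / B)"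
    using cs(3) B by (intro ennreal_mult_strict_left_mono) auto
  also have "\<dots> = ennreal e" using B \<open>0 < e\<close> by (simp flip: ennreal_mult')
  finally show ?thesis using that cs by blast
qed

text \<open>The two unweighted inequalities concern points of \<open>F\<close> and come from
  \<open>small_in_measure\<close>. The two weighted ones concern shifted points, outside the reach
  of compactness, and come from the translated Chebyshev bound. The threshold \<open>e\<close> is
  independent of \<open>c\<close> and \<open>s\<close>, which are found only after it is
  fixed.\<close>

lemma good_set:
  assumes F: "compact F" and "0 < \<eta>" "0 < \<delta>" "0 < \<kappa>"
  obtains e where "0 < e"
    "\<And>h u v c s. h \<in> borel_measurable borel \<Longrightarrow> u \<in> borel_measurable borel \<Longrightarrow>
      v \<in> borel_measurable borel \<Longrightarrow> modular (\<lambda>t. h t - u t) \<le> ennreal e \<Longrightarrow>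
      modular (\<lambda>t. c * translate s h t - v t) \<le> ennreal e \<Longrightarrow>
      \<exists>E\<in>sets borel. E \<subseteq> F \<and> emeasure \<mu> (F - E) \<le> ennreal \<delta> \<and> (\<forall>t\<in>E.
        norm (h t - u t) < \<kappa> \<and> norm (c * h (- s + t) - v t) < \<kappa> \<and>
        norm (h (- s + t) - u (- s + t)) * \<omega> (- s + t) < \<eta> \<and>
        norm (c * h t - v (s + t)) * \<omega> (s + t) < \<eta>)"
proof -
  have Fm[measurable]: "F \<in> sets borel" using F by (rule borel_compact)
  obtain e where e: "0 < e"
    "\<And>f. f \<in> borel_measurable borel \<Longrightarrow> modular f \<le> ennreal e \<Longrightarrow>
        emeasure \<mu> {t\<in>F. \<kappa> \<le> norm (f t)} \<le> ennreal (\<delta> / 4)"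
    using small_in_measure[OF F \<open>0 < \<kappa>\<close>, of "\<delta> / 4"] \<open>0 < \<delta>\<close> by auto
  show ?thesis
  proof
    show "0 < min e (\<eta> powr p * (\<delta> / 4))" using e assms by simp
    fix h u v c s
    assume hm[measurable]: "h \<in> borel_measurable borel" and um[measurable]: "u \<in> borel_measurable borel"
      and vm[measurable]: "v \<in> borel_measurable borel"
      and le: "modular (\<lambda>t. h t - u t) \<le> ennreal (min e (\<eta> powr p * (\<delta> / 4)))"
        "modular (\<lambda>t. c * translate s h t - v t) \<le> ennreal (min e (\<eta> powr p * (\<delta> / 4)))"
    define f where "f = (\<lambda>t. h t - u t)"
    define g where "g = (\<lambda>t. c * translate s h t - v t)"
    have fm[measurable]: "f \<in> borel_measurable borel" unfolding f_def by measurable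
    have gm[measurable]: "g \<in> borel_measurable borel" unfolding g_def by measurable
    have small: "modular f \<le> ennreal e" "modular f \<le> ennreal (\<eta> powr p * (\<delta> / 4))"
      "modular g \<le> ennreal e" "modular g \<le> ennreal (\<eta> powr p * (\<delta> / 4))"
      unfolding f_def g_def
      by (rule order_trans[OF le(1)] order_trans[OF le(2)], rule ennreal_leI, simp)+
    define A where "A = {t\<in>F. \<kappa> \<le> norm (f t)}"
    define A' where "A' = {t\<in>F. \<kappa> \<le> norm (g t)}"
    define B where "B = {t. \<eta> \<le> norm (f (- s + t)) * \<omega> (- s + t)}"
    define B' where "B' = {t. \<eta> \<le> norm (g (s + t)) * \<omega> (s + t)}"
    have m: "A \<in> sets borel" "A' \<in> sets borel" unfolding A_def A'_def by measurable
    have "{t. \<eta> \<le> norm (f t) * \<omega> t} \<in> sets borel" "{t. \<eta> \<le> norm (g t) * \<omega> t} \<in> sets borel"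
      by measurable
    then have m': "B \<in> sets borel" "B' \<in> sets borel"
      using measurable_sets[OF measurable_translation, of "{t. \<eta> \<le> norm (f t) * \<omega> t}" "- s"]
        measurable_sets[OF measurable_translation, of "{t. \<eta> \<le> norm (g t) * \<omega> t}" s]
      by (simp_all add: B_def B'_def vimage_def)
    have le4: "emeasure \<mu> A \<le> ennreal (\<delta> / 4)" "emeasure \<mu> A' \<le> ennreal (\<delta> / 4)"
      "emeasure \<mu> B \<le> ennreal (\<delta> / 4)" "emeasure \<mu> B' \<le> ennreal (\<delta> / 4)"
      unfolding A_def A'_def B_def B'_def
      using e(2)[OF fm small(1)] e(2)[OF gm small(3)] chebyshev_translation[OF fm _ _ small(2)]
        chebyshev_translation[OF gm _ _ small(4)] assms by simp_all
    let ?E = "F - (A \<union> A' \<union> B \<union> B')"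
    show "\<exists>E\<in>sets borel. E \<subseteq> F \<and> emeasure \<mu> (F - E) \<le> ennreal \<delta> \<and> (\<forall>t\<in>E.
        norm (h t - u t) < \<kappa> \<and> norm (c * h (- s + t) - v t) < \<kappa> \<and>
        norm (h (- s + t) - u (- s + t)) * \<omega> (- s + t) < \<eta> \<and>
        norm (c * h t - v (s + t)) * \<omega> (s + t) < \<eta>)"
    proof (intro bexI[of _ ?E] conjI ballI)
      show "?E \<in> sets borel" using m m' by measurable
      have "emeasure \<mu> (F - ?E) \<le> emeasure \<mu> (A \<union> A' \<union> B \<union> B')"
        using m m' by (intro emeasure_mono) (auto simp: sets_eq)
      also have "\<dots> \<le> emeasure \<mu> A + emeasure \<mu> A' + emeasure \<mu> B + emeasure \<mu> B'"
        using m m' by (intro order_trans[OF emeasure_subadditive] add_right_mono) (auto simp: sets_eq)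
      also have "\<dots> \<le> ennreal (\<delta> / 4) + ennreal (\<delta> / 4) + ennreal (\<delta> / 4) + ennreal (\<delta> / 4)"
        using le4 by (intro add_mono) auto
      also have "\<dots> = ennreal \<delta>" using \<open>0 < \<delta>\<close> by (simp flip: ennreal_plus)
      finally show "emeasure \<mu> (F - ?E) \<le> ennreal \<delta>" .
      have cancel: "- s + (s + t) = t" for t by (simp add: add.assoc[symmetric])
      fix t assume t: "t \<in> ?E"
      show "norm (h t - u t) < \<kappa>" using t by (auto simp: A_def f_def)
      show "norm (c * h (- s + t) - v t) < \<kappa>" using t by (auto simp: A'_def g_def translate_def)
      show "norm (h (- s + t) - u (- s + t)) * \<omega> (- s + t) < \<eta>"
        using t by (auto simp: B_def f_def)
      show "norm (c * h t - v (s + t)) * \<omega> (s + t) < \<eta>"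
        using t by (auto simp: B'_def g_def translate_def cancel)
    qed auto
  qed
qed

text \<open>The order of quantifiers matters: one \<open>h\<close> serves all targets
  \<open>v\<close>, so that solutions for different targets can be compared. The atomic case relies
  on this.\<close>

lemma dense_vector_pair:
  assumes adm: "admissible \<mu> S \<omega>" and comm: "\<And>r s. r \<in> S \<Longrightarrow> s \<in> S \<Longrightarrow> r + s = s + r"
    and f: "LS_dense_vector \<mu> p \<omega> \<Lambda> S f"
    and F: "compact F" and pos: "0 < emeasure \<mu> F" and "0 < \<eta>" "0 < \<delta>" "0 < \<kappa>"
  obtains h where "\<And>v. v \<in> bcs \<Longrightarrow> \<exists>c\<in>\<Lambda>. \<exists>s\<in>S. \<exists>E\<in>sets borel.
      E \<subseteq> F \<and> emeasure \<mu> (F - E) \<le> ennreal \<delta> \<and> (\<forall>t\<in>E.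
        norm (h t - 1) < \<kappa> \<and> norm (c * h (- s + t) - v t) < \<kappa> \<and>
        norm (h (- s + t) - indicator F (- s + t)) * \<omega> (- s + t) < \<eta> \<and>
        norm (c * h t - v (s + t)) * \<omega> (s + t) < \<eta>)"
proof -
  have Fm[measurable]: "F \<in> sets borel" using F by (rule borel_compact)
  obtain e where e: "0 < e"
    "\<And>h u v c s. h \<in> borel_measurable borel \<Longrightarrow> u \<in> borel_measurable borel \<Longrightarrow>
      v \<in> borel_measurable borel \<Longrightarrow> modular (\<lambda>t. h t - u t) \<le> ennreal e \<Longrightarrow>
      modular (\<lambda>t. c * translate s h t - v t) \<le> ennreal e \<Longrightarrow>
      \<exists>E\<in>sets borel. E \<subseteq> F \<and> emeasure \<mu> (F - E) \<le> ennreal \<delta> \<and> (\<forall>t\<in>E.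
        norm (h t - u t) < \<kappa> \<and> norm (c * h (- s + t) - v t) < \<kappa> \<and>
        norm (h (- s + t) - u (- s + t)) * \<omega> (- s + t) < \<eta> \<and>
        norm (c * h t - v (s + t)) * \<omega> (s + t) < \<eta>)"
    by (rule good_set[OF F \<open>0 < \<eta>\<close> \<open>0 < \<delta>\<close> \<open>0 < \<kappa>\<close>]) (rule that)
  let ?u = "indicator F :: 'g \<Rightarrow> complex"
  have u: "?u \<in> bcs"
    unfolding bcs_def using F by (intro CollectI conjI exI[of _ F] exI[of _ 1] allI impI) (simp_all add: indicator_def)
  have "modular ?u < \<infinity>" using bcs_wLp[OF u] by (simp add: wLp_iff)
  then obtain a where a: "modular ?u = ennreal a" "0 \<le> a" by (cases "modular ?u") auto
  then have "0 < a" using modular_indicator_pos[OF Fm pos] by simp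
  have fm[measurable]: "f \<in> borel_measurable borel"
    using f unfolding LS_dense_vector_iff[OF adm] by (simp add: wLp_iff)
  \<comment> \<open>Closeness below \<open>a\<close>, the modular of the indicator itself, excludes
    \<open>b = 0\<close>.\<close>
  have "0 < min e a" using e \<open>0 < a\<close> by simp
  moreover have "\<forall>g\<in>wLp \<mu> p \<omega>. \<forall>e>0. \<exists>c\<in>\<Lambda>. \<exists>s\<in>S. modular (\<lambda>t. c * translate s f t - g t) < ennreal e"
    using f unfolding LS_dense_vector_iff[OF adm] by (rule conjunct2)
  ultimately obtain b r where br: "r \<in> S" "modular (\<lambda>t. b * translate r f t - ?u t) < ennreal (min e a)"
    using bcs_wLp[OF u] by blast
  have "b \<noteq> 0"
  proof
    assume "b = 0"
    then have "modular ?u < ennreal (min e a)" using br(2) by (simp add: modular_def)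
    also have "\<dots> \<le> ennreal a" by (simp add: ennreal_leI)
    finally show False using a by simp
  qed
  define h where "h = (\<lambda>t. b * translate r f t)"
  have hm: "h \<in> borel_measurable borel" unfolding h_def by measurable
  have hu: "modular (\<lambda>t. h t - ?u t) \<le> ennreal e"
    unfolding h_def by (rule order_trans[OF less_imp_le[OF br(2)]]) (simp add: ennreal_leI)
  have main: "\<exists>c\<in>\<Lambda>. \<exists>s\<in>S. \<exists>E\<in>sets borel.
      E \<subseteq> F \<and> emeasure \<mu> (F - E) \<le> ennreal \<delta> \<and> (\<forall>t\<in>E.
        norm (h t - ?u t) < \<kappa> \<and> norm (c * h (- s + t) - v t) < \<kappa> \<and>
        norm (h (- s + t) - ?u (- s + t)) * \<omega> (- s + t) < \<eta> \<and>
        norm (c * h t - v (s + t)) * \<omega> (s + t) < \<eta>)" if v: "v \<in> bcs" for v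
  proof -
    obtain c s where cs: "c \<in> \<Lambda>" "s \<in> S" "modular (\<lambda>t. c * translate s h t - v t) < ennreal e"
      using dense_vector_multiple[OF adm comm f br(1) \<open>b \<noteq> 0\<close> v e(1)] unfolding h_def by blast
    show ?thesis
      using e(2)[OF hm bcs_measurable[OF u] bcs_measurable[OF v] hu less_imp_le[OF cs(3)]]
      by (intro bexI[OF _ cs(1)] bexI[OF _ cs(2)])
  qed
  show ?thesis
  proof
    fix v assume "v \<in> bcs"
    from main[OF this] obtain c s E where *: "c \<in> \<Lambda>" "s \<in> S" "E \<in> sets borel" "E \<subseteq> F"
      "emeasure \<mu> (F - E) \<le> ennreal \<delta>" and E: "\<And>t. t \<in> E \<Longrightarrow>
        norm (h t - ?u t) < \<kappa> \<and> norm (c * h (- s + t) - v t) < \<kappa> \<and>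
        norm (h (- s + t) - ?u (- s + t)) * \<omega> (- s + t) < \<eta> \<and>
        norm (c * h t - v (s + t)) * \<omega> (s + t) < \<eta>" by blast
    have "?u t = 1" if "t \<in> E" for t using that *(4) by auto
    then have "\<forall>t\<in>E. norm (h t - 1) < \<kappa> \<and> norm (c * h (- s + t) - v t) < \<kappa> \<and>
        norm (h (- s + t) - ?u (- s + t)) * \<omega> (- s + t) < \<eta> \<and>
        norm (c * h t - v (s + t)) * \<omega> (s + t) < \<eta>"
      using E by simp
    from conjI[OF *(4) conjI[OF *(5) this]] show "\<exists>c\<in>\<Lambda>. \<exists>s\<in>S. \<exists>E\<in>sets borel.
      E \<subseteq> F \<and> emeasure \<mu> (F - E) \<le> ennreal \<delta> \<and> (\<forall>t\<in>E.
        norm (h t - 1) < \<kappa> \<and> norm (c * h (- s + t) - v t) < \<kappa> \<and>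
        norm (h (- s + t) - indicator F (- s + t)) * \<omega> (- s + t) < \<eta> \<and>
        norm (c * h t - v (s + t)) * \<omega> (s + t) < \<eta>)"
      by (intro bexI[OF _ *(1)] bexI[OF _ *(2)] bexI[OF _ *(3)])
  qed
qed

end

section \<open>Scalar estimates for separated targets\<close>

lemma target_separated_left:
  fixes c x v u :: complex and w \<eta> :: real
  assumes "norm (c * x - v) < 1 / 4" "1 \<le> norm v" "norm (x - u) * w < \<eta>" "0 \<le> w"
    and u: "u = 0 \<or> (u = 1 \<and> 1 / 2 \<le> norm (c - v))"
  shows "w \<le> 4 * \<eta> * norm c"
proof -
  \<comment> \<open>In the application \<open>x\<close> is \<open>h (- s + t)\<close>,
    \<open>v\<close> is the target at \<open>t\<close>, and \<open>u\<close> is the indicator of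
    \<open>F\<close> at \<open>- s + t\<close>. As \<open>c * x\<close> is within 1/4 of
    \<open>v\<close>, it keeps distance at least 1/4 from \<open>c * u\<close>: from 0 because
    \<open>norm v\<close> is at least 1, from \<open>c\<close> because \<open>v\<close> is at
    distance at least 1/2 from it.\<close>
  have "1 / 4 \<le> norm c * norm (x - u)"
  proof (cases "u = 0")
    case True
    have "norm v \<le> norm (c * x) + norm (c * x - v)"
      using norm_triangle_ineq4[of "c * x" "c * x - v"] by simp
    then show ?thesis using assms True by (simp add: norm_mult)
  next
    case False
    have "norm (c - v) \<le> norm (c * x - c) + norm (c * x - v)"
      using norm_triangle_ineq4[of "c * x - v" "c * x - c"] by simp
    moreover have "norm (c * x - c) = norm c * norm (x - 1)"
      by (simp add: norm_mult[symmetric] right_diff_distrib)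
    ultimately show ?thesis using assms False by simp
  qed
  then have "1 / 4 * w \<le> norm c * norm (x - u) * w"
    using \<open>0 \<le> w\<close> by (rule mult_right_mono)
  also have "\<dots> \<le> norm c * \<eta>"
    using assms(3) by (simp add: mult.assoc mult_left_mono)
  finally show ?thesis by (simp add: mult_ac)
qed

text \<open>Here \<open>x\<close> stands for \<open>h t\<close> and \<open>v\<close> for the target
  at \<open>s + t\<close>. As \<open>x\<close> is within 1/4 of 1, \<open>c * x\<close> is close to
  \<open>c\<close> only relative to \<open>norm c\<close>. Hence separation of \<open>v\<close> from
  \<open>c\<close> is also measured relatively, and \<open>norm (c * x - v)\<close> is at least
  \<open>norm c / 4\<close> in both cases.\<close>

lemma target_separated_right:
  fixes c x v :: complex and w \<eta> :: real
  assumes "norm (x - 1) < 1 / 4" "norm (c * x - v) * w < \<eta>" "0 \<le> w"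
    and v: "v = 0 \<or> norm c / 2 \<le> norm (c - v)"
  shows "norm c * w \<le> 4 * \<eta>"
proof -
  have cx: "norm (c * x - c) \<le> norm c / 4"
  proof -
    have "norm (c * x - c) = norm c * norm (x - 1)"
      by (simp add: norm_mult[symmetric] right_diff_distrib)
    also have "\<dots> \<le> norm c * (1 / 4)" using assms(1) by (intro mult_left_mono) auto
    finally show ?thesis by simp
  qed
  have "norm c / 4 \<le> norm (c * x - v)"
  proof (cases "v = 0")
    case True
    then show ?thesis
      using cx norm_triangle_sub[of c "c * x"] norm_ge_zero[of c]
      unfolding True diff_zero norm_minus_commute[of c "c * x"] by linarith
  next
    case False
    then show ?thesis
      using cx v norm_triangle_ineq4[of "c * x - v" "c * x - c"] by simp
  qed
  then have "norm c / 4 * w \<le> norm (c * x - v) * w"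
    using \<open>0 \<le> w\<close> by (rule mult_right_mono)
  with assms(2) show ?thesis by simp
qed

lemma power4_gap:
  assumes "i < (j::nat)" shows "4 * 4 ^ i \<le> (4::real) ^ j"
proof -
  have "(4::real) ^ Suc i \<le> 4 ^ j" using assms by (intro power_increasing) auto
  then show ?thesis by simp
qed

lemma power4_near_unique:
  fixes c :: complex
  assumes "norm (c - of_real (4 ^ i)) < 1 / 2" "norm (c - of_real (4 ^ j)) < 1 / 2"
  shows "i = j"
proof -
  have False if "norm (c - of_real (4 ^ i)) < 1 / 2" "norm (c - of_real (4 ^ j)) < 1 / 2" "i < j" for i j
  proof -
    have "(4::real) ^ j - 4 ^ i \<le> norm ((of_real (4 ^ j - 4 ^ i)) :: complex)"
      unfolding norm_of_real by simp
    also have "\<dots> = norm ((c - of_real (4 ^ i)) - (c - of_real (4 ^ j)))" by simp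
    also have "\<dots> < 1"
      using norm_triangle_ineq4[of "c - of_real (4 ^ i)" "c - of_real (4 ^ j)"] that by simp
    finally have "(4::real) ^ j - 4 ^ i < 1" .
    moreover have "(1::real) \<le> 4 ^ i" by simp
    ultimately show False using power4_gap[OF that(3)] by linarith
  qed
  then show ?thesis using assms by (metis linorder_neqE_nat)
qed

text \<open>The condition puts \<open>norm c\<close> strictly between 2/3 of the value and twice the
  value; for distinct powers of 4 these ranges are disjoint.\<close>

lemma power4_relatively_near_unique:
  fixes c :: complex
  assumes "norm (c - of_real (4 ^ i)) < norm c / 2" "norm (c - of_real (4 ^ j)) < norm c / 2"
  shows "i = j"
proof -
  have False if "norm (c - of_real (4 ^ i)) < norm c / 2" "norm (c - of_real (4 ^ j)) < norm c / 2" "i < j" for i j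
  proof -
    have n: "norm (of_real (4 ^ k) :: complex) = 4 ^ k" for k unfolding norm_of_real by simp
    have "norm c \<le> norm (c - of_real (4 ^ i)) + 4 ^ i"
      using norm_triangle_sub[of c "of_real (4 ^ i)"] unfolding n by simp
    moreover have "4 ^ j \<le> norm c + norm (c - of_real (4 ^ j))"
      using norm_triangle_sub[of "of_real (4 ^ j)" c] unfolding n by (simp add: norm_minus_commute)
    moreover have "(0::real) < 4 ^ i" by simp
    ultimately show False using power4_gap[OF that(3)] that(1,2) by linarith
  qed
  then show ?thesis using assms by (metis linorder_neqE_nat)
qed

text \<open>The ratio \<open>norm y / norm x\<close> does not depend on the multiplier. The errors
  of 1/4 confine it to the range from 3/5 to 5/3 of \<open>4 ^ i\<close>, and a factor 4 exceeds
  25/9.\<close>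

lemma power4_ratio_unique:
  fixes c c' x y :: complex
  assumes "norm (c * x - 1) < 1 / 4" "norm (c * y - of_real (4 ^ i)) < 1 / 4"
    and "norm (c' * x - 1) < 1 / 4" "norm (c' * y - of_real (4 ^ j)) < 1 / 4"
  shows "i = j"
proof -
  have False if a: "norm (c * x - 1) < 1 / 4" "norm (c * y - of_real (4 ^ i)) < 1 / 4"
    and b: "norm (c' * x - 1) < 1 / 4" "norm (c' * y - of_real (4 ^ j)) < 1 / 4"
    and "i < j" for c c' i j
  proof -
    have n: "norm (of_real (4 ^ k) :: complex) = 4 ^ k" for k unfolding norm_of_real by simp
    have one: "(1::real) \<le> 4 ^ k" for k :: nat by simp
    have cx: "3 / 4 \<le> norm c * norm x"
      using norm_triangle_ineq4[of "c * x" "c * x - 1"] a(1) by (simp add: norm_mult)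
    have cy: "norm c * norm y \<le> 5 / 4 * 4 ^ i"
      using norm_triangle_sub[of "c * y" "of_real (4 ^ i)"] a(2) one[of i]
      unfolding n norm_mult by linarith
    have cx': "norm c' * norm x \<le> 5 / 4"
      using norm_triangle_sub[of "c' * x" 1] b(1) by (simp add: norm_mult)
    have cy': "3 / 4 * 4 ^ j \<le> norm c' * norm y"
      using norm_triangle_sub[of "of_real (4 ^ j)" "c' * y"] b(2) one[of j]
      unfolding n norm_mult norm_minus_commute[of "of_real (4 ^ j)"] by linarith
    have "3 / 4 * norm y \<le> norm c * norm x * norm y" using cx by (rule mult_right_mono) simp
    also have "\<dots> = norm c * norm y * norm x" by simp
    also have "\<dots> \<le> 5 / 4 * 4 ^ i * norm x" using cy by (rule mult_right_mono) simp
    finally have 1: "3 / 4 * norm y \<le> 5 / 4 * (4 ^ i * norm x)" by simp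
    have "3 / 4 * 4 ^ j * norm x \<le> norm c' * norm y * norm x" using cy' by (rule mult_right_mono) simp
    also have "\<dots> = norm c' * norm x * norm y" by simp
    also have "\<dots> \<le> 5 / 4 * norm y" using cx' by (rule mult_right_mono) simp
    finally have 2: "3 / 4 * (4 ^ j * norm x) \<le> 5 / 4 * norm y" by simp
    have 3: "4 * (4 ^ i * norm x) \<le> 4 ^ j * norm x"
      using mult_right_mono[OF power4_gap[OF \<open>i < j\<close>], of "norm x"] by simp
    have "norm x \<noteq> 0" using cx by auto
    then have "0 < 4 ^ i * norm x" by simp
    with 1 2 3 show False by linarith
  qed
  from this[of c i c' j] this[of c' j c i] show ?thesis using assms by (metis linorder_neqE_nat)
qed

section \<open>Separated targets in the nonatomic and the atomic case\<close>

context weighted_Lp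
begin

text \<open>Enlarging \<open>F\<close> strengthens the condition, so \<open>F\<close> may be assumed
  to have positive measure and two points; afterwards \<open>E\<close> is cut back to the original
  set and shrunk to a compact one.\<close>

lemma mixingI:
  assumes inf: "\<not> compact (UNIV :: 'g set)"
    and *: "\<And>F \<epsilon>. compact F \<Longrightarrow> 0 < emeasure \<mu> F \<Longrightarrow> \<exists>x\<in>F. \<exists>y\<in>F. x \<noteq> y \<Longrightarrow> 0 < \<epsilon> \<Longrightarrow>
      \<exists>s\<in>S. \<exists>c\<in>\<Lambda>. \<exists>E\<in>sets borel. c \<noteq> 0 \<and> E \<subseteq> F \<and> emeasure \<mu> (F - E) < ennreal \<epsilon> \<and>
        (\<forall>t\<in>E. norm c * \<omega> (s + t) \<le> \<epsilon> \<and> \<omega> (- s + t) \<le> \<epsilon> * norm c)"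
  shows "mixing \<Lambda> S"
  unfolding mixing_def
proof (intro allI impI, elim conjE)
  fix F :: "'g set" and \<epsilon> :: real assume F: "compact F" and "0 < \<epsilon>"
  obtain K where K: "compact K" "0 < emeasure \<mu> K"
  proof (rule ccontr)
    assume "\<not> thesis"
    with that have "emeasure \<mu> K = 0" if "compact K" for K using \<open>compact K\<close> by (metis not_gr_zero)
    then have "(SUP K\<in>{K. compact K \<and> K \<subseteq> UNIV}. emeasure \<mu> K) = 0"
      by (intro antisym SUP_least) auto
    moreover have "emeasure \<mu> UNIV = (SUP K\<in>{K. compact K \<and> K \<subseteq> UNIV}. emeasure \<mu> K)"
      using haar open_UNIV unfolding left_haar_measure_def by blast
    ultimately show False using haar by (simp add: left_haar_measure_def)
  qed
  \<comment> \<open>Non-compactness excludes the one-point group. The second point is for the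
    targets of the atomic case, which are distinguished by their values at two points.\<close>
  have "UNIV \<noteq> {0 :: 'g}" using inf by (metis compact_sing)
  then obtain y :: 'g where y: "y \<noteq> 0" by auto
  define F' where "F' = F \<union> K \<union> {0, y}"
  have F': "compact F'" unfolding F'_def by (intro compact_Un[OF compact_Un[OF F K(1)]] finite_imp_compact) simp
  then have F'm: "F' \<in> sets borel" and Fm: "F \<in> sets borel" using F by (auto intro: borel_compact)
  have "0 < emeasure \<mu> F'"
    by (rule order_less_le_trans[OF K(2) emeasure_mono]) (use F'm in \<open>auto simp: F'_def sets_eq\<close>)
  moreover have "\<exists>x\<in>F'. \<exists>y\<in>F'. x \<noteq> y"
    using y by (intro bexI[of _ 0] bexI[of _ y]) (auto simp: F'_def)
  ultimately obtain s c E where E: "s \<in> S" "c \<in> \<Lambda>" "E \<in> sets borel" "c \<noteq> 0" "E \<subseteq> F'"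
    "emeasure \<mu> (F' - E) < ennreal \<epsilon>"
    "\<And>t. t \<in> E \<Longrightarrow> norm c * \<omega> (s + t) \<le> \<epsilon> \<and> \<omega> (- s + t) \<le> \<epsilon> * norm c"
    using *[OF F' _ _ \<open>0 < \<epsilon>\<close>] by blast
  have "emeasure \<mu> (F - E \<inter> F) \<le> emeasure \<mu> (F' - E)"
    using E F'm by (intro emeasure_mono) (auto simp: F'_def sets_eq)
  then have "emeasure \<mu> (F - E \<inter> F) < ennreal \<epsilon>" using E(6) by (rule order_le_less_trans)
  then obtain L where L: "compact L" "L \<subseteq> E \<inter> F" "emeasure \<mu> (F - L) < ennreal \<epsilon>"
    using inner_compact[OF F, of "E \<inter> F" \<epsilon>] E(3) Fm by auto
  show "\<exists>s\<in>S. \<exists>c\<in>\<Lambda>. \<exists>E. c \<noteq> 0 \<and> compact E \<and> E \<subseteq> F \<and> emeasure \<mu> (F - E) < ennreal \<epsilon> \<and>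
       (AE t in \<mu>. t \<in> E \<longrightarrow> norm c * \<omega> (s + t) \<le> \<epsilon> \<and> \<omega> (- s + t) \<le> \<epsilon> * norm c)"
    using E(4,7) L
    by (intro bexI[OF _ E(1)] bexI[OF _ E(2)] exI[of _ L] conjI AE_I2 impI) auto
qed

text \<open>Left invariance gives all singletons the same mass, so if it is positive, a set of
  finite measure has only finitely many points.\<close>

lemma compact_finite_of_atom:
  fixes F :: "'g set"
  assumes F: "compact F" and atom: "emeasure \<mu> {x} \<noteq> 0"
  shows "finite F" and "\<And>y. emeasure \<mu> {y} = emeasure \<mu> {x}"
proof -
  show eq: "emeasure \<mu> {y} = emeasure \<mu> {x}" for y
  proof -
    have "t = y" if "x + - y + t = x" for t
    proof -
      have "x + (- y + t) = x + 0" using that by (simp only: add.assoc add_0_right)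
      then have "- y + t = 0" by (simp only: add_left_cancel)
      then show "t = y" by (simp only: neg_eq_iff_add_eq_0[symmetric] minus_minus)
    qed
    then have "{t. x + - y + t \<in> {x}} = {y}" by (auto simp: add.assoc)
    then show ?thesis
      using emeasure_translation[of "{x}" "x + - y"] by (simp only: borel_singleton sets.empty_sets)
  qed
  define a where "a = measure \<mu> {x}"
  have x: "emeasure \<mu> {x} = ennreal a"
    using compact_finite[of "{x}"] unfolding a_def by (intro emeasure_eq_ennreal_measure) simp
  have "a \<noteq> 0" using atom unfolding x by auto
  then have a: "0 < a" by (simp add: a_def less_le)
  define b where "b = measure \<mu> F"
  have b: "emeasure \<mu> F = ennreal b"
    using compact_finite[OF F] unfolding b_def by (intro emeasure_eq_ennreal_measure) simp
  show "finite F"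
  proof (rule ccontr)
    assume "infinite F"
    obtain n :: nat where n: "b / a < real n" using reals_Archimedean2 by blast
    obtain A where A: "finite A" "card A = n" "A \<subseteq> F"
      using infinite_arbitrarily_large[OF \<open>infinite F\<close>] by blast
    have "ennreal (real n * a) = (\<Sum>y\<in>A. ennreal a)"
      unfolding sum_constant A(2) ennreal_of_nat_eq_real_of_nat by (rule ennreal_mult') simp
    also have "\<dots> = (\<Sum>y\<in>A. emeasure \<mu> {y})"
      by (intro sum.cong refl trans[OF eq x, symmetric])
    also have "\<dots> = emeasure \<mu> A"
      using A by (intro emeasure_eq_sum_singleton[symmetric]) (auto simp: sets_eq)
    also have "\<dots> \<le> ennreal b"
      unfolding b[symmetric] using A(3) compact_sets[OF F] by (rule emeasure_mono)
    finally have "real n * a \<le> b"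
      using measure_nonneg[of \<mu> F] unfolding b_def by simp
    moreover have "b < real n * a" using n a by (simp add: pos_divide_less_eq)
    ultimately show False by simp
  qed
qed


text \<open>The tolerance \<open>\<epsilon> / 4\<close> compensates the factor 4 of the scalar
  estimates. Separation from \<open>c\<close> is demanded only where the shifted point lies in
  \<open>F\<close>; elsewhere the indicator and the target vanish there, and the other alternative
  of those estimates applies.\<close>

lemma separated_bounds:
  fixes c :: complex and s :: 'g
  assumes t: "norm (h t - 1) < 1 / 4" "norm (c * h (- s + t) - v t) < 1 / 4"
      "norm (h (- s + t) - indicator F (- s + t)) * \<omega> (- s + t) < \<epsilon> / 4"
      "norm (c * h t - v (s + t)) * \<omega> (s + t) < \<epsilon> / 4"
    and "1 \<le> norm (v t)"
    and "- s + t \<in> F \<Longrightarrow> 1 / 2 \<le> norm (c - v t)"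
    and "s + t \<in> F \<Longrightarrow> norm c / 2 \<le> norm (c - v (s + t))"
    and "\<And>t. t \<notin> F \<Longrightarrow> v t = 0"
  shows "norm c * \<omega> (s + t) \<le> \<epsilon> \<and> \<omega> (- s + t) \<le> \<epsilon> * norm c"
proof
  have "norm c * \<omega> (s + t) \<le> 4 * (\<epsilon> / 4)"
    by (rule target_separated_right[OF t(1,4)]) (use assms weight_pos[of "s + t"] in \<open>auto simp: less_imp_le\<close>)
  then show "norm c * \<omega> (s + t) \<le> \<epsilon>" by simp
  have "\<omega> (- s + t) \<le> 4 * (\<epsilon> / 4) * norm c"
    by (rule target_separated_left[OF t(2) _ t(3)])
      (use assms weight_pos[of "- s + t"] in \<open>auto simp: less_imp_le indicator_def\<close>)
  then show "\<omega> (- s + t) \<le> \<epsilon> * norm c" by simp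
qed

lemma multiplier_nonzero:
  fixes c :: complex
  assumes "norm (c * x - v) < 1 / 4" "1 \<le> norm v" shows "c \<noteq> 0"
  using assms by auto

text \<open>Outer regularity puts each null singleton into an open set of small measure, and
  compactness leaves finitely many of these.\<close>

lemma small_cover:
  assumes F: "compact F" and null: "\<And>x. emeasure \<mu> {x} = 0" and "0 < \<delta>"
  obtains xs where "\<forall>U\<in>set xs. open U \<and> emeasure \<mu> U < ennreal \<delta>" "F \<subseteq> \<Union>(set xs)"
proof -
  have "\<exists>U. open U \<and> x \<in> U \<and> emeasure \<mu> U < ennreal \<delta>" for x
    using outer_open[of "{x}" \<delta>] null \<open>0 < \<delta>\<close> by auto
  then have "F \<subseteq> \<Union>{U. open U \<and> emeasure \<mu> U < ennreal \<delta>}" by blast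
  with F obtain \<U> where \<U>: "finite \<U>" "\<U> \<subseteq> {U. open U \<and> emeasure \<mu> U < ennreal \<delta>}" "F \<subseteq> \<Union>\<U>"
    by (elim compactE) auto
  obtain xs where "set xs = \<U>" using finite_list[OF \<U>(1)] by blast
  with \<U> show ?thesis by (intro that[of xs]) auto
qed

context
  fixes S :: "'g set" and \<Lambda> :: "complex set" and f :: "'g \<Rightarrow> complex"
  assumes adm: "admissible \<mu> S \<omega>" and comm: "\<And>r s. r \<in> S \<Longrightarrow> s \<in> S \<Longrightarrow> r + s = s + r"
    and f: "LS_dense_vector \<mu> p \<omega> \<Lambda> S f"
begin

text \<open>
  The target \<open>v\<close> takes the values \<open>4 ^ i\<close> on small pieces of \<open>F\<close>. Whatever \<open>c\<close> is, at most one
  of these values is close to \<open>c\<close>, so removing a single piece separates \<open>v\<close> from \<open>c\<close>.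
\<close>

lemma mixing_set_nonatomic:
  assumes null: "\<And>x. emeasure \<mu> {x} = 0"
    and F: "compact F" and pos: "0 < emeasure \<mu> F" and "0 < \<epsilon>"
  shows "\<exists>s\<in>S. \<exists>c\<in>\<Lambda>. \<exists>E\<in>sets borel. c \<noteq> 0 \<and> E \<subseteq> F \<and> emeasure \<mu> (F - E) < ennreal \<epsilon> \<and>
        (\<forall>t\<in>E. norm c * \<omega> (s + t) \<le> \<epsilon> \<and> \<omega> (- s + t) \<le> \<epsilon> * norm c)"
proof -
  have Fm[measurable]: "F \<in> sets borel" using F by (rule borel_compact)
  define a where "a = measure \<mu> F"
  have aF: "emeasure \<mu> F = ennreal a"
    using compact_finite[OF F] unfolding a_def by (intro emeasure_eq_ennreal_measure) simp
  have "0 < a" using pos unfolding aF by simp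
  note a = aF this
  \<comment> \<open>In the end three sets of measure at most \<open>\<delta>\<close> are removed
    from \<open>F\<close>; \<open>\<delta> < a\<close> keeps \<open>E\<close> nonempty.\<close>
  define \<delta> where "\<delta> = min a \<epsilon> / 4"
  have \<delta>: "0 < \<delta>" "\<delta> < a" "\<delta> + \<delta> + \<delta> < \<epsilon>"
  proof -
    have "0 < min a \<epsilon>" "min a \<epsilon> \<le> a" "min a \<epsilon> \<le> \<epsilon>" using a(2) \<open>0 < \<epsilon>\<close> by simp_all
    then show "0 < \<delta>" "\<delta> < a" "\<delta> + \<delta> + \<delta> < \<epsilon>" unfolding \<delta>_def by linarith+
  qed
  obtain xs where xs: "\<forall>U\<in>set xs. open U \<and> emeasure \<mu> U < ennreal \<delta>" "F \<subseteq> \<Union>(set xs)"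
    using small_cover[OF F null \<delta>(1)] by blast
  define n where "n = length xs"
  define V where "V i = (if i < n then xs ! i else {})" for i
  have V: "open (V i)" "emeasure \<mu> (V i) \<le> ennreal \<delta>" for i
    using xs(1) by (auto simp: V_def n_def less_imp_le)
  \<comment> \<open>Taking the first index makes the pieces disjoint: the points of \<open>F\<close>
    where the target has the value \<open>4 ^ i\<close> all lie in \<open>V i\<close>.\<close>
  define k where "k t = (LEAST i. t \<in> V i)" for t
  have Vm[measurable]: "V i \<in> sets borel" for i using V(1) by (rule borel_open)
  have k: "t \<in> V (k t)" "k t < n" if t: "t \<in> F" for t
  proof -
    obtain U where "U \<in> set xs" "t \<in> U" using xs(2) t by blast
    then obtain i where i: "i < n" "t \<in> V i" by (auto simp: V_def n_def in_set_conv_nth)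
    show "t \<in> V (k t)" unfolding k_def using i(2) by (rule LeastI)
    have "k t \<le> i" unfolding k_def using i(2) by (rule Least_le)
    then show "k t < n" using i(1) by simp
  qed
  have km[measurable]: "k \<in> measurable borel (count_space UNIV)"
    unfolding k_def by (intro measurable_Least) (simp add: pred_def Vm)
  define v :: "'g \<Rightarrow> complex" where "v t = of_real (4 ^ k t) * indicator F t" for t
  have v_in: "v t = of_real (4 ^ k t)" if "t \<in> F" for t using that by (simp add: v_def)
  have norm_v: "norm (v t) = 4 ^ k t" if "t \<in> F" for t
    unfolding v_in[OF that] norm_of_real by simp
  have v_out: "v t = 0" if "t \<notin> F" for t using that by (simp add: v_def)
  have v: "v \<in> bcs"
    unfolding bcs_def
  proof (intro CollectI conjI exI[of _ F] exI[of _ "4 ^ n"] allI impI F v_out)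
    have "(\<lambda>t. of_real (4 ^ k t) :: complex) \<in> borel_measurable borel"
      by (rule measurable_compose[OF km]) simp
    then show "v \<in> borel_measurable borel" unfolding v_def by measurable
    show "norm (v t) \<le> 4 ^ n" for t
    proof (cases "t \<in> F")
      case True
      then show ?thesis using k(2)[of t] by (simp add: norm_v less_imp_le)
    next
      case False
      then show ?thesis by (simp add: v_out)
    qed
  qed simp_all
  have pos4: "0 < \<epsilon> / 4" "0 < (1 / 4 :: real)" using \<open>0 < \<epsilon>\<close> by simp_all
  obtain h where h0: "\<And>v. v \<in> bcs \<Longrightarrow> \<exists>c\<in>\<Lambda>. \<exists>s\<in>S. \<exists>E\<in>sets borel.
      E \<subseteq> F \<and> emeasure \<mu> (F - E) \<le> ennreal \<delta> \<and> (\<forall>t\<in>E.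
        norm (h t - 1) < 1 / 4 \<and> norm (c * h (- s + t) - v t) < 1 / 4 \<and>
        norm (h (- s + t) - indicator F (- s + t)) * \<omega> (- s + t) < \<epsilon> / 4 \<and>
        norm (c * h t - v (s + t)) * \<omega> (s + t) < \<epsilon> / 4)"
    by (rule dense_vector_pair[OF adm comm f F pos pos4(1) \<delta>(1) pos4(2)]) (assumption | rule that)+
  from h0[OF v] obtain c s E where E: "c \<in> \<Lambda>" "s \<in> S" "E \<in> sets borel" "E \<subseteq> F" "emeasure \<mu> (F - E) \<le> ennreal \<delta>"
    and hE: "\<forall>t\<in>E. norm (h t - 1) < 1 / 4 \<and> norm (c * h (- s + t) - v t) < 1 / 4 \<and>
        norm (h (- s + t) - indicator F (- s + t)) * \<omega> (- s + t) < \<epsilon> / 4 \<and>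
        norm (c * h t - v (s + t)) * \<omega> (s + t) < \<epsilon> / 4"
    by blast
  note h = bspec[OF hE]
  \<comment> \<open>One point of \<open>E\<close> suffices to exclude \<open>c = 0\<close>, since
    there \<open>c * h (- s + t)\<close> is close to a value of norm at least 1.\<close>
  have "E \<noteq> {}"
  proof
    assume "E = {}"
    then have "ennreal a \<le> ennreal \<delta>" using E(5) a by simp
    then show False using \<delta> a by simp
  qed
  then obtain t\<^sub>0 where "t\<^sub>0 \<in> E" by blast
  have norm_v1: "1 \<le> norm (v t)" if "t \<in> E" for t
    using that E(4) by (subst norm_v) auto
  have "c \<noteq> 0" using h[OF \<open>t\<^sub>0 \<in> E\<close>] norm_v1[OF \<open>t\<^sub>0 \<in> E\<close>] by (intro multiplier_nonzero) (elim conjE)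
  \<comment> \<open>All points of \<open>F\<close> at which \<open>v\<close> is near
    \<open>c\<close> share one value, hence lie in a single \<open>V i\<close>.\<close>
  obtain B where B: "B \<in> sets borel" "emeasure \<mu> B \<le> ennreal \<delta>"
    "\<And>t. t \<in> F \<Longrightarrow> norm (c - v t) < 1 / 2 \<Longrightarrow> t \<in> B"
  proof (cases "\<exists>t\<in>F. norm (c - v t) < 1 / 2")
    case True
    then obtain t where t: "t \<in> F" "norm (c - v t) < 1 / 2" by blast
    show thesis
    proof (rule that[of "V (k t)"])
      show "t' \<in> V (k t)" if "t' \<in> F" "norm (c - v t') < 1 / 2" for t'
        using power4_near_unique[of c "k t" "k t'"] k(1)[of t'] that t by (simp add: v_in)
    qed (rule Vm V(2))+
  next
    case False
    then show thesis by (intro that[of "{}"]) auto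
  qed
  obtain B' where B': "B' \<in> sets borel" "emeasure \<mu> B' \<le> ennreal \<delta>"
    "\<And>t. t \<in> F \<Longrightarrow> norm (c - v t) < norm c / 2 \<Longrightarrow> t \<in> B'"
  proof (cases "\<exists>t\<in>F. norm (c - v t) < norm c / 2")
    case True
    then obtain t where t: "t \<in> F" "norm (c - v t) < norm c / 2" by blast
    show thesis
    proof (rule that[of "V (k t)"])
      show "t' \<in> V (k t)" if "t' \<in> F" "norm (c - v t') < norm c / 2" for t'
        using power4_relatively_near_unique[of c "k t" "k t'"] k(1)[of t'] that t by (simp add: v_in)
    qed (rule Vm V(2))+
  next
    case False
    then show thesis by (intro that[of "{}"]) auto
  qed
  \<comment> \<open>The relative separation is used at \<open>s + t\<close>, so its exceptional set
    is pulled back along the translation, which preserves its measure.\<close>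
  define B'' where "B'' = {t. s + t \<in> B'}"
  have B''m: "B'' \<in> sets borel"
    using measurable_sets[OF measurable_translation B'(1), of s] by (simp add: B''_def vimage_def)
  have B''e: "emeasure \<mu> B'' \<le> ennreal \<delta>"
    using emeasure_translation[OF B'(1)] B'(2) by (simp add: B''_def)
  have "emeasure \<mu> (F - (E - B - B'')) \<le> emeasure \<mu> (F - E \<union> B \<union> B'')"
    using B B''m E(3) by (intro emeasure_mono) (auto simp: sets_eq)
  also have "\<dots> \<le> emeasure \<mu> (F - E) + emeasure \<mu> B + emeasure \<mu> B''"
    using B B''m E(3) by (intro order_trans[OF emeasure_subadditive] add_right_mono) (auto simp: sets_eq)
  also have "\<dots> \<le> ennreal \<delta> + ennreal \<delta> + ennreal \<delta>"
    using E(5) B(2) B''e by (intro add_mono)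
  also have "\<dots> = ennreal (\<delta> + \<delta> + \<delta>)" using \<delta>(1) by (simp flip: ennreal_plus)
  also have "\<dots> < ennreal \<epsilon>" using \<delta>(3) \<open>0 < \<epsilon>\<close> by (intro ennreal_lessI)
  finally have small: "emeasure \<mu> (F - (E - B - B'')) < ennreal \<epsilon>" .
  have "norm c * \<omega> (s + t) \<le> \<epsilon> \<and> \<omega> (- s + t) \<le> \<epsilon> * norm c" if t: "t \<in> E - B - B''" for t
  proof (rule separated_bounds[where h=h and v=v and F=F])
    have tE: "t \<in> E" "t \<in> F" "t \<notin> B" "s + t \<notin> B'" using t E(4) by (auto simp: B''_def)
    show "1 / 2 \<le> norm (c - v t)" using B(3)[of t] tE by (meson not_less)
    show "norm c / 2 \<le> norm (c - v (s + t))" if "s + t \<in> F" using B'(3)[OF that] tE by (meson not_less)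
    show "1 \<le> norm (v t)" using tE(1) by (rule norm_v1)
    show "norm (h t - 1) < 1 / 4" "norm (c * h (- s + t) - v t) < 1 / 4"
      "norm (h (- s + t) - indicator F (- s + t)) * \<omega> (- s + t) < \<epsilon> / 4"
      "norm (c * h t - v (s + t)) * \<omega> (s + t) < \<epsilon> / 4"
      using h[OF tE(1)] by blast+
  qed (rule v_out)
  then have all: "\<forall>t\<in>E - B - B''. norm c * \<omega> (s + t) \<le> \<epsilon> \<and> \<omega> (- s + t) \<le> \<epsilon> * norm c"
    by blast
  have sub: "E - B - B'' \<subseteq> F" using E(4) by blast
  have "E - B - B'' \<in> sets borel" using E(3) B(1) B''m by simp
  with conjI[OF \<open>c \<noteq> 0\<close> conjI[OF sub conjI[OF small all]]] show ?thesis
    by (intro bexI[OF _ E(2)] bexI[OF _ E(1)] bexI[of _ "E - B - B''"])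
qed

text \<open>
  Here \<open>F\<close> is finite and has no small pieces. Instead, the targets \<open>v i\<close> for different \<open>i\<close> are
  reached with different \<open>s\<close>, so one of these \<open>s\<close> moves \<open>F\<close> off itself.
\<close>

lemma mixing_set_atomic:
  assumes atom: "emeasure \<mu> {x} \<noteq> 0"
    and F: "compact F" and t\<^sub>1\<^sub>2: "t\<^sub>1 \<in> F" "t\<^sub>2 \<in> F" "t\<^sub>1 \<noteq> t\<^sub>2" and "0 < \<epsilon>"
  shows "\<exists>s\<in>S. \<exists>c\<in>\<Lambda>. \<exists>E\<in>sets borel. c \<noteq> 0 \<and> E \<subseteq> F \<and> emeasure \<mu> (F - E) < ennreal \<epsilon> \<and>
        (\<forall>t\<in>E. norm c * \<omega> (s + t) \<le> \<epsilon> \<and> \<omega> (- s + t) \<le> \<epsilon> * norm c)"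
proof -
  have Fm[measurable]: "F \<in> sets borel" using F by (rule borel_compact)
  have fin: "finite F" and eq: "\<And>y. emeasure \<mu> {y} = emeasure \<mu> {x}"
    using compact_finite_of_atom[OF F atom] by blast+
  define a where "a = measure \<mu> {x}"
  have ax: "emeasure \<mu> {x} = ennreal a"
    using compact_finite[of "{x}"] unfolding a_def by (intro emeasure_eq_ennreal_measure) simp
  have "a \<noteq> 0" using atom unfolding ax by auto
  then have a: "emeasure \<mu> {x} = ennreal a" "0 < a" using ax by (simp_all add: a_def less_le)
  have eqa: "emeasure \<mu> {y} = ennreal a" for y using eq ax by (rule trans)
  \<comment> \<open>A subset that misses at most half of one point mass misses no point.\<close>
  have full: "E = F" if E: "E \<in> sets borel" "E \<subseteq> F" "emeasure \<mu> (F - E) \<le> ennreal (a / 2)" for E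
  proof (rule ccontr)
    assume "E \<noteq> F"
    then obtain y where "y \<in> F - E" using E(2) by auto
    then have "ennreal a \<le> emeasure \<mu> (F - E)"
      using E(1) emeasure_mono[of "{y}" "F - E" \<mu>] unfolding eqa by (simp add: sets_eq)
    then have "ennreal a \<le> ennreal (a / 2)" using E(3) by (rule order_trans)
    then show False using a by simp
  qed
  have "emeasure \<mu> {t\<^sub>1} \<le> emeasure \<mu> F" using t\<^sub>1\<^sub>2 F by (intro emeasure_mono) (auto simp: compact_sets)
  moreover have "0 < emeasure \<mu> {t\<^sub>1}" using a(2) unfolding eqa by simp
  ultimately have pos: "0 < emeasure \<mu> F" by simp
  have pos4: "0 < \<epsilon> / 4" "0 < a / 2" "0 < (1 / 4 :: real)" using \<open>0 < \<epsilon>\<close> a by auto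
  obtain h where h: "\<And>v. v \<in> bcs \<Longrightarrow> \<exists>c\<in>\<Lambda>. \<exists>s\<in>S. \<exists>E\<in>sets borel.
      E \<subseteq> F \<and> emeasure \<mu> (F - E) \<le> ennreal (a / 2) \<and> (\<forall>t\<in>E.
        norm (h t - 1) < 1 / 4 \<and> norm (c * h (- s + t) - v t) < 1 / 4 \<and>
        norm (h (- s + t) - indicator F (- s + t)) * \<omega> (- s + t) < \<epsilon> / 4 \<and>
        norm (c * h t - v (s + t)) * \<omega> (s + t) < \<epsilon> / 4)"
    by (rule dense_vector_pair[OF adm comm f F pos pos4]) (assumption | rule that)+
  \<comment> \<open>The pair of values at \<open>t\<^sub>1\<close> and \<open>t\<^sub>2\<close>
    encodes \<open>i\<close>.\<close>
  define v :: "nat \<Rightarrow> 'g \<Rightarrow> complex" where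
    "v i t = indicator F t * (if t = t\<^sub>2 then of_real (4 ^ i) else 1)" for i t
  have n4: "norm (of_real (4 ^ i) :: complex) = 4 ^ i" for i unfolding norm_of_real by simp
  have v: "v i \<in> bcs" for i
    unfolding bcs_def
  proof (intro CollectI conjI exI[of _ F] exI[of _ "4 ^ i"] allI impI F)
    show "v i \<in> borel_measurable borel" unfolding v_def by measurable
    show "norm (v i t) \<le> 4 ^ i" for t
      using n4[of i] by (simp add: v_def indicator_def)
  qed (simp_all add: v_def)
  have norm_v: "1 \<le> norm (v i t)" if "t \<in> F" for i t
    using that n4[of i] by (simp add: v_def)
  define G where "G i c s \<longleftrightarrow> (\<forall>t\<in>F.
        norm (h t - 1) < 1 / 4 \<and> norm (c * h (- s + t) - v i t) < 1 / 4 \<and>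
        norm (h (- s + t) - indicator F (- s + t)) * \<omega> (- s + t) < \<epsilon> / 4 \<and>
        norm (c * h t - v i (s + t)) * \<omega> (s + t) < \<epsilon> / 4)" for i c s
  have "\<exists>c s. c \<in> \<Lambda> \<and> s \<in> S \<and> G i c s" for i
  proof -
    obtain c s E where E: "c \<in> \<Lambda>" "s \<in> S" "E \<in> sets borel" "E \<subseteq> F" "emeasure \<mu> (F - E) \<le> ennreal (a / 2)"
      and "\<forall>t\<in>E. norm (h t - 1) < 1 / 4 \<and> norm (c * h (- s + t) - v i t) < 1 / 4 \<and>
        norm (h (- s + t) - indicator F (- s + t)) * \<omega> (- s + t) < \<epsilon> / 4 \<and>
        norm (c * h t - v i (s + t)) * \<omega> (s + t) < \<epsilon> / 4"
      using h[OF v[of i]] by blast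
    moreover have "E = F" using E(3-5) by (rule full)
    ultimately show ?thesis by (intro exI[of _ c] exI[of _ s]) (simp add: G_def)
  qed
  then obtain c s where cs: "\<And>i. c i \<in> \<Lambda>" "\<And>i. s i \<in> S" and G: "\<And>i. G i (c i) (s i)"
    by metis
  have cst: "norm (h t - 1) < 1 / 4 \<and> norm (c i * h (- s i + t) - v i t) < 1 / 4 \<and>
        norm (h (- s i + t) - indicator F (- s i + t)) * \<omega> (- s i + t) < \<epsilon> / 4 \<and>
        norm (c i * h t - v i (s i + t)) * \<omega> (s i + t) < \<epsilon> / 4" if "t \<in> F" for i t
    using G[of i] that unfolding G_def by blast
  \<comment> \<open>Every \<open>s\<close> for which some \<open>s + t\<close> or
    \<open>- s + t\<close> with \<open>t\<close> in \<open>F\<close> returns to \<open>F\<close> is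
    a difference of two points of \<open>F\<close>.\<close>
  define K where "K = (\<lambda>(x, y). x - y) ` (F \<times> F)"
  have "finite K" using fin by (simp add: K_def)
  \<comment> \<open>With equal translations the values of \<open>h\<close> at
    \<open>- s i + t\<^sub>1\<close> and \<open>- s i + t\<^sub>2\<close> are shared and only the
    multipliers may differ; the ratio of these values determines the exponent.\<close>
  have "inj s"
  proof (rule injI)
    fix i j assume ij: "s i = s j"
    have v12: "v k t\<^sub>1 = 1" "v k t\<^sub>2 = of_real (4 ^ k)" for k using t\<^sub>1\<^sub>2 by (simp_all add: v_def)
    have ci: "norm (c k * h (- s k + t\<^sub>1) - 1) < 1 / 4"
      "norm (c k * h (- s k + t\<^sub>2) - of_real (4 ^ k)) < 1 / 4" for k
      using cst[OF t\<^sub>1\<^sub>2(1), of k] cst[OF t\<^sub>1\<^sub>2(2), of k] unfolding v12 by blast+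
    show "i = j"
      using power4_ratio_unique[OF ci[of i] ci[of j, folded ij]] .
  qed
  then have "\<not> range s \<subseteq> K"
    using \<open>finite K\<close> by (meson finite_imageD finite_subset infinite_UNIV_nat)
  then obtain i where i: "s i \<notin> K" by blast
  have "- s i + t \<notin> F" if "t \<in> F" for t
  proof
    assume "- s i + t \<in> F"
    then have "t - (- s i + t) \<in> K" using that unfolding K_def by force
    moreover have "t - (- s i + t) = s i" by (simp add: diff_conv_add_uminus minus_add del: add_uminus_conv_diff)
    ultimately show False using i by simp
  qed
  moreover have "s i + t \<notin> F" if "t \<in> F" for t
  proof
    assume "s i + t \<in> F"
    then have "(s i + t) - t \<in> K" using that unfolding K_def by force
    then show False using i by simp
  qed
  \<comment> \<open>Both shifts move \<open>F\<close> off itself, so the separation assumptions of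
    \<open>separated_bounds\<close> hold vacuously and nothing has to be removed from
    \<open>F\<close>.\<close>
  ultimately have "norm (c i) * \<omega> (s i + t) \<le> \<epsilon> \<and> \<omega> (- s i + t) \<le> \<epsilon> * norm (c i)"
    if "t \<in> F" for t
  proof (intro separated_bounds[where h=h and v="v i" and F=F])
    show "norm (h t - 1) < 1 / 4" "norm (c i * h (- s i + t) - v i t) < 1 / 4"
      "norm (h (- s i + t) - indicator F (- s i + t)) * \<omega> (- s i + t) < \<epsilon> / 4"
      "norm (c i * h t - v i (s i + t)) * \<omega> (s i + t) < \<epsilon> / 4"
      using cst[OF that] by simp_all
    show "v i t' = 0" if "t' \<notin> F" for t' using that by (simp add: v_def)
  qed (use that norm_v in auto)
  then have all: "\<forall>t\<in>F. norm (c i) * \<omega> (s i + t) \<le> \<epsilon> \<and> \<omega> (- s i + t) \<le> \<epsilon> * norm (c i)"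
    by blast
  have "c i \<noteq> 0" using cst[OF t\<^sub>1\<^sub>2(1), of i] norm_v[OF t\<^sub>1\<^sub>2(1)] multiplier_nonzero by blast
  moreover have "emeasure \<mu> (F - F) < ennreal \<epsilon>" using \<open>0 < \<epsilon>\<close> by simp
  ultimately show ?thesis
    using all by (intro bexI[OF _ cs(2)] bexI[OF _ cs(1)] bexI[OF _ Fm] conjI order_refl)
qed

theorem mixing_of_dense_vector:
  assumes "\<not> compact (UNIV :: 'g set)"
  shows "mixing \<Lambda> S"
proof (rule mixingI[OF assms])
  fix F :: "'g set" and \<epsilon> :: real
  assume "compact F" "0 < emeasure \<mu> F" "\<exists>x\<in>F. \<exists>y\<in>F. x \<noteq> y" "0 < \<epsilon>"
  then show "\<exists>s\<in>S. \<exists>c\<in>\<Lambda>. \<exists>E\<in>sets borel. c \<noteq> 0 \<and> E \<subseteq> F \<and> emeasure \<mu> (F - E) < ennreal \<epsilon> \<and>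
        (\<forall>t\<in>E. norm c * \<omega> (s + t) \<le> \<epsilon> \<and> \<omega> (- s + t) \<le> \<epsilon> * norm c)"
    using mixing_set_nonatomic mixing_set_atomic by blast
qed

end


theorem ex_dense_vector_iff_mixing:
  assumes "\<not> compact (UNIV :: 'g set)" "admissible \<mu> S \<omega>"
    and "\<And>r s. r \<in> S \<Longrightarrow> s \<in> S \<Longrightarrow> r + s = s + r"
  shows "(\<exists>f. LS_dense_vector \<mu> p \<omega> \<Lambda> S f) \<longleftrightarrow> mixing \<Lambda> S"
  using mixing_of_dense_vector[OF assms(2,3) _ assms(1)] dense_vector_of_mixing[OF assms(2)] by blast

section \<open>Essential suprema\<close>

lemma esssup_on_le:
  assumes [measurable]: "f \<in> borel_measurable borel" and E: "E \<in> sets borel"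
    and ae: "AE t in \<mu>. t \<in> E \<longrightarrow> f t \<le> c"
  shows "esssup_on \<mu> E f \<le> ennreal c"
  unfolding esssup_on_def
proof (rule esssup_I)
  have "f \<in> borel_measurable \<mu>" by (simp add: measurable_cong_sets[OF sets_eq refl])
  then show "(\<lambda>t. ennreal (f t)) \<in> borel_measurable (restrict_space \<mu> E)"
    by (intro measurable_restrict_space1 measurable_compose[OF _ measurable_ennreal])
  show "AE t in restrict_space \<mu> E. ennreal (f t) \<le> ennreal c"
    using ae E by (subst AE_restrict_space_iff) (auto simp: sets_eq elim!: eventually_mono intro: ennreal_leI)
qed

lemma AE_esssup_on:
  assumes E: "E \<in> sets borel"
  shows "AE t in \<mu>. t \<in> E \<longrightarrow> ennreal (f t) \<le> esssup_on \<mu> E f"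
proof -
  have "AE t in restrict_space \<mu> E. ennreal (f t) \<le> esssup_on \<mu> E f"
    unfolding esssup_on_def by (rule esssup_AE)
  then show ?thesis using E by (subst (asm) AE_restrict_space_iff) (auto simp: sets_eq)
qed

lemma AE_of_esssup_on:
  assumes "E \<in> sets borel" "esssup_on \<mu> E f \<le> ennreal c" "0 \<le> c"
  shows "AE t in \<mu>. t \<in> E \<longrightarrow> f t \<le> c"
  using AE_esssup_on[OF assms(1), of f]
proof eventually_elim
  case (elim t)
  show ?case
  proof
    assume "t \<in> E"
    then have "ennreal (f t) \<le> ennreal c" using elim assms(2) by (blast intro: order_trans)
    then show "f t \<le> c" using assms(3) by simp
  qed
qed

text \<open>Since the weight is positive, the suprema of \<open>\<omega> (s + t)\<close> and
  \<open>\<omega> (- s + t)\<close> can vanish only over a null set, hence only together. This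
  excludes products of 0 with infinity in the conditions.\<close>

lemma esssup_on_eq_0:
  assumes E: "E \<in> sets borel" and f: "\<And>t. 0 < f t" and 0: "esssup_on \<mu> E f = 0"
  shows "AE t in \<mu>. t \<notin> E"
proof -
  have "AE t in \<mu>. t \<in> E \<longrightarrow> f t \<le> 0" using AE_of_esssup_on[OF E, of f 0] 0 by simp
  then show ?thesis by eventually_elim (use f in \<open>auto simp: not_le[symmetric]\<close>)
qed

lemma esssup_on_null:
  assumes E: "E \<in> sets borel" and f: "f \<in> borel_measurable borel" and "AE t in \<mu>. t \<notin> E"
  shows "esssup_on \<mu> E f = 0"
proof -
  have "AE t in \<mu>. t \<in> E \<longrightarrow> f t \<le> 0" using assms(3) by eventually_elim auto
  from esssup_on_le[OF f E this] show ?thesis by simp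
qed

text \<open>\<open>R\<close> stands for any of the four conditions, with \<open>a\<close> and
  \<open>b\<close> the suprema of \<open>\<omega> (s + t)\<close> and
  \<open>\<omega> (- s + t)\<close>. What remains is a question about two numbers: whether some
  scalar satisfies \<open>norm c * a \<le> \<eta>\<close> and
  \<open>b \<le> \<eta> * norm c\<close>.\<close>

lemma mixing_iff_esssup:
  assumes to_sup: "\<And>\<epsilon>. 0 < \<epsilon> \<Longrightarrow> \<exists>\<eta>>0. \<eta> \<le> \<epsilon> \<and> (\<forall>c\<in>\<Lambda>. \<forall>a b. c \<noteq> 0 \<longrightarrow>
      a \<le> ennreal (\<eta> / norm c) \<longrightarrow> b \<le> ennreal (\<eta> * norm c) \<longrightarrow> R a b \<epsilon>)"
    and of_sup: "\<And>\<eta>. 0 < \<eta> \<Longrightarrow> \<exists>\<epsilon>>0. \<epsilon> \<le> \<eta> \<and> (\<forall>a b. (a = 0 \<longleftrightarrow> b = 0) \<longrightarrow> R a b \<epsilon> \<longrightarrow>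
      (\<exists>c\<in>\<Lambda>. c \<noteq> 0 \<and> a \<le> ennreal (\<eta> / norm c) \<and> b \<le> ennreal (\<eta> * norm c)))"
  shows "mixing \<Lambda> S \<longleftrightarrow> (\<forall>F \<epsilon>. compact F \<and> 0 < \<epsilon> \<longrightarrow> (\<exists>s\<in>S. \<exists>E. compact E \<and> E \<subseteq> F \<and>
     emeasure \<mu> (F - E) < ennreal \<epsilon> \<and>
     R (esssup_on \<mu> E (\<lambda>t. \<omega> (s + t))) (esssup_on \<mu> E (\<lambda>t. \<omega> (- s + t))) \<epsilon>))"
    (is "_ \<longleftrightarrow> ?sup")
proof
  have \<omega>m: "(\<lambda>t. \<omega> (r + t)) \<in> borel_measurable borel" for r
    by (rule measurable_compose[OF measurable_translation weight_measurable])
  show ?sup if mix: "mixing \<Lambda> S"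
  proof (intro allI impI, elim conjE)
    fix F :: "'g set" and \<epsilon> :: real assume F: "compact F" and "0 < \<epsilon>"
    obtain \<eta> where \<eta>: "0 < \<eta>" "\<eta> \<le> \<epsilon>" "\<And>c a b. c \<in> \<Lambda> \<Longrightarrow> c \<noteq> 0 \<Longrightarrow>
      a \<le> ennreal (\<eta> / norm c) \<Longrightarrow> b \<le> ennreal (\<eta> * norm c) \<Longrightarrow> R a b \<epsilon>"
      using to_sup[OF \<open>0 < \<epsilon>\<close>] by blast
    obtain s c E where E: "s \<in> S" "c \<in> \<Lambda>" "c \<noteq> 0" "compact E" "E \<subseteq> F"
      "emeasure \<mu> (F - E) < ennreal \<eta>"
      and ae: "AE t in \<mu>. t \<in> E \<longrightarrow> norm c * \<omega> (s + t) \<le> \<eta> \<and> \<omega> (- s + t) \<le> \<eta> * norm c"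
      using mix[unfolded mixing_def] F \<eta>(1) by blast
    have Em: "E \<in> sets borel" using E(4) by (rule borel_compact)
    have "AE t in \<mu>. t \<in> E \<longrightarrow> \<omega> (s + t) \<le> \<eta> / norm c"
      using ae by eventually_elim (use E(3) in \<open>auto simp: pos_le_divide_eq mult.commute\<close>)
    then have a: "esssup_on \<mu> E (\<lambda>t. \<omega> (s + t)) \<le> ennreal (\<eta> / norm c)"
      by (rule esssup_on_le[OF \<omega>m Em])
    have "AE t in \<mu>. t \<in> E \<longrightarrow> \<omega> (- s + t) \<le> \<eta> * norm c"
      using ae by eventually_elim auto
    then have b: "esssup_on \<mu> E (\<lambda>t. \<omega> (- s + t)) \<le> ennreal (\<eta> * norm c)"
      by (rule esssup_on_le[OF \<omega>m Em])
    have "emeasure \<mu> (F - E) < ennreal \<epsilon>"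
      using E(6) ennreal_leI[OF \<eta>(2)] by (rule order_less_le_trans)
    then show "\<exists>s\<in>S. \<exists>E. compact E \<and> E \<subseteq> F \<and> emeasure \<mu> (F - E) < ennreal \<epsilon> \<and>
        R (esssup_on \<mu> E (\<lambda>t. \<omega> (s + t))) (esssup_on \<mu> E (\<lambda>t. \<omega> (- s + t))) \<epsilon>"
      using \<eta>(3)[OF E(2,3) a b] E(4,5) by (intro bexI[OF _ E(1)] exI[of _ E] conjI)
  qed
  show "mixing \<Lambda> S" if sup: ?sup
    unfolding mixing_def
  proof (intro allI impI, elim conjE)
    fix F :: "'g set" and \<eta> :: real assume F: "compact F" and "0 < \<eta>"
    obtain \<epsilon> where \<epsilon>: "0 < \<epsilon>" "\<epsilon> \<le> \<eta>" "\<And>a b. a = 0 \<longleftrightarrow> b = 0 \<Longrightarrow> R a b \<epsilon> \<Longrightarrow>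
      \<exists>c\<in>\<Lambda>. c \<noteq> 0 \<and> a \<le> ennreal (\<eta> / norm c) \<and> b \<le> ennreal (\<eta> * norm c)"
      using of_sup[OF \<open>0 < \<eta>\<close>] by blast
    obtain s E where E: "s \<in> S" "compact E" "E \<subseteq> F" "emeasure \<mu> (F - E) < ennreal \<epsilon>"
      "R (esssup_on \<mu> E (\<lambda>t. \<omega> (s + t))) (esssup_on \<mu> E (\<lambda>t. \<omega> (- s + t))) \<epsilon>"
      using sup[rule_format, OF conjI[OF F \<epsilon>(1)]] by (elim bexE exE conjE)
    have Em: "E \<in> sets borel" using E(2) by (rule borel_compact)
    have "esssup_on \<mu> E (\<lambda>t. \<omega> (s + t)) = 0 \<longleftrightarrow> esssup_on \<mu> E (\<lambda>t. \<omega> (- s + t)) = 0"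
      using esssup_on_eq_0[OF Em weight_pos] esssup_on_null[OF Em \<omega>m] by blast
    from \<epsilon>(3)[OF this E(5)] obtain c where c: "c \<in> \<Lambda>" "c \<noteq> 0"
      "esssup_on \<mu> E (\<lambda>t. \<omega> (s + t)) \<le> ennreal (\<eta> / norm c)"
      "esssup_on \<mu> E (\<lambda>t. \<omega> (- s + t)) \<le> ennreal (\<eta> * norm c)" by (elim bexE conjE)
    have "AE t in \<mu>. t \<in> E \<longrightarrow> \<omega> (s + t) \<le> \<eta> / norm c"
      using \<open>0 < \<eta>\<close> by (intro AE_of_esssup_on[OF Em c(3)]) simp
    moreover have "AE t in \<mu>. t \<in> E \<longrightarrow> \<omega> (- s + t) \<le> \<eta> * norm c"
      using \<open>0 < \<eta>\<close> by (intro AE_of_esssup_on[OF Em c(4)]) simp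
    ultimately have ae: "AE t in \<mu>. t \<in> E \<longrightarrow> norm c * \<omega> (s + t) \<le> \<eta> \<and> \<omega> (- s + t) \<le> \<eta> * norm c"
      by eventually_elim (use c(2) in \<open>auto simp: pos_le_divide_eq mult.commute\<close>)
    have "emeasure \<mu> (F - E) < ennreal \<eta>"
      using E(4) ennreal_leI[OF \<epsilon>(2)] by (rule order_less_le_trans)
    then show "\<exists>s\<in>S. \<exists>c\<in>\<Lambda>. \<exists>E. c \<noteq> 0 \<and> compact E \<and> E \<subseteq> F \<and> emeasure \<mu> (F - E) < ennreal \<eta> \<and>
       (AE t in \<mu>. t \<in> E \<longrightarrow> norm c * \<omega> (s + t) \<le> \<eta> \<and> \<omega> (- s + t) \<le> \<eta> * norm c)"
      using c(2) E(2,3) ae by (intro bexI[OF _ E(1)] bexI[OF _ c(1)] exI[of _ E] conjI)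
  qed
qed

end

text \<open>Prepares a scalar of modulus \<open>\<eta> / a\<close>: it turns
  \<open>a \<le> \<eta> / norm c\<close> into an equality, and the bound on the product gives the
  bound on \<open>b\<close>. Both factors are nonzero, so finiteness of the product makes both
  finite.\<close>

lemma ennreal_balance:
  fixes a b :: ennreal
  assumes "0 < \<eta>" "a \<noteq> 0" "b = 0 \<Longrightarrow> a = 0" "a * b < ennreal \<epsilon>" "\<epsilon> \<le> \<eta> * \<eta>"
  obtains r where "0 < r" "a = ennreal r" "b \<le> ennreal (\<eta> * (\<eta> / r))"
proof -
  have "b \<noteq> 0" using assms(2,3) by blast
  have top: "a \<noteq> top" "b \<noteq> top"
    using assms(2,4) \<open>b \<noteq> 0\<close> by (auto simp: ennreal_top_mult ennreal_mult_top)
  obtain r where r: "0 \<le> r" "a = ennreal r" using top(1) by (cases a) auto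
  obtain q where q: "0 \<le> q" "b = ennreal q" using top(2) by (cases b) auto
  have "0 < r" using assms(2) r by (cases "r = 0") auto
  have "ennreal (r * q) < ennreal \<epsilon>" using assms(4) unfolding r q using r(1) by (simp add: ennreal_mult')
  then have "r * q < \<epsilon>" using \<open>0 < r\<close> q(1) by (simp add: ennreal_less_iff)
  then have "q * r \<le> \<eta> * \<eta>" using assms(5) by (simp add: mult.commute)
  then have "q \<le> \<eta> * (\<eta> / r)" using \<open>0 < r\<close> by (simp add: pos_le_divide_eq)
  then show ?thesis using \<open>0 < r\<close> r(2) q(2) by (intro that[of r]) (auto intro: ennreal_leI)
qed

text \<open>The square serves the product of the suprema; strictness leads from the weak
  inequalities in \<open>mixing\<close> to the strict ones for essential suprema.\<close>

lemma small_quantity: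
  fixes \<epsilon> :: real
  assumes "0 < \<epsilon>"
  obtains \<eta> where "0 < \<eta>" "\<eta> < \<epsilon>" "\<eta> * \<eta> < \<epsilon>"
proof -
  define m where "m = min \<epsilon> 1"
  have m: "0 < m" "m \<le> \<epsilon>" "m \<le> 1" using assms by (simp_all add: m_def)
  have "m / 2 * (m / 2) \<le> m / 2 * 1" using m by (intro mult_left_mono) auto
  then have "m / 2 * (m / 2) < \<epsilon>" using m by linarith
  then show ?thesis using m by (intro that[of "m / 2"]) auto
qed

lemma ennreal_scaled_product_less:
  assumes "a \<le> ennreal (\<eta> / x)" "b \<le> ennreal (\<eta> * x)" "0 < x" "0 < \<eta>" "\<eta> * \<eta> < \<epsilon>"
  shows "a * b < ennreal \<epsilon>"
proof -
  have "a * b \<le> ennreal (\<eta> / x) * ennreal (\<eta> * x)" using assms by (intro mult_mono) auto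
  also have "\<dots> = ennreal (\<eta> * \<eta>)" using assms by (simp flip: ennreal_mult')
  also have "\<dots> < ennreal \<epsilon>" using assms by (simp add: ennreal_less_iff)
  finally show ?thesis .
qed

lemma ennreal_less_of_le:
  "a \<le> ennreal x \<Longrightarrow> x \<le> y \<Longrightarrow> y < z \<Longrightarrow> 0 < y \<Longrightarrow> a < ennreal z"
  by (meson ennreal_leI ennreal_lessI order.strict_trans order_le_less_trans)

section \<open>The four sets of scalars\<close>

context weighted_Lp
begin

lemma mixing_1_iff:
  "mixing {1} S \<longleftrightarrow> (\<forall>F \<epsilon>. compact F \<and> 0 < \<epsilon> \<longrightarrow> (\<exists>s\<in>S. \<exists>E. compact E \<and> E \<subseteq> F \<and>
     emeasure \<mu> (F - E) < ennreal \<epsilon> \<and> esssup_on \<mu> E (\<lambda>t. \<omega> (s + t)) < ennreal \<epsilon> \<and>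
     esssup_on \<mu> E (\<lambda>t. \<omega> (- s + t)) < ennreal \<epsilon>))"
proof (rule mixing_iff_esssup[where R="\<lambda>a b \<epsilon>. a < ennreal \<epsilon> \<and> b < ennreal \<epsilon>"])
  fix \<epsilon> :: real assume "0 < \<epsilon>"
  then obtain \<eta> where "0 < \<eta>" "\<eta> < \<epsilon>" "\<eta> * \<eta> < \<epsilon>" by (rule small_quantity)
  then show "\<exists>\<eta>>0. \<eta> \<le> \<epsilon> \<and> (\<forall>c\<in>{1 :: complex}. \<forall>a b. c \<noteq> 0 \<longrightarrow> a \<le> ennreal (\<eta> / norm c) \<longrightarrow>
      b \<le> ennreal (\<eta> * norm c) \<longrightarrow> a < ennreal \<epsilon> \<and> b < ennreal \<epsilon>)"
    by (intro exI[of _ \<eta>]) (auto intro: ennreal_less_of_le)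
next
  fix \<eta> :: real assume "0 < \<eta>"
  then show "\<exists>\<epsilon>>0. \<epsilon> \<le> \<eta> \<and> (\<forall>a b. (a = 0 \<longleftrightarrow> b = 0) \<longrightarrow> a < ennreal \<epsilon> \<and> b < ennreal \<epsilon> \<longrightarrow>
      (\<exists>c\<in>{1 :: complex}. c \<noteq> 0 \<and> a \<le> ennreal (\<eta> / norm c) \<and> b \<le> ennreal (\<eta> * norm c)))"
    by (intro exI[of _ \<eta>]) auto
qed

lemma mixing_le_1_iff:
  "mixing (complex_of_real ` {0..1}) S \<longleftrightarrow> (\<forall>F \<epsilon>. compact F \<and> 0 < \<epsilon> \<longrightarrow> (\<exists>s\<in>S. \<exists>E. compact E \<and> E \<subseteq> F \<and>
     emeasure \<mu> (F - E) < ennreal \<epsilon> \<and> esssup_on \<mu> E (\<lambda>t. \<omega> (- s + t)) < ennreal \<epsilon> \<and>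
     esssup_on \<mu> E (\<lambda>t. \<omega> (s + t)) * esssup_on \<mu> E (\<lambda>t. \<omega> (- s + t)) < ennreal \<epsilon>))"
proof (rule mixing_iff_esssup[where R="\<lambda>a b \<epsilon>. b < ennreal \<epsilon> \<and> a * b < ennreal \<epsilon>"])
  fix \<epsilon> :: real assume "0 < \<epsilon>"
  then obtain \<eta> where \<eta>: "0 < \<eta>" "\<eta> < \<epsilon>" "\<eta> * \<eta> < \<epsilon>" by (rule small_quantity)
  have "b < ennreal \<epsilon> \<and> a * b < ennreal \<epsilon>"
    if "c \<in> complex_of_real ` {0..1}" "c \<noteq> 0" "a \<le> ennreal (\<eta> / norm c)" "b \<le> ennreal (\<eta> * norm c)" for a b c
  proof
    have "norm c \<le> 1" using that(1) by auto
    then have "\<eta> * norm c \<le> \<eta>" using mult_left_mono[of "norm c" 1 \<eta>] \<eta>(1) by simp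
    then show "b < ennreal \<epsilon>" by (rule ennreal_less_of_le[OF that(4) _ \<eta>(2,1)])
    show "a * b < ennreal \<epsilon>"
      using ennreal_scaled_product_less[OF that(3,4) _ \<eta>(1,3)] that(2) by simp
  qed
  then show "\<exists>\<eta>>0. \<eta> \<le> \<epsilon> \<and> (\<forall>c\<in>complex_of_real ` {0..1}. \<forall>a b. c \<noteq> 0 \<longrightarrow> a \<le> ennreal (\<eta> / norm c) \<longrightarrow>
      b \<le> ennreal (\<eta> * norm c) \<longrightarrow> b < ennreal \<epsilon> \<and> a * b < ennreal \<epsilon>)"
    using \<eta>(1,2) by (intro exI[of _ \<eta>] conjI ballI allI impI) (simp_all add: less_imp_le)
next
  fix \<eta> :: real assume "0 < \<eta>"
  define \<epsilon> where "\<epsilon> = min \<eta> (\<eta> * \<eta>)"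
  have \<epsilon>: "0 < \<epsilon>" "\<epsilon> \<le> \<eta>" "\<epsilon> \<le> \<eta> * \<eta>" using \<open>0 < \<eta>\<close> by (simp_all add: \<epsilon>_def)
  have "\<exists>c\<in>complex_of_real ` {0..1}. c \<noteq> 0 \<and> a \<le> ennreal (\<eta> / norm c) \<and> b \<le> ennreal (\<eta> * norm c)"
    if ab: "a = 0 \<longleftrightarrow> b = 0" "b < ennreal \<epsilon>" "a * b < ennreal \<epsilon>" for a b
  \<comment> \<open>If \<open>a\<close> is small, \<open>c = 1\<close> works; otherwise
    \<open>c = \<eta> / a\<close> is below 1.\<close>
  proof (cases "a \<le> ennreal \<eta>")
    case True
    have "b \<le> ennreal \<eta>" using ab(2) ennreal_leI[OF \<epsilon>(2)] by (meson less_imp_le order_trans)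
    moreover have "1 \<in> complex_of_real ` {0..1}" by (rule image_eqI[of _ _ 1]) simp_all
    ultimately show ?thesis using True by (intro bexI[of _ 1]) simp_all
  next
    case False
    then have "a \<noteq> 0" by auto
    from ab(1) have "b = 0 \<Longrightarrow> a = 0" by simp
    from ennreal_balance[OF \<open>0 < \<eta>\<close> \<open>a \<noteq> 0\<close> this ab(3) \<epsilon>(3)]
    obtain r where r: "0 < r" "a = ennreal r" "b \<le> ennreal (\<eta> * (\<eta> / r))" by metis
    have "\<eta> < r" using False r by (simp add: not_le ennreal_less_iff \<open>0 < \<eta>\<close> less_imp_le)
    moreover have "norm (complex_of_real (\<eta> / r)) = \<eta> / r" using r(1) \<open>0 < \<eta>\<close> unfolding norm_of_real by simp
    moreover have "\<eta> / r \<in> {0..1}" using \<open>\<eta> < r\<close> r(1) \<open>0 < \<eta>\<close> by simp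
    moreover have "\<eta> / (\<eta> / r) = r" using \<open>0 < \<eta>\<close> by simp
    ultimately show ?thesis
      using r \<open>0 < \<eta>\<close> by (intro bexI[of _ "complex_of_real (\<eta> / r)"] conjI imageI) simp_all
  qed
  then show "\<exists>\<epsilon>>0. \<epsilon> \<le> \<eta> \<and> (\<forall>a b. (a = 0 \<longleftrightarrow> b = 0) \<longrightarrow> b < ennreal \<epsilon> \<and> a * b < ennreal \<epsilon> \<longrightarrow>
      (\<exists>c\<in>complex_of_real ` {0..1}. c \<noteq> 0 \<and> a \<le> ennreal (\<eta> / norm c) \<and> b \<le> ennreal (\<eta> * norm c)))"
    using \<epsilon>(1,2) by (intro exI[of _ \<epsilon>] conjI allI impI) simp_all
qed

lemma mixing_ge_1_iff:
  "mixing (complex_of_real ` {1..}) S \<longleftrightarrow> (\<forall>F \<epsilon>. compact F \<and> 0 < \<epsilon> \<longrightarrow> (\<exists>s\<in>S. \<exists>E. compact E \<and> E \<subseteq> F \<and>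
     emeasure \<mu> (F - E) < ennreal \<epsilon> \<and> esssup_on \<mu> E (\<lambda>t. \<omega> (s + t)) < ennreal \<epsilon> \<and>
     esssup_on \<mu> E (\<lambda>t. \<omega> (s + t)) * esssup_on \<mu> E (\<lambda>t. \<omega> (- s + t)) < ennreal \<epsilon>))"
proof (rule mixing_iff_esssup[where R="\<lambda>a b \<epsilon>. a < ennreal \<epsilon> \<and> a * b < ennreal \<epsilon>"])
  fix \<epsilon> :: real assume "0 < \<epsilon>"
  then obtain \<eta> where \<eta>: "0 < \<eta>" "\<eta> < \<epsilon>" "\<eta> * \<eta> < \<epsilon>" by (rule small_quantity)
  have "a < ennreal \<epsilon> \<and> a * b < ennreal \<epsilon>"
    if "c \<in> complex_of_real ` {1..}" "c \<noteq> 0" "a \<le> ennreal (\<eta> / norm c)" "b \<le> ennreal (\<eta> * norm c)" for a b c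
  proof
    have "1 \<le> norm c" using that(1) by auto
    then have "\<eta> / norm c \<le> \<eta> / 1" using \<eta>(1) by (intro divide_left_mono) auto
    then show "a < ennreal \<epsilon>" using that(3) \<eta> by (auto intro: ennreal_less_of_le)
    show "a * b < ennreal \<epsilon>"
      using ennreal_scaled_product_less[OF that(3,4) _ \<eta>(1,3)] that(2) by simp
  qed
  then show "\<exists>\<eta>>0. \<eta> \<le> \<epsilon> \<and> (\<forall>c\<in>complex_of_real ` {1..}. \<forall>a b. c \<noteq> 0 \<longrightarrow> a \<le> ennreal (\<eta> / norm c) \<longrightarrow>
      b \<le> ennreal (\<eta> * norm c) \<longrightarrow> a < ennreal \<epsilon> \<and> a * b < ennreal \<epsilon>)"
    using \<eta>(1,2) by (intro exI[of _ \<eta>] conjI ballI allI impI) (simp_all add: less_imp_le)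
next
  fix \<eta> :: real assume "0 < \<eta>"
  define \<epsilon> where "\<epsilon> = min \<eta> (\<eta> * \<eta>)"
  have \<epsilon>: "0 < \<epsilon>" "\<epsilon> \<le> \<eta>" "\<epsilon> \<le> \<eta> * \<eta>" using \<open>0 < \<eta>\<close> by (simp_all add: \<epsilon>_def)
  have "\<exists>c\<in>complex_of_real ` {1..}. c \<noteq> 0 \<and> a \<le> ennreal (\<eta> / norm c) \<and> b \<le> ennreal (\<eta> * norm c)"
    if ab: "a = 0 \<longleftrightarrow> b = 0" "a < ennreal \<epsilon>" "a * b < ennreal \<epsilon>" for a b
  \<comment> \<open>The suprema exchange roles: a large \<open>b\<close> calls for
    \<open>c = b / \<eta>\<close>, which exceeds 1.\<close>
  proof (cases "b \<le> ennreal \<eta>")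
    case True
    have "a \<le> ennreal \<eta>" using ab(2) ennreal_leI[OF \<epsilon>(2)] by (meson less_imp_le order_trans)
    with True show ?thesis by (intro bexI[of _ 1]) (auto simp: image_iff)
  next
    case False
    then have "b \<noteq> 0" by auto
    then obtain r where r: "0 < r" "b = ennreal r" "a \<le> ennreal (\<eta> * (\<eta> / r))"
      using ennreal_balance[OF \<open>0 < \<eta>\<close>, of b a \<epsilon>] ab \<epsilon>(3) by (metis mult.commute)
    have "\<eta> < r" using False r by (simp add: not_le ennreal_less_iff \<open>0 < \<eta>\<close> less_imp_le)
    moreover have "norm (complex_of_real (r / \<eta>)) = r / \<eta>" using r(1) \<open>0 < \<eta>\<close> unfolding norm_of_real by simp
    ultimately show ?thesis
      using r \<open>0 < \<eta>\<close> by (intro bexI[of _ "complex_of_real (r / \<eta>)"] conjI imageI) auto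
  qed
  then show "\<exists>\<epsilon>>0. \<epsilon> \<le> \<eta> \<and> (\<forall>a b. (a = 0 \<longleftrightarrow> b = 0) \<longrightarrow> a < ennreal \<epsilon> \<and> a * b < ennreal \<epsilon> \<longrightarrow>
      (\<exists>c\<in>complex_of_real ` {1..}. c \<noteq> 0 \<and> a \<le> ennreal (\<eta> / norm c) \<and> b \<le> ennreal (\<eta> * norm c)))"
    using \<epsilon>(1,2) by (intro exI[of _ \<epsilon>] conjI allI impI) simp_all
qed

lemma mixing_UNIV_iff:
  "mixing UNIV S \<longleftrightarrow> (\<forall>F \<epsilon>. compact F \<and> 0 < \<epsilon> \<longrightarrow> (\<exists>s\<in>S. \<exists>E. compact E \<and> E \<subseteq> F \<and>
     emeasure \<mu> (F - E) < ennreal \<epsilon> \<and>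
     esssup_on \<mu> E (\<lambda>t. \<omega> (s + t)) * esssup_on \<mu> E (\<lambda>t. \<omega> (- s + t)) < ennreal \<epsilon>))"
proof (rule mixing_iff_esssup[where R="\<lambda>a b \<epsilon>. a * b < ennreal \<epsilon>"])
  fix \<epsilon> :: real assume "0 < \<epsilon>"
  then obtain \<eta> where \<eta>: "0 < \<eta>" "\<eta> < \<epsilon>" "\<eta> * \<eta> < \<epsilon>" by (rule small_quantity)
  then show "\<exists>\<eta>>0. \<eta> \<le> \<epsilon> \<and> (\<forall>c\<in>UNIV. \<forall>a b. c \<noteq> 0 \<longrightarrow> a \<le> ennreal (\<eta> / norm (c :: complex)) \<longrightarrow>
      b \<le> ennreal (\<eta> * norm c) \<longrightarrow> a * b < ennreal \<epsilon>)"
    by (intro exI[of _ \<eta>] conjI ballI allI impI)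
      (simp_all add: less_imp_le ennreal_scaled_product_less)
next
  fix \<eta> :: real assume "0 < \<eta>"
  define \<epsilon> where "\<epsilon> = min \<eta> (\<eta> * \<eta>)"
  have \<epsilon>: "0 < \<epsilon>" "\<epsilon> \<le> \<eta>" "\<epsilon> \<le> \<eta> * \<eta>" using \<open>0 < \<eta>\<close> by (simp_all add: \<epsilon>_def)
  have "\<exists>c\<in>UNIV. c \<noteq> 0 \<and> a \<le> ennreal (\<eta> / norm (c :: complex)) \<and> b \<le> ennreal (\<eta> * norm c)"
    if ab: "a = 0 \<longleftrightarrow> b = 0" "a * b < ennreal \<epsilon>" for a b
  proof (cases "a = 0")
    case True
    with ab(1) show ?thesis by (intro bexI[of _ 1]) auto
  next
    case False
    then obtain r where r: "0 < r" "a = ennreal r" "b \<le> ennreal (\<eta> * (\<eta> / r))"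
      using ennreal_balance[OF \<open>0 < \<eta>\<close>, of a b \<epsilon>] ab \<epsilon>(3) by metis
    moreover have "norm (complex_of_real (\<eta> / r)) = \<eta> / r" using r(1) \<open>0 < \<eta>\<close> unfolding norm_of_real by simp
    ultimately show ?thesis
      using \<open>0 < \<eta>\<close> by (intro bexI[of _ "complex_of_real (\<eta> / r)"] conjI) auto
  qed
  then show "\<exists>\<epsilon>>0. \<epsilon> \<le> \<eta> \<and> (\<forall>a b. (a = 0 \<longleftrightarrow> b = 0) \<longrightarrow> a * b < ennreal \<epsilon> \<longrightarrow>
      (\<exists>c\<in>UNIV. c \<noteq> 0 \<and> a \<le> ennreal (\<eta> / norm (c :: complex)) \<and> b \<le> ennreal (\<eta> * norm c)))"
    using \<epsilon>(1,2) by (intro exI[of _ \<epsilon>] conjI allI impI) simp_all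
qed

end

lemma S_dense_vector_iff_LS: "S_dense_vector \<mu> p \<omega> S f \<longleftrightarrow> LS_dense_vector \<mu> p \<omega> {1} S f"
proof -
  have "{(\<lambda>t. c * translate s f t) |c s. c \<in> {1} \<and> s \<in> S} = {translate s f |s. s \<in> S}"
    by auto
  then show ?thesis by (simp only: S_dense_vector_def LS_dense_vector_def)
qed

theorem corollary6p2:
  fixes \<mu> :: "'g::{topological_group_add, t2_space, second_countable_topology} measure"
    and S :: "'g set" and p :: real and \<omega> :: "'g \<Rightarrow> real"
  assumes "locally_compact_space (euclidean :: 'g topology)"
    and "\<not> compact (UNIV :: 'g set)"
    and "left_haar_measure \<mu>"
    and "1 \<le> p"
    and "weight \<mu> \<omega>"
    and "locally_p_integrable \<mu> p \<omega>"
    and "admissible \<mu> S \<omega>"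
    and "abelian_set (generated_subgroup S)"
  shows
   "((\<exists>f. S_dense_vector \<mu> p \<omega> S f) \<longleftrightarrow>
        (\<forall>F \<epsilon>. compact F \<and> 0 < \<epsilon> \<longrightarrow> (\<exists>s\<in>S. \<exists>E. compact E \<and> E \<subseteq> F \<and>
            emeasure \<mu> (F - E) < ennreal \<epsilon> \<and>
            esssup_on \<mu> E (\<lambda>t. \<omega> (s + t)) < ennreal \<epsilon> \<and>
            esssup_on \<mu> E (\<lambda>t. \<omega> (- s + t)) < ennreal \<epsilon>))) \<and>
    ((\<exists>f. LS_dense_vector \<mu> p \<omega> (complex_of_real ` {0..1}) S f) \<longleftrightarrow>
        (\<forall>F \<epsilon>. compact F \<and> 0 < \<epsilon> \<longrightarrow> (\<exists>s\<in>S. \<exists>E. compact E \<and> E \<subseteq> F \<and>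
            emeasure \<mu> (F - E) < ennreal \<epsilon> \<and>
            esssup_on \<mu> E (\<lambda>t. \<omega> (- s + t)) < ennreal \<epsilon> \<and>
            esssup_on \<mu> E (\<lambda>t. \<omega> (s + t)) * esssup_on \<mu> E (\<lambda>t. \<omega> (- s + t)) < ennreal \<epsilon>))) \<and>
    ((\<exists>f. LS_dense_vector \<mu> p \<omega> (complex_of_real ` {1..}) S f) \<longleftrightarrow>
        (\<forall>F \<epsilon>. compact F \<and> 0 < \<epsilon> \<longrightarrow> (\<exists>s\<in>S. \<exists>E. compact E \<and> E \<subseteq> F \<and>
            emeasure \<mu> (F - E) < ennreal \<epsilon> \<and>
            esssup_on \<mu> E (\<lambda>t. \<omega> (s + t)) < ennreal \<epsilon> \<and>
            esssup_on \<mu> E (\<lambda>t. \<omega> (s + t)) * esssup_on \<mu> E (\<lambda>t. \<omega> (- s + t)) < ennreal \<epsilon>))) \<and>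
    ((\<exists>f. LS_dense_vector \<mu> p \<omega> UNIV S f) \<longleftrightarrow>
        (\<forall>F \<epsilon>. compact F \<and> 0 < \<epsilon> \<longrightarrow> (\<exists>s\<in>S. \<exists>E. compact E \<and> E \<subseteq> F \<and>
            emeasure \<mu> (F - E) < ennreal \<epsilon> \<and>
            esssup_on \<mu> E (\<lambda>t. \<omega> (s + t)) * esssup_on \<mu> E (\<lambda>t. \<omega> (- s + t)) < ennreal \<epsilon>)))"
proof -
  interpret weighted_Lp \<mu> p \<omega>
    by unfold_locales (fact assms)+
  have comm: "r + s = s + r" if "r \<in> S" "s \<in> S" for r s
    using that assms(8) hull_subset[of S add_subgroup]
    unfolding abelian_set_def generated_subgroup_def by blast
  have dense: "(\<exists>f. LS_dense_vector \<mu> p \<omega> \<Lambda> S f) \<longleftrightarrow> mixing \<Lambda> S" for \<Lambda>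
    by (rule ex_dense_vector_iff_mixing[OF assms(2,7)]) (rule comm)
  show ?thesis
    unfolding S_dense_vector_iff_LS dense
    by (rule conjI[OF mixing_1_iff conjI[OF mixing_le_1_iff conjI[OF mixing_ge_1_iff mixing_UNIV_iff]]])
qed

end
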